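(* For every $\varepsilon>0$ there exists $m=m(\varepsilon)\in\mathbb N$ such that for all sufficiently large even $n\in\mathbb N$ the following holds. Let $\pi_1,\dots,\pi_{2m}$ be independent uniformly random permutations of $[n]$ and let $\mathcal C_{DA}$ and $\mathcal C_{AD}$ be the resulting rate $1/2$ codes $R(DA)^m$ and $R(AD)^m$ of block-length $n$. Then, except with probability at most $n^{1/2-m/4}=1/\mathrm{poly}(n)$ (in particular $1/2-m/4<0$), both codes have relative minimum distance at least $\delta^{(\mathrm{GV})}(1/2)-\varepsilon$. Moreover, the encoding function of either code can be computed by a Boolean circuit of size $2m(n-1)$, and alternatively by a Boolean circuit of size $O(mn)$ and depth $O(m\log n)$.
   Context: Let $n$ be even. $F_2\in\mathbb F_2^{n\times n/2}$ is the repetition matrix: $(F_2)_{ij}=1$ iff $\lceil i/2\rceil=j$. $A\in\mathbb F_2^{n\times n}$ is the accumulator matrix, $A_{ij}=1$ iff $i\ge j$. $D\in\mathbb F_2^{n\times n}$ is the discrete derivative matrix, $D_{ij}=1$ iff $j=i$ or $j=i-1$. For a permutation $\pi$ of $[n]$, $M_\pi$ is the permutation matrix with $(M_\pi)_{ij}=1$ iff $\pi(i)=j$. The code $R(DA)^m$ (rate $1/2$) has encoding map $x\mapsto Gx$, $x\in\mathbb F_2^{n/2}$, with $$G=AM_{\pi_{2m}}DM_{\pi_{2m-1}}\cdots AM_{\pi_2}DM_{\pi_1}F_2,$$ and the code $R(AD)^m$ has encoding map $x\mapsto Hx$ with $$H=D^\top M_{\pi_{2m}}A^\top M_{\pi_{2m-1}}\cdots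 D^\top M_{\pi_2}A^\top M_{\pi_1}F_2 .$$ (These two codes are dual to each other; replacing $A^\top,D^\top$ by $A,D$ does not change the distribution of weights.) The relative minimum distance of a linear code is the minimum fraction of nonzero coordinates of a nonzero codeword. $\delta^{(\mathrm{GV})}(1/2)=h^{-1}(1/2)\approx0.1100$, where $h$ is the binary entropy function (base 2) and $h^{-1}$ takes values in $[0,1/2]$. Circuits are Boolean circuits with arbitrary fan-in 2 gates (repeating and permuting wires is free). *)

theory Defs
  imports
    "HOL-Library.Z2"
    "HOL-Combinatorics.Permutations"
    "HOL-Probability.Product_PMF"
    "Jordan_Normal_Form.Matrix"
begin

text \<open>Matrices over \<open>\<F>\<^sub>2\<close> (the type \<^typ>\<open>bit\<close>). Indices start at \<open>0\<close>, so the
  1-based condition \<open>\<lceil>i/2\<rceil> = j\<close> reads \<open>i div 2 = j\<close>, and permutations act on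
  \<open>{..<n}\<close>.\<close>

definition repetition_mat :: "nat \<Rightarrow> bit mat" where
  "repetition_mat n = mat n (n div 2) (\<lambda>(i, j). of_bool (i div 2 = j))"

definition accumulator_mat :: "nat \<Rightarrow> bit mat" where
  "accumulator_mat n = mat n n (\<lambda>(i, j). of_bool (j \<le> i))"

definition derivative_mat :: "nat \<Rightarrow> bit mat" where
  "derivative_mat n = mat n n (\<lambda>(i, j). of_bool (j = i \<or> j + 1 = i))"

definition perm_mat :: "nat \<Rightarrow> (nat \<Rightarrow> nat) \<Rightarrow> bit mat" where
  "perm_mat n p = mat n n (\<lambda>(i, j). of_bool (p i = j))"

text \<open>The permutations keep their numbering \<open>\<pi> 1, \<dots>, \<pi> (2 * m)\<close>; the factors of
  larger index stand further to the left.\<close>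

fun RDA_mat :: "nat \<Rightarrow> (nat \<Rightarrow> nat \<Rightarrow> nat) \<Rightarrow> nat \<Rightarrow> bit mat" where
  "RDA_mat n \<pi> 0 = repetition_mat n"
| "RDA_mat n \<pi> (Suc m) =
     accumulator_mat n * (perm_mat n (\<pi> (2 * m + 2)) *
     (derivative_mat n * (perm_mat n (\<pi> (2 * m + 1)) * RDA_mat n \<pi> m)))"

fun RAD_mat :: "nat \<Rightarrow> (nat \<Rightarrow> nat \<Rightarrow> nat) \<Rightarrow> nat \<Rightarrow> bit mat" where
  "RAD_mat n \<pi> 0 = repetition_mat n"
| "RAD_mat n \<pi> (Suc m) =
     transpose_mat (derivative_mat n) * (perm_mat n (\<pi> (2 * m + 2)) *
     (transpose_mat (accumulator_mat n) * (perm_mat n (\<pi> (2 * m + 1)) * RAD_mat n \<pi> m)))"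

definition linear_code :: "bit mat \<Rightarrow> bit vec set" where
  "linear_code G = (\<lambda>x. G *\<^sub>v x) ` carrier_vec (dim_col G)"

definition relative_weight :: "bit vec \<Rightarrow> real" where
  "relative_weight v = real (card {i. i < dim_vec v \<and> v $ i \<noteq> 0}) / real (dim_vec v)"

definition relative_min_distance :: "bit vec set \<Rightarrow> real" where
  "relative_min_distance C = Min (relative_weight ` {v \<in> C. v \<noteq> 0\<^sub>v (dim_vec v)})"

definition binary_entropy :: "real \<Rightarrow> real" where
  "binary_entropy p = - p * log 2 p - (1 - p) * log 2 (1 - p)"

definition GV_distance :: "real \<Rightarrow> real" where
  "GV_distance r = inv_into {0..1/2} binary_entropy (1 - r)"

text \<open>Independent uniform permutations \<open>\<pi> 1, \<dots>, \<pi> k\<close> of \<open>{..<n}\<close>; outside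
  \<open>{1..k}\<close> the family takes the irrelevant value \<^term>\<open>id\<close>.\<close>

definition random_permutations :: "nat \<Rightarrow> nat \<Rightarrow> (nat \<Rightarrow> nat \<Rightarrow> nat) pmf" where
  "random_permutations n k = Pi_pmf {1..k} id (\<lambda>_. pmf_of_set {p. p permutes {..<n}})"

text \<open>A circuit is a straight-line program. Wires \<open>0, \<dots>, k - 1\<close> carry the \<open>k\<close> inputs,
  and wire \<open>k + l\<close> carries the output of gate number \<open>l\<close>. A gate is an arbitrary
  binary operation with two earlier wires as arguments. Any list of wires may be
  declared as the output, so repeating and permuting wires costs nothing.\<close>

datatype gate = Gate (gate_op: "bit \<Rightarrow> bit \<Rightarrow> bit") (gate_left: nat) (gate_right: nat)

datatype circuit = Circuit (inputs: nat) (gates: "gate list") (outputs: "nat list")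

definition wf_circuit :: "circuit \<Rightarrow> bool" where
  "wf_circuit c \<longleftrightarrow>
     (\<forall>l < length (gates c). gate_left (gates c ! l) < inputs c + l \<and>
                             gate_right (gates c ! l) < inputs c + l) \<and>
     (\<forall>w \<in> set (outputs c). w < inputs c + length (gates c))"

definition circuit_size :: "circuit \<Rightarrow> nat" where
  "circuit_size c = length (gates c)"

definition wire_values :: "gate list \<Rightarrow> bit list \<Rightarrow> bit list" where
  "wire_values gs xs =
     foldl (\<lambda>ws g. ws @ [gate_op g (ws ! gate_left g) (ws ! gate_right g)]) xs gs"

definition circuit_eval :: "circuit \<Rightarrow> bit vec \<Rightarrow> bit vec" where
  "circuit_eval c x =
     vec_of_list (map (\<lambda>w. wire_values (gates c) (list_of_vec x) ! w) (outputs c))"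

definition wire_depths :: "gate list \<Rightarrow> nat \<Rightarrow> nat list" where
  "wire_depths gs k =
     foldl (\<lambda>ds g. ds @ [Suc (max (ds ! gate_left g) (ds ! gate_right g))]) (replicate k 0) gs"

text \<open>The inserted \<open>0\<close> only matters for a circuit without any wires.\<close>

definition circuit_depth :: "circuit \<Rightarrow> nat" where
  "circuit_depth c = Max (insert 0 (set (wire_depths (gates c) (inputs c))))"

definition computes_encoding :: "circuit \<Rightarrow> bit mat \<Rightarrow> bool" where
  "computes_encoding c G \<longleftrightarrow> wf_circuit c \<and> inputs c = dim_col G \<and>
     (\<forall>x \<in> carrier_vec (dim_col G). circuit_eval c x = G *\<^sub>v x)"

end

theory Submission
  imports Defs "HOL-Real_Asymp.Real_Asymp"
begin

text \<open>
  After a uniformly random permutation only the Hamming weight matters, so an accumulator step is a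
  Markov chain on weights. Let \<open>T u w\<close> (\<open>trans_count\<close>) be the number of vectors of weight \<open>u\<close> that the
  accumulator maps to weight \<open>w\<close>. The accumulator moves from \<open>u\<close> to \<open>w\<close> with probability
  \<open>T u w / (n choose u)\<close> and the derivative, its inverse, moves from \<open>w\<close> to \<open>u\<close> with probability
  \<open>T u w / (n choose w)\<close>; hence both leave the measure \<open>w \<mapsto> n choose w\<close> invariant. By the union
  bound over all inputs it suffices to bound the expected number of codewords of weight below \<open>\<delta> n\<close>,
  where \<open>\<delta>\<close> has entropy \<open>h \<delta> < 1/2\<close>.

  Paths of weights that meet a balanced weight \<open>w\<close>, close to \<open>n/2\<close>, are harmless: by invariance such
  a path ends below \<open>\<delta> n\<close> with probability at most \<open>(\<Sum>v < \<delta> n. n choose v) / (n choose w)\<close>, about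
  \<open>2 powr (n (h \<delta> - 1))\<close>, which is exponentially smaller than one over the number \<open>2 powr (n/2)\<close> of
  inputs. On all other paths an accumulator step leads to an unbalanced weight, which is exponentially
  unlikely in the weight. Conjugation with the square root of \<open>n choose w\<close> turns both steps into the
  same symmetric kernel \<open>T u w / sqrt ((n choose u) (n choose w))\<close>, whose row and column sums away from
  the balanced weights are at most \<open>n powr (-1/4)\<close>, so a round gains \<open>n powr (-1/2)\<close>. Boundedly many
  rounds bring the probability of having stayed unbalanced below a fixed power of \<open>n\<close> divided by
  \<open>sqrt (n choose w)\<close>, and at most \<open>sqrt (n choose w)\<close> inputs lead to a repetition of weight \<open>w\<close>.
\<close>

unbundle no vec_syntax

subsection \<open>Weight transitions of the accumulator\<close>

text \<open>The trivial bound 1 on the survival probability leaves \<open>sqrt (n choose w)\<close>,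
  which can be exponentially large, and a gain of \<open>n powr (-1/2)\<close> per round cannot
  remove that in boundedly many rounds. Hence a bootstrap. Weights within a small constant fraction
  of \<open>n\<close> from \<open>0\<close> or \<open>n\<close> are settled by two rounds: up to
  polynomial factors survival has probability \<open>C ^ wbar n w / (n choose w)\<close>, which is
  below \<open>1 / sqrt (n choose w)\<close> there. Kernel entries into the other unbalanced weights
  are exponentially small in \<open>n\<close>, so a number of rounds depending only on \<eta>
  cancels the initial \<open>exp n\<close>. Only then does the polynomial gain take over. Bounded
  weights limit it: a single one can be accumulated to weight \<open>n\<close>, and
  \<open>T 1 n / sqrt (n * 1) = n powr (-1/2)\<close>. The row and column bound
  \<open>n powr (-1/4)\<close> gives up half of this exponent to absorb absolute constants. Likewise
  only \<open>m/4\<close> of the \<open>m/2\<close> gained in \<open>m\<close> rounds appears in the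
  claim; the rest pays for the bootstrap rounds and the polynomial factors.\<close>

definition deriv_set :: "nat \<Rightarrow> nat set \<Rightarrow> nat set" where
  "deriv_set n Y = {i. i < n \<and> (i \<in> Y) \<noteq> (0 < i \<and> i - 1 \<in> Y)}"

definition accum_set :: "nat \<Rightarrow> nat set \<Rightarrow> nat set" where
  "accum_set n X = {i. i < n \<and> odd (card {j \<in> X. j \<le> i})}"

definition trans_count :: "nat \<Rightarrow> nat \<Rightarrow> nat \<Rightarrow> nat" where
  "trans_count n u w = card {Y. Y \<subseteq> {..<n} \<and> card Y = w \<and> card (deriv_set n Y) = u}"

lemma deriv_set_subset: "deriv_set n Y \<subseteq> {..<n}"
  by (auto simp: deriv_set_def)

lemma accum_set_subset: "accum_set n X \<subseteq> {..<n}"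
  by (auto simp: accum_set_def)

lemma finite_deriv_set [simp]: "finite (deriv_set n Y)"
  using deriv_set_subset finite_subset by blast

lemma finite_accum_set [simp]: "finite (accum_set n Y)"
  using accum_set_subset finite_subset by blast

lemma deriv_set_Suc:
  "deriv_set (Suc n) Y =
     (if (n \<in> Y) \<noteq> (0 < n \<and> n - 1 \<in> Y) then insert n (deriv_set n Y) else deriv_set n Y)"
  by (auto simp: deriv_set_def less_Suc_eq)

lemma deriv_set_insert: "deriv_set n (insert n Y) = deriv_set n Y"
  by (auto simp: deriv_set_def)

lemma notin_deriv_set [simp]: "n \<notin> deriv_set n Y"
  by (auto simp: deriv_set_def)

text \<open>The implicit zero in front of position \<open>0\<close> makes the number of changes
  telescope: its parity is the last bit. So the recursion on \<open>n\<close> carries no boundary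
  bit along; \<open>u\<close> determines it.\<close>

lemma odd_card_deriv_set: "odd (card (deriv_set n Y)) \<longleftrightarrow> 0 < n \<and> n - 1 \<in> Y"
proof (induction n)
  case 0
  then show ?case by (auto simp: deriv_set_def)
next
  case (Suc n)
  then show ?case by (auto simp: deriv_set_Suc)
qed

lemma card_deriv_set_Suc:
  "card (deriv_set (Suc n) Y) =
     card (deriv_set n Y) + of_bool ((n \<in> Y) \<noteq> odd (card (deriv_set n Y)))"
  unfolding odd_card_deriv_set by (auto simp: deriv_set_Suc)

lemma trans_count_eq_0: "n < w \<Longrightarrow> trans_count n u w = 0"
proof -
  assume "n < w"
  hence "{Y. Y \<subseteq> {..<n} \<and> card Y = w \<and> card (deriv_set n Y) = u} = {}"
    by (auto dest: card_mono[rotated])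
  thus ?thesis by (simp add: trans_count_def)
qed

lemma trans_count_w0: "trans_count n u 0 = of_bool (u = 0)"
proof -
  have "{Y. Y \<subseteq> {..<n} \<and> card Y = 0 \<and> card (deriv_set n Y) = u} = (if u = 0 then {{}} else {})"
    by (auto simp: deriv_set_def dest: finite_subset)
  thus ?thesis by (simp add: trans_count_def)
qed

text \<open>The last position is cut off. The parity of \<open>u\<close> decides whether
  \<open>n\<close> lies in \<open>Y\<close>, so either all sets counted on the left contain it and
  lose one unit of weight, or all avoid it. The terms \<open>u\<close> and \<open>u - 1\<close>
  distinguish whether the derivative vanishes at \<open>n\<close>.\<close>

lemma trans_count_Suc:
  "trans_count (Suc n) u w =
     (if even u then trans_count n u w + (if u = 0 then 0 else trans_count n (u - 1) w)
      else if w = 0 then 0 else trans_count n u (w - 1) + trans_count n (u - 1) (w - 1))"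
proof -
  define E where "E n u w = {Y. Y \<subseteq> {..<n} \<and> card Y = w \<and> card (deriv_set n Y) = u}" for n u w
  have fin: "finite (E n u w)" for n u w
    unfolding E_def by (rule finite_subset[of _ "Pow {..<n}"]) auto
  have tc: "trans_count n u w = card (E n u w)" for n u w
    by (simp add: trans_count_def E_def)
  have finY: "finite Y" if "Y \<subseteq> {..<n}" for Y using that finite_subset by blast
  have sub: "Y \<subseteq> {..<Suc n} \<longleftrightarrow> (if n \<in> Y then Y - {n} \<subseteq> {..<n} else Y \<subseteq> {..<n})" for Y
    by (force simp: less_Suc_eq lessThan_Suc)
  have disj: "E n u w \<inter> E n (u-1) w = {}" if "u > 0" for u w
    using that by (auto simp: E_def)
  show ?thesis
  proof (cases "even u")
    case True
    have "E (Suc n) u w = E n u w \<union> (if u = 0 then {} else E n (u-1) w)"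
      using True by (auto simp: E_def card_deriv_set_Suc sub split: if_splits)
    thus ?thesis
      using True disj[of u w] fin unfolding tc by (auto simp: card_Un_disjoint)
  next
    case False
    hence u: "u > 0" by (rule odd_pos)
    show ?thesis
    proof (cases "w = 0")
      case True
      thus ?thesis using False u by (auto simp: trans_count_w0)
    next
      case w: False
      have "E (Suc n) u w = insert n ` (E n u (w-1) \<union> E n (u-1) (w-1))" (is "_ = ?R")
      proof (intro equalityI subsetI)
        fix Y assume Y: "Y \<in> E (Suc n) u w"
        hence nY: "n \<in> Y" using False
          by (auto simp: E_def card_deriv_set_Suc split: if_splits)
        have s: "Y - {n} \<subseteq> {..<n}" using Y nY by (auto simp: E_def less_Suc_eq)
        have c: "card (Y - {n}) = w - 1" using Y nY finY[OF s] by (auto simp: E_def)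
        have d: "deriv_set n (Y - {n}) = deriv_set n Y"
          using deriv_set_insert[of n "Y - {n}"] nY by (simp add: insert_absorb)
        have "card (deriv_set n Y) = u \<or> card (deriv_set n Y) = u - 1"
          using Y False by (auto simp: E_def card_deriv_set_Suc split: if_splits)
        hence "Y - {n} \<in> E n u (w-1) \<union> E n (u-1) (w-1)"
          using s c d by (auto simp: E_def)
        moreover have "Y = insert n (Y - {n})" using nY by blast
        ultimately show "Y \<in> ?R" by blast
      next
        fix Y assume "Y \<in> ?R"
        then obtain Z where Z: "Y = insert n Z" "Z \<in> E n u (w-1) \<union> E n (u-1) (w-1)" by blast
        have s: "Z \<subseteq> {..<n}" using Z by (auto simp: E_def)
        have "n \<notin> Z" using s by auto
        hence "card Y = w" using Z w finY[OF s] by (auto simp: E_def)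
        moreover have "card (deriv_set (Suc n) Y) = u"
          using Z False u by (auto simp: E_def card_deriv_set_Suc deriv_set_insert)
        ultimately show "Y \<in> E (Suc n) u w" using Z s by (auto simp: E_def)
      qed
      moreover have "inj_on (insert n) (E n u (w-1) \<union> E n (u-1) (w-1))"
      proof (rule inj_onI)
        fix X Y assume "X \<in> E n u (w-1) \<union> E n (u-1) (w-1)" "Y \<in> E n u (w-1) \<union> E n (u-1) (w-1)"
          and eq: "insert n X = insert n Y"
        hence "n \<notin> X" "n \<notin> Y" by (auto simp: E_def)
        thus "X = Y" using eq by (simp add: insert_ident)
      qed
      ultimately show ?thesis
        using False w fin disj[of u "w-1"] u unfolding tc
        by (auto simp: card_image card_Un_disjoint)
    qed
  qed
qed

lemma trans_count_u0: "trans_count n 0 w = of_bool (w = 0)"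
proof (induction n)
  case 0
  show ?case by (cases "w = 0") (auto simp: trans_count_w0 trans_count_eq_0)
qed (simp add: trans_count_Suc)

text \<open>A vector with \<open>u\<close> changes has \<open>(u + 1) div 2\<close> runs of ones and
  \<open>u div 2\<close> runs of zeros besides a possibly empty initial one. Counting compositions
  of \<open>w\<close> and of \<open>n - w\<close> gives this product, in fact with equality. The
  induction is Pascal's rule, in the zeros for even \<open>u\<close> and in the ones for odd
  \<open>u\<close>.\<close>

lemma trans_count_le:
  assumes "1 \<le> u" "1 \<le> w" "w \<le> n"
  shows "trans_count n u w \<le> ((n - w) choose (u div 2)) * ((w - 1) choose ((u - 1) div 2))"
  using assms
proof (induction n arbitrary: u w)
  case 0
  then show ?case by simp
next
  case (Suc n)
  show ?case
  proof (cases "even u")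
    case True
    then obtain c where c: "u = 2 * c" by (elim evenE)
    then obtain a where a: "u = 2 * Suc a" using Suc.prems by (cases c) auto
    have e: "u - 1 = 2 * a + 1" "u div 2 = Suc a" "(u - 1) div 2 = a" "(u - 1 - 1) div 2 = a" "(u-1) div 2 = a"
      using a by auto
    show ?thesis
    proof (cases "w \<le> n")
      case w: True
      have "trans_count n u w \<le> ((n - w) choose Suc a) * ((w - 1) choose a)"
        using Suc.IH[of u w] Suc.prems w e by simp
      moreover have "trans_count n (u - 1) w \<le> ((n - w) choose a) * ((w - 1) choose a)"
        using Suc.IH[of "2 * a + 1" w] Suc.prems w a by simp
      moreover have "Suc n - w = Suc (n - w)" using w by simp
      ultimately show ?thesis using True a e by (simp add: trans_count_Suc algebra_simps)
    next
      case False
      thus ?thesis using True a by (simp add: trans_count_Suc trans_count_eq_0)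
    qed
  next
    case False
    then obtain a where a: "u = 2 * a + 1" by (elim oddE)
    obtain v where v: "w = Suc v" using Suc.prems by (cases w) auto
    show ?thesis
    proof (cases "v = 0")
      case True
      thus ?thesis using a v by (auto simp: trans_count_Suc trans_count_w0)
    next
      case False
      have 1: "trans_count n u v \<le> ((n - v) choose a) * ((v - 1) choose a)"
        using Suc.IH[of u v] Suc.prems a v False by simp
      show ?thesis
      proof (cases a)
        case 0
        thus ?thesis using 1 a v False by (simp add: trans_count_Suc trans_count_u0)
      next
        case (Suc b)
        have 2: "trans_count n (2 * a) v \<le> ((n - v) choose a) * ((v - 1) choose b)"
          using Suc.IH[of "2 * a" v] Suc.prems a v False Suc by simp
        have "trans_count (Suc n) u w = trans_count n u v + trans_count n (2 * a) v"
          using a v by (simp add: trans_count_Suc)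
        also have "\<dots> \<le> ((n - v) choose a) * ((v - 1) choose a) + ((n - v) choose a) * ((v - 1) choose b)"
          using 1 2 by (rule add_mono)
        finally have "trans_count (Suc n) u w \<le> ((n - v) choose a) * (((v - 1) choose a) + ((v - 1) choose b))"
          by (simp only: add_mult_distrib2)
        moreover have "v choose a = ((v - 1) choose a) + ((v - 1) choose b)"
          using False Suc by (cases v) auto
        ultimately show ?thesis using a v by simp
      qed
    qed
  qed
qed

section \<open>Accumulation and differentiation as inverse bijections on supports\<close>

lemma odd_card_prefix:
  fixes X :: "nat set"
  assumes "finite X"
  shows "odd (card {j \<in> X. j \<le> i}) \<longleftrightarrow> (i \<in> X) \<noteq> (0 < i \<and> odd (card {j \<in> X. j \<le> i - 1}))"
proof (cases i)
  case 0
  hence "{j \<in> X. j \<le> i} = (if 0 \<in> X then {0} else {})" by auto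
  thus ?thesis using 0 by simp
next
  case (Suc k)
  have "{j \<in> X. j \<le> Suc k} = (if Suc k \<in> X then insert (Suc k) {j \<in> X. j \<le> k} else {j \<in> X. j \<le> k})"
    by (auto simp: le_Suc_eq)
  thus ?thesis using Suc assms by simp
qed

lemma deriv_accum_set:
  assumes "X \<subseteq> {..<n}"
  shows "deriv_set n (accum_set n X) = X"
proof -
  have "finite X" using assms finite_subset by blast
  hence "i \<in> deriv_set n (accum_set n X) \<longleftrightarrow> i \<in> X" if "i < n" for i
    using that odd_card_prefix[of X i] unfolding deriv_set_def accum_set_def by simp fastforce
  thus ?thesis using assms deriv_set_subset by blast
qed

lemma accum_deriv_set:
  assumes "Y \<subseteq> {..<n}"
  shows "accum_set n (deriv_set n Y) = Y"
proof -
  have "i < n \<Longrightarrow> odd (card {j \<in> deriv_set n Y. j \<le> i}) \<longleftrightarrow> i \<in> Y" for i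
  proof (induction i)
    case 0
    have "0 \<in> deriv_set n Y \<longleftrightarrow> 0 \<in> Y" using 0 by (auto simp: deriv_set_def)
    then show ?case using odd_card_prefix[of "deriv_set n Y" 0] by simp
  next
    case (Suc i)
    have "Suc i \<in> deriv_set n Y \<longleftrightarrow> (Suc i \<in> Y) \<noteq> (i \<in> Y)" using Suc by (auto simp: deriv_set_def)
    then show ?case using Suc odd_card_prefix[of "deriv_set n Y" "Suc i"] by auto
  qed
  thus ?thesis using assms by (auto simp: accum_set_def)
qed

lemma trans_count_accum:
  "card {X. X \<subseteq> {..<n} \<and> card X = u \<and> card (accum_set n X) = w} = trans_count n u w"
  unfolding trans_count_def
proof (rule bij_betw_same_card[of "accum_set n"], rule bij_betw_byWitness[where f' = "deriv_set n"])
qed (auto simp: accum_deriv_set deriv_accum_set deriv_set_subset[THEN subsetD, THEN lessThan_iff[THEN iffD1]]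
   accum_set_subset[THEN subsetD, THEN lessThan_iff[THEN iffD1]])

lemma sum_trans_count_left: "(\<Sum>u\<le>n. trans_count n u w) = n choose w"
proof -
  have fin: "finite {Y. Y \<subseteq> {..<n} \<and> card Y = w}" by (rule finite_subset[of _ "Pow {..<n}"]) auto
  have "card {Y. Y \<subseteq> {..<n} \<and> card Y = w} =
      (\<Sum>u\<in>{..n}. card {Y \<in> {Y. Y \<subseteq> {..<n} \<and> card Y = w}. card (deriv_set n Y) = u})"
    using fin card_mono[OF _ deriv_set_subset]
    by (subst card_eq_sum, subst sum.group[where T = "{..n}" and g = "\<lambda>Y. card (deriv_set n Y)" , symmetric]) auto
  also have "card {Y. Y \<subseteq> {..<n} \<and> card Y = w} = n choose w" by (subst n_subsets) auto
  finally show ?thesis by (simp add: trans_count_def conj_assoc)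
qed

lemma sum_trans_count_right: "(\<Sum>w\<le>n. trans_count n u w) = n choose u"
proof -
  have fin: "finite {Y. Y \<subseteq> {..<n} \<and> card Y = u}" by (rule finite_subset[of _ "Pow {..<n}"]) auto
  have "card {Y. Y \<subseteq> {..<n} \<and> card Y = u} =
      (\<Sum>w\<in>{..n}. card {Y \<in> {Y. Y \<subseteq> {..<n} \<and> card Y = u}. card (accum_set n Y) = w})"
    using fin card_mono[OF _ accum_set_subset]
    by (subst card_eq_sum, subst sum.group[where T = "{..n}" and g = "\<lambda>Y. card (accum_set n Y)" , symmetric]) auto
  also have "card {Y. Y \<subseteq> {..<n} \<and> card Y = u} = n choose u" by (subst n_subsets) auto
  finally show ?thesis by (simp add: trans_count_accum[symmetric] conj_assoc)
qed

subsection \<open>Bounds on the number of transitions\<close>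

lemma Suc_mult_choose_Suc: "Suc k * (n choose Suc k) = (n - k) * (n choose k)"
  by (metis binomial_absorb_comp binomial_absorption)

lemma choose_le_power: "n choose k \<le> n ^ k"
  by (cases "k \<le> n") (auto simp: binomial_le_pow binomial_eq_0)

lemma choose_mult_choose_le: "(m choose a) * (n choose b) \<le> (m + n) choose (a + b)"
proof -
  have "(m choose a) * (n choose (a + b - a)) \<le> (\<Sum>k\<le>a+b. (m choose k) * (n choose (a + b - k)))"
    by (rule member_le_sum) auto
  thus ?thesis by (simp add: vandermonde)
qed

text \<open>With \<open>w = h + d\<close>, passing from \<open>a\<close> to \<open>a + 1\<close>
  multiplies the left side by a quotient with numerator
  \<open>(h - d - a) * (h + d - a) = (h - a)^2 - d^2\<close>, which is at most
  \<open>(1 - d^2 / h^2) * (h - a)^2\<close>. The base on the right is just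
  \<open>1 - d^2 / h^2\<close>, so every unit of \<open>a\<close> gains the full factor against the
  central case \<open>d = 0\<close>.\<close>

lemma choose_mult_choose_le_half:
  assumes n: "n = 2 * h" and w: "w \<le> n"
  shows "real (((n - w) choose a) * (w choose a))
           \<le> (4 * real w * real (n - w) / real n ^ 2) ^ a * real (h choose a) ^ 2"
proof (induction a)
  case 0
  then show ?case by simp
next
  case (Suc a)
  let ?p = "4 * real w * real (n - w) / real n ^ 2"
  have p0: "?p \<ge> 0" by simp
  show ?case
  proof (cases "a < w \<and> a < n - w")
    case False
    hence "((n - w) choose Suc a) * (w choose Suc a) = 0" by (auto simp: not_less binomial_eq_0)
    thus ?thesis using p0 by (simp only: of_nat_0) (intro mult_nonneg_nonneg zero_le_power; simp)
  next
    case True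
    hence ah: "a < h" "h > 0" using n w by auto
    define x where "x = real h"
    define d where "d = real w - real h"
    define y where "y = real a"
    have x: "x > 0" "y < x" "0 \<le> y" using ah by (auto simp: x_def y_def)
    have wv: "real w = x + d" "real (n - w) = x - d" "real n = 2 * x"
      using n w by (auto simp: x_def d_def of_nat_diff)
    have "0 \<le> x + d" "0 \<le> x - d" using wv(1,2) by (metis of_nat_0_le_iff)+
    hence "\<bar>d\<bar> \<le> \<bar>x\<bar>" by (simp add: abs_le_iff)
    hence d: "d\<^sup>2 \<le> x\<^sup>2" by (simp only: abs_le_square_iff)
    have step: "real (n - w - a) * real (w - a) \<le> ?p * real (h - a) ^ 2"
    proof -
      have eq: "real (n - w - a) = x - d - y" "real (w - a) = x + d - y" "real (h - a) = x - y"
        using True ah wv by (auto simp: of_nat_diff y_def x_def)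
      have peq: "?p = (x\<^sup>2 - d\<^sup>2) / x\<^sup>2"
        unfolding wv using x by (simp add: power2_eq_square field_simps)
      have "(x - y)^2 \<le> x^2" using x by (intro power_mono) auto
      hence "d^2 * (x - y)^2 \<le> d^2 * x^2" by (intro mult_left_mono) auto
      hence "(x - d - y) * (x + d - y) * x^2 \<le> (x^2 - d^2) * (x - y)^2"
        by (simp add: power2_eq_square algebra_simps)
      thus ?thesis unfolding eq peq using x by (simp add: field_simps)
    qed
    have e1: "real (Suc a) * real ((n - w) choose Suc a) = real (n - w - a) * real ((n - w) choose a)"
      using Suc_mult_choose_Suc[of a "n - w"] by (metis of_nat_mult)
    have e2: "real (Suc a) * real (w choose Suc a) = real (w - a) * real (w choose a)"
      using Suc_mult_choose_Suc[of a w] by (metis of_nat_mult)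
    have e3: "real (Suc a) * real (h choose Suc a) = real (h - a) * real (h choose a)"
      using Suc_mult_choose_Suc[of a h] by (metis of_nat_mult)
    have "real (Suc a) ^ 2 * real (((n - w) choose Suc a) * (w choose Suc a))
       = (real (Suc a) * real ((n - w) choose Suc a)) * (real (Suc a) * real (w choose Suc a))"
      by (simp add: power2_eq_square algebra_simps)
    also have "\<dots> = (real (n - w - a) * real (w - a)) * real (((n - w) choose a) * (w choose a))"
      unfolding e1 e2 by simp
    also have "\<dots> \<le> (?p * real (h - a) ^ 2) * (?p ^ a * real (h choose a) ^ 2)"
    proof (rule mult_mono)
      show "real (n - w - a) * real (w - a) \<le> ?p * real (h - a) ^ 2" by (rule step)
      show "real (((n - w) choose a) * (w choose a)) \<le> ?p ^ a * real (h choose a) ^ 2" by (rule Suc.IH)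
    qed (use p0 in \<open>auto simp del: of_nat_mult\<close>)
    also have "\<dots> = ?p ^ Suc a * (real (h - a) * real (h choose a)) ^ 2"
      by (simp add: power_mult_distrib)
    also have "\<dots> = real (Suc a) ^ 2 * (?p ^ Suc a * real (h choose Suc a) ^ 2)"
      unfolding e3[symmetric] by (simp only: power_mult_distrib mult_ac)
    finally show ?thesis
      by (subst (asm) mult_le_cancel_left_pos) (auto simp del: of_nat_Suc of_nat_mult)
  qed
qed

lemma trans_count_le_right: "w \<le> n \<Longrightarrow> trans_count n u w \<le> n choose w"
proof (cases "u \<le> n")
  case True
  thus ?thesis unfolding sum_trans_count_left[symmetric] by (intro member_le_sum) auto
next
  case False
  have "{Y. Y \<subseteq> {..<n} \<and> card Y = w \<and> card (deriv_set n Y) = u} = {}"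
    using False card_mono[OF _ deriv_set_subset, of n] by fastforce
  hence "trans_count n u w = 0" unfolding trans_count_def by (simp only: card.empty)
  thus ?thesis by simp
qed

lemma trans_count_le_left: "trans_count n u w \<le> n choose u"
proof (cases "w \<le> n")
  case True
  thus ?thesis unfolding sum_trans_count_right[symmetric] by (intro member_le_sum) auto
qed (simp add: trans_count_eq_0)

text \<open>\<open>(h choose a)^2 \<le> n choose (2 * a)\<close> turns the estimate by half lengths
  into a binomial coefficient of \<open>n\<close>. For odd \<open>u\<close> that coefficient belongs
  to \<open>u - 1\<close>, and passing to \<open>u\<close> costs the factor \<open>n\<close>. The
  base equals \<open>1 - 4 * (w/n - 1/2)^2\<close>, hence stays away from 1 off the balanced
  weights.\<close>

lemma trans_count_le_choose:
  assumes n: "n = 2 * h" and u: "1 \<le> u" "u \<le> n" and w: "1 \<le> w" "w \<le> n"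
  shows "real (trans_count n u w)
           \<le> real n * (4 * real w * real (n - w) / real n ^ 2) ^ (u div 2) * real (n choose u)"
proof -
  let ?p = "4 * real w * real (n - w) / real n ^ 2" and ?a = "u div 2"
  have n1: "n \<ge> 1" using u by simp
  have "(w - 1) choose ((u - 1) div 2) \<le> w choose ?a"
  proof (cases "even u")
    case True
    then obtain c where c: "u = 2 * c" by (elim evenE)
    then obtain b where "u = 2 * Suc b" using u by (cases c) auto
    moreover obtain v where "w = Suc v" using w by (cases w) auto
    ultimately show ?thesis by simp
  next
    case False
    then obtain b where "u = 2 * b + 1" by (elim oddE)
    thus ?thesis by (simp add: binomial_right_mono)
  qed
  hence "trans_count n u w \<le> ((n - w) choose ?a) * (w choose ?a)"
    using trans_count_le[OF u(1) w] by (meson le_trans mult_le_mono2)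
  hence "real (trans_count n u w) \<le> real (((n - w) choose ?a) * (w choose ?a))" by linarith
  also have "\<dots> \<le> ?p ^ ?a * real (h choose ?a) ^ 2"
    using choose_mult_choose_le_half[OF n w(2)] .
  finally have T: "real (trans_count n u w) \<le> ?p ^ ?a * real (h choose ?a) ^ 2" .
  have "real (h choose ?a) ^ 2 \<le> real (n choose (2 * ?a))"
    using choose_mult_choose_le[of h ?a h ?a] n
    by (simp add: power2_eq_square mult_2 flip: of_nat_mult)
  also have "real (n choose (2 * ?a)) \<le> real n * real (n choose u)"
  proof (cases "even u")
    case True
    thus ?thesis using n1 by (simp add: mult_le_cancel_right1)
  next
    case False
    then obtain b where b: "u = Suc (2 * b)" by (elim oddE) auto
    have "n choose (2 * b) \<le> (n - 2 * b) * (n choose (2 * b))" using b u by simp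
    also have "\<dots> = u * (n choose u)" using Suc_mult_choose_Suc[of "2*b" n] b by simp
    also have "\<dots> \<le> n * (n choose u)" using u by simp
    finally show ?thesis using b by (simp flip: of_nat_mult)
  qed
  finally have "?p ^ ?a * real (h choose ?a) ^ 2 \<le> ?p ^ ?a * (real n * real (n choose u))"
    by (rule mult_left_mono) simp
  with T have "real (trans_count n u w) \<le> ?p ^ ?a * (real n * real (n choose u))"
    by (rule order_trans)
  thus ?thesis by (simp only: mult_ac)
qed

section \<open>Ratios of binomial coefficients and folded weights\<close>

lemma choose_ratio:
  assumes "\<And>i. j \<le> i \<Longrightarrow> i < j + k \<Longrightarrow> c * real (Suc i) \<le> real n - real i" and "0 \<le> c"
  shows "c ^ k * real (n choose j) \<le> real (n choose (j + k))"
  using assms(1)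
proof (induction k)
  case 0
  then show ?case by simp
next
  case (Suc k)
  let ?i = "j + k"
  have c: "c * real (Suc ?i) \<le> real (n - ?i)" using Suc.prems[of ?i] by linarith
  have "real (Suc ?i) * (c ^ Suc k * real (n choose j)) = c * real (Suc ?i) * (c ^ k * real (n choose j))"
    by simp
  also have "\<dots> \<le> real (n - ?i) * real (n choose ?i)"
    using Suc.IH Suc.prems c assms(2) by (intro mult_mono) auto
  also have "\<dots> = real (Suc ?i) * real (n choose Suc ?i)"
    using Suc_mult_choose_Suc[of ?i n] by (metis of_nat_mult)
  finally show ?case by (simp del: of_nat_Suc)
qed

text \<open>The weight folded at \<open>n / 2\<close>. Both \<open>n choose w\<close> and the
  distance from balance depend on \<open>w\<close> only through it, so weights near \<open>n\<close>
  are as dangerous as weights near \<open>0\<close>.\<close>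

definition wbar :: "nat \<Rightarrow> nat \<Rightarrow> nat" where
  "wbar n w = min w (n - w)"

lemma wbar_le: "2 * wbar n w \<le> n" "wbar n w \<le> w" "wbar n w \<le> n" "wbar n w \<le> n - w"
  by (auto simp: wbar_def)

lemma choose_wbar: "w \<le> n \<Longrightarrow> n choose wbar n w = n choose w"
  by (auto simp: wbar_def min_def binomial_symmetric[symmetric])

text \<open>Either \<open>u\<close> is below a third of \<open>wbar n w\<close>, and then sets of
  size \<open>u\<close> are exponentially rarer than sets of size \<open>w\<close>, or
  \<open>u\<close> is large enough for the factor gained by an accumulator step from
  \<open>u\<close> to be exponentially small in \<open>wbar n w\<close>. Binomial coefficients at
  least double per step below \<open>n / 3\<close>, which covers the way from \<open>v\<close> to
  \<open>2 * v\<close> for \<open>v = wbar n w div 3\<close>. The 6 is this 3 times the 2 of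
  \<open>u div 2\<close>.\<close>

lemma choose_or_power_small:
  assumes r: "0 < r" "r < 1" and w: "w \<le> n"
  defines "q \<equiv> max r (1/2)"
  shows "real (n choose u) \<le> q ^ (wbar n w div 6) * real (n choose w) \<or> r ^ (u div 2) \<le> q ^ (wbar n w div 6)"
proof (cases "u < wbar n w div 3")
  case False
  hence "wbar n w div 6 \<le> u div 2" by linarith
  hence "r ^ (u div 2) \<le> r ^ (wbar n w div 6)" using r by (intro power_decreasing) auto
  also have "\<dots> \<le> q ^ (wbar n w div 6)" using r by (intro power_mono) (auto simp: q_def)
  finally show ?thesis ..
next
  case True
  let ?v = "wbar n w div 3"
  have six: "6 * ?v \<le> n" using wbar_le(1)[of n w] by linarith
  have "n choose u \<le> n choose ?v" using True six by (intro binomial_mono) auto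
  hence "real (n choose u) \<le> real (n choose ?v)" by simp
  also have "\<dots> \<le> (1/2) ^ ?v * real (n choose (?v + ?v))"
  proof -
    have "2 ^ ?v * real (n choose ?v) \<le> real (n choose (?v + ?v))"
      using six by (intro choose_ratio) auto
    thus ?thesis by (simp add: field_simps)
  qed
  also have "\<dots> \<le> (1/2) ^ ?v * real (n choose wbar n w)"
    using wbar_le(1)[of n w] by (intro mult_left_mono of_nat_mono binomial_mono) auto
  also have "\<dots> \<le> q ^ (wbar n w div 6) * real (n choose wbar n w)"
  proof (intro mult_right_mono)
    have "(1/2::real) ^ ?v \<le> (1/2) ^ (wbar n w div 6)" by (intro power_decreasing) auto
    also have "\<dots> \<le> q ^ (wbar n w div 6)" by (intro power_mono) (auto simp: q_def)
    finally show "(1/2::real) ^ ?v \<le> q ^ (wbar n w div 6)" .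
  qed auto
  finally show ?thesis using choose_wbar[OF w] by simp
qed

text \<open>One of the two binomials that count the runs has its top bounded by
  \<open>wbar n w\<close> and is at most \<open>2 ^ wbar n w\<close>; the other is controlled by a
  power of \<open>n\<close> over a factorial. The factorial is kept on the left because it later
  cancels the one in \<open>opK_surv_1_le\<close>.\<close>

lemma trans_count_fact_le:
  assumes u: "1 \<le> u" and w: "1 \<le> w" "w \<le> n"
  shows "trans_count n u w * fact (u div 2) \<le> 2 ^ wbar n w * n ^ (u div 2)"
    and "trans_count n u w \<noteq> 0 \<Longrightarrow> u div 2 \<le> wbar n w"
proof -
  let ?a = "u div 2" and ?b = "(u - 1) div 2"
  note T = trans_count_le[OF u w]
  have ab: "?a = ?b \<or> ?a = Suc ?b" using u by linarith
  show le: "?a \<le> wbar n w" if "trans_count n u w \<noteq> 0"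
  proof -
    have "((n - w) choose ?a) * ((w - 1) choose ?b) \<noteq> 0" using T that by linarith
    hence "(n - w) choose ?a \<noteq> 0" "(w - 1) choose ?b \<noteq> 0" by (metis mult_0 mult_0_right)+
    hence "?a \<le> n - w" "?b \<le> w - 1" by (auto simp: binomial_eq_0_iff not_less)
    thus ?thesis using ab w by (auto simp: wbar_def)
  qed
  show "trans_count n u w * fact ?a \<le> 2 ^ wbar n w * n ^ ?a"
  proof (cases "trans_count n u w = 0")
    case False
    note a = le[OF this]
    show ?thesis
    proof (cases "w \<le> n - w")
      case True
      have "((n - w) choose ?a) * fact ?a \<le> n ^ ?a"
        using binomial_fact_pow[of "n-w" ?a] power_mono[of "n-w" n ?a] by simp
      moreover have "(w - 1) choose ?b \<le> 2 ^ wbar n w"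
        using order_trans[OF binomial_le_pow2[of "w-1" ?b] power_increasing[of "w-1" w "2::nat"]] True
        by (simp add: wbar_def)
      ultimately have "(((n - w) choose ?a) * fact ?a) * ((w - 1) choose ?b) \<le> n ^ ?a * 2 ^ wbar n w"
        by (intro mult_le_mono)
      moreover have "trans_count n u w * fact ?a \<le> (((n - w) choose ?a) * ((w - 1) choose ?b)) * fact ?a"
        using T by (intro mult_le_mono) auto
      ultimately show ?thesis by (simp only: mult_ac)
    next
      case wn: False
      have 1: "(n - w) choose ?a \<le> 2 ^ wbar n w"
        using binomial_le_pow2[of "n-w" ?a] wn by (simp add: wbar_def)
      have 2: "((w - 1) choose ?b) * fact ?b \<le> n ^ ?b"
        using order_trans[OF binomial_fact_pow[of "w-1" ?b] power_mono[of "w-1" n ?b]] w by simp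
      have 3: "((w - 1) choose ?b) * fact ?a \<le> n ^ ?a"
      proof (cases "?a = ?b")
        case False
        hence s: "?a = Suc ?b" using ab by simp
        have "?a \<le> n" using a wbar_le(3)[of n w] by linarith
        have "((w - 1) choose ?b) * fact ?a = ?a * (((w - 1) choose ?b) * fact ?b)"
          unfolding s fact_Suc by (simp only: of_nat_id mult_ac)
        also have "\<dots> \<le> n * n ^ ?b" using 2 \<open>?a \<le> n\<close> by (intro mult_le_mono)
        finally show ?thesis using s by simp
      qed (use 2 in simp)
      have "((n - w) choose ?a) * (((w - 1) choose ?b) * fact ?a) \<le> 2 ^ wbar n w * n ^ ?a"
        using 1 3 by (intro mult_le_mono)
      moreover have "trans_count n u w * fact ?a \<le> (((n - w) choose ?a) * ((w - 1) choose ?b)) * fact ?a"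
        using T by (intro mult_le_mono) auto
      ultimately show ?thesis by (simp only: mult_ac)
    qed
  qed simp
qed

text \<open>For bounded weights the gain of a step is only polynomial: a factor \<open>n powr (-1/2)\<close> after
  symmetrisation.\<close>

lemma trans_count_small_weights:
  assumes u: "1 \<le> u" "u \<le> 15" "u \<le> n" and w: "1 \<le> w" "w \<le> n" and wb: "wbar n w \<le> 21"
  shows "real (trans_count n u w) ^ 2 * real n
           \<le> (15^15 * real (n choose u)) * 2^42 * (21^21 * real (n choose w))"
proof -
  let ?a = "u div 2" and ?b = "(u - 1) div 2" and ?v = "wbar n w"
  note T = trans_count_le[OF u(1) w]
  have n1: "n \<ge> 1" using u by simp
  have pow: "real n ^ k \<le> real c ^ c * real (n choose k)" if "k \<le> c" "k \<le> n" for k c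
  proof (cases "k = 0")
    case True
    thus ?thesis by (cases "c = 0") (auto simp: one_le_power)
  next
    case False
    have "(real n / real k) ^ k \<le> real (n choose k)"
      using binomial_ge_n_over_k_pow_k[of k n, where 'a = real] that by simp
    hence "real n ^ k \<le> real k ^ k * real (n choose k)"
      using False by (simp add: power_divide field_simps)
    also have "real k ^ k \<le> real c ^ c"
    proof -
      have "real k ^ k \<le> real c ^ k" using that by (intro power_mono) auto
      also have "\<dots> \<le> real c ^ c" using that False by (intro power_increasing) auto
      finally show ?thesis .
    qed
    finally show ?thesis by (simp add: mult_right_mono)
  qed
  have pu: "real n ^ u \<le> 15^15 * real (n choose u)" using pow[of u 15] u by simp
  have pw: "real n ^ ?v \<le> 21^21 * real (n choose w)"
    using pow[of ?v 21] wb wbar_le(3)[of n w] choose_wbar[OF w(2)] by simp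
  show ?thesis
  proof (cases "w \<le> n - w")
    \<comment> \<open>\<open>T^2\<close> is at most \<open>n^u\<close> up to a constant, and the
      extra \<open>n\<close> is paid by \<open>n choose w\<close>, since the folded weight is at
      least 1.\<close>
    case True
    hence v: "?v = w" by (simp add: wbar_def)
    have A: "(n - w) choose ?a \<le> n ^ ?a"
      using choose_le_power[of "n - w" ?a] power_mono[of "n - w" n ?a] by simp
    have B: "(w - 1) choose ?b \<le> 2 ^ 21"
      using order_trans[OF binomial_le_pow2[of "w-1" ?b] power_increasing[of "w-1" 21 "2::nat"]] wb v by simp
    have "trans_count n u w \<le> n ^ ?a * 2 ^ 21"
      by (rule order_trans[OF T mult_le_mono[OF A B]])
    hence "real (trans_count n u w) \<le> real (n ^ ?a * 2 ^ 21)" by (rule of_nat_mono)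
    hence "real (trans_count n u w) \<le> real n ^ ?a * 2 ^ 21"
      by (simp only: of_nat_mult of_nat_power of_nat_numeral)
    hence "real (trans_count n u w) ^ 2 \<le> (real n ^ ?a * 2 ^ 21) ^ 2" by (intro power_mono) auto
    also have "\<dots> = real n ^ (2 * ?a) * 2 ^ 42"
      unfolding power_mult_distrib power_mult[symmetric] mult.commute[of 2 ?a] by simp
    also have "\<dots> \<le> real n ^ u * 2 ^ 42" using n1 by (intro mult_right_mono power_increasing) auto
    finally have "real (trans_count n u w) ^ 2 * real n \<le> real n ^ u * 2 ^ 42 * real n"
      by (rule mult_right_mono) simp
    also have "\<dots> \<le> (15^15 * real (n choose u)) * 2^42 * (21^21 * real (n choose w))"
    proof -
      have "real n \<le> real n ^ ?v" using n1 v w by (cases w) (auto simp: one_le_power)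
      hence "real n \<le> 21^21 * real (n choose w)" using pw by (rule order_trans)
      thus ?thesis using pu by (intro mult_mono) auto
    qed
    finally show ?thesis .
  next
    \<comment> \<open>The folded weight may be 0 here, so \<open>n choose w\<close> cannot pay. The
      powers of \<open>n\<close> now come from the runs of ones, and
      \<open>2 * ((u - 1) div 2) + 1 \<le> u\<close> leaves room for the extra factor.\<close>
    case False
    hence v: "?v = n - w" by (simp add: wbar_def)
    have A: "(n - w) choose ?a \<le> 2 ^ 21"
      using order_trans[OF binomial_le_pow2[of "n-w" ?a] power_increasing[of "n-w" 21 "2::nat"]] wb v by simp
    have B: "(w - 1) choose ?b \<le> n ^ ?b"
      using order_trans[OF choose_le_power[of "w - 1" ?b] power_mono[of "w - 1" n ?b]] w by simp
    have "trans_count n u w \<le> 2 ^ 21 * n ^ ?b"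
      by (rule order_trans[OF T mult_le_mono[OF A B]])
    hence "real (trans_count n u w) \<le> real (2 ^ 21 * n ^ ?b)" by (rule of_nat_mono)
    hence "real (trans_count n u w) \<le> 2 ^ 21 * real n ^ ?b"
      by (simp only: of_nat_mult of_nat_power of_nat_numeral)
    hence "real (trans_count n u w) ^ 2 \<le> (2 ^ 21 * real n ^ ?b) ^ 2" by (intro power_mono) auto
    also have "\<dots> = real n ^ (2 * ?b) * 2 ^ 42"
      unfolding power_mult_distrib power_mult[symmetric] mult.commute[of 2 ?b] by simp
    finally have "real (trans_count n u w) ^ 2 * real n \<le> (real n ^ (2 * ?b) * 2 ^ 42) * real n"
      by (rule mult_right_mono) simp
    also have "\<dots> = real n ^ Suc (2 * ?b) * 2 ^ 42" by simp
    also have "\<dots> \<le> real n ^ u * 2 ^ 42" using n1 u by (intro mult_right_mono power_increasing) auto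
    also have "\<dots> \<le> (15^15 * real (n choose u)) * 2^42 * (21^21 * real (n choose w))"
    proof -
      have "1 \<le> 21^21 * real (n choose w)" using pw n1
        using one_le_power[of "real n" ?v] by linarith
      hence "real n ^ u * 2 ^ 42 * 1 \<le> (15^15 * real (n choose u)) * 2^42 * (21^21 * real (n choose w))"
        using pu by (intro mult_mono) auto
      thus ?thesis by (simp only: mult_1_right)
    qed
    finally show ?thesis .
  qed
qed

subsection \<open>The chain of weights\<close>

text \<open>\<open>surv \<eta> n k w\<close> is the probability that the weight chain started in \<open>w\<close> stays away from the
  balanced weights for \<open>k\<close> rounds; \<open>sym_kernel\<close> is the transition matrix made symmetric by
  conjugation with the square root of the invariant measure.\<close>

definition unbal :: "real \<Rightarrow> nat \<Rightarrow> nat \<Rightarrow> bool" where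
  "unbal \<eta> n w \<longleftrightarrow> \<eta> \<le> \<bar>real w / real n - 1/2\<bar>"

text \<open>The operators act on functions of the weight, as conditional expectations, so the first
  step of the chain is the outermost operator. Weight \<open>0\<close> is left out of the sum
  because an invertible step maps no nonzero vector to zero.\<close>

definition opA :: "nat \<Rightarrow> (nat \<Rightarrow> real) \<Rightarrow> nat \<Rightarrow> real" where
  "opA n f u = (\<Sum>w=1..n. real (trans_count n u w) * f w) / real (n choose u)"

definition opD :: "nat \<Rightarrow> (nat \<Rightarrow> real) \<Rightarrow> nat \<Rightarrow> real" where
  "opD n f w = (\<Sum>u=1..n. real (trans_count n u w) * f u) / real (n choose w)"

text \<open>An accumulator step killed at balanced weights. Only the weight after the accumulator is
  tested, not the one after the derivative.\<close>

definition opK :: "real \<Rightarrow> nat \<Rightarrow> (nat \<Rightarrow> real) \<Rightarrow> nat \<Rightarrow> real" where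
  "opK \<eta> n f = opA n (\<lambda>w. if unbal \<eta> n w then f w else 0)"

definition surv :: "real \<Rightarrow> nat \<Rightarrow> nat \<Rightarrow> nat \<Rightarrow> real" where
  "surv \<eta> n k = ((opD n \<circ> opK \<eta> n) ^^ k) (\<lambda>_. 1)"

definition sym_kernel :: "nat \<Rightarrow> nat \<Rightarrow> nat \<Rightarrow> real" where
  "sym_kernel n u w = real (trans_count n u w) / (sqrt (real (n choose u)) * sqrt (real (n choose w)))"

lemma surv_0: "surv \<eta> n 0 w = 1"
  by (simp add: surv_def)

lemma surv_Suc: "surv \<eta> n (Suc k) = opD n (opK \<eta> n (surv \<eta> n k))"
  by (simp add: surv_def)

lemma opA_mono: "(\<And>w. 1 \<le> w \<Longrightarrow> w \<le> n \<Longrightarrow> f w \<le> g w) \<Longrightarrow> opA n f u \<le> opA n g u"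
  unfolding opA_def by (intro divide_right_mono sum_mono mult_left_mono) auto

lemma opD_mono: "(\<And>u. 1 \<le> u \<Longrightarrow> u \<le> n \<Longrightarrow> f u \<le> g u) \<Longrightarrow> opD n f w \<le> opD n g w"
  unfolding opD_def by (intro divide_right_mono sum_mono mult_left_mono) auto

lemma opK_mono: "(\<And>w. 1 \<le> w \<Longrightarrow> w \<le> n \<Longrightarrow> f w \<le> g w) \<Longrightarrow> opK \<eta> n f u \<le> opK \<eta> n g u"
  unfolding opK_def by (intro opA_mono) auto

lemma sum_trans_right: "1 \<le> u \<Longrightarrow> (\<Sum>w=1..n. trans_count n u w) = n choose u"
proof -
  assume "1 \<le> u"
  have "{..n} = insert 0 {1..n}" by auto
  thus ?thesis using sum_trans_count_right[of n u] \<open>1 \<le> u\<close> by (simp add: trans_count_w0)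
qed

lemma sum_trans_left: "1 \<le> w \<Longrightarrow> (\<Sum>u=1..n. trans_count n u w) = n choose w"
proof -
  assume "1 \<le> w"
  have "{..n} = insert 0 {1..n}" by auto
  thus ?thesis using sum_trans_count_left[of n w] \<open>1 \<le> w\<close> by (simp add: trans_count_u0)
qed

lemma sum_trans_right_real: "1 \<le> u \<Longrightarrow> (\<Sum>w=1..n. real (trans_count n u w)) = real (n choose u)"
  using sum_trans_right[of u n] by (metis of_nat_sum)

lemma sum_trans_left_real: "1 \<le> w \<Longrightarrow> (\<Sum>u=1..n. real (trans_count n u w)) = real (n choose w)"
  using sum_trans_left[of w n] by (metis of_nat_sum)

lemma opA_add_const: "1 \<le> u \<Longrightarrow> u \<le> n \<Longrightarrow> opA n (\<lambda>w. c + f w) u = c + opA n f u"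
  unfolding opA_def
  by (simp add: distrib_left sum.distrib add_divide_distrib sum_distrib_right[symmetric]
      sum_trans_right_real[simplified])

lemma opD_add_const: "1 \<le> w \<Longrightarrow> w \<le> n \<Longrightarrow> opD n (\<lambda>u. c + f u) w = c + opD n f w"
  unfolding opD_def
  by (simp add: distrib_left sum.distrib add_divide_distrib sum_distrib_right[symmetric]
      sum_trans_left_real[simplified])

lemma opA_const: "1 \<le> u \<Longrightarrow> u \<le> n \<Longrightarrow> opA n (\<lambda>w. c) u = c"
  using opA_add_const[of u n c "\<lambda>_. 0"] by (simp add: opA_def)

lemma opD_const: "1 \<le> w \<Longrightarrow> w \<le> n \<Longrightarrow> opD n (\<lambda>w. c) w = c"
  using opD_add_const[of w n c "\<lambda>_. 0"] by (simp add: opD_def)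

lemma sum_opA: "(\<Sum>u=1..n. real (n choose u) * opA n f u) = (\<Sum>w=1..n. real (n choose w) * f w)"
proof -
  have "(\<Sum>u=1..n. real (n choose u) * opA n f u) = (\<Sum>u=1..n. \<Sum>w=1..n. real (trans_count n u w) * f w)"
    by (intro sum.cong) (auto simp: opA_def)
  also have "\<dots> = (\<Sum>w=1..n. real (\<Sum>u=1..n. trans_count n u w) * f w)"
    by (subst sum.swap) (simp add: sum_distrib_right)
  finally show ?thesis by (simp add: sum_trans_left_real[simplified])
qed

lemma sum_opD: "(\<Sum>w=1..n. real (n choose w) * opD n f w) = (\<Sum>u=1..n. real (n choose u) * f u)"
proof -
  have "(\<Sum>w=1..n. real (n choose w) * opD n f w) = (\<Sum>w=1..n. \<Sum>u=1..n. real (trans_count n u w) * f u)"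
    by (intro sum.cong) (auto simp: opD_def)
  also have "\<dots> = (\<Sum>u=1..n. real (\<Sum>w=1..n. trans_count n u w) * f u)"
    by (subst sum.swap) (simp add: sum_distrib_right)
  finally show ?thesis by (simp add: sum_trans_right_real[simplified])
qed

lemma sqrt_times_opA:
  assumes "u \<le> n"
  shows "sqrt (real (n choose u)) * opA n f u =
    (\<Sum>w=1..n. sym_kernel n u w * (sqrt (real (n choose w)) * f w))"
proof -
  have "real (n choose u) = sqrt (real (n choose u)) * sqrt (real (n choose u))" by simp
  hence "sqrt (real (n choose u)) * opA n f u =
     (\<Sum>w=1..n. real (trans_count n u w) * f w) / sqrt (real (n choose u))"
    unfolding opA_def using assms by (metis (no_types, lifting) mult_divide_mult_cancel_left_if
       times_divide_eq_right real_sqrt_eq_zero_cancel_iff of_nat_eq_0_iff binomial_eq_0_iff not_less)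
  also have "\<dots> = (\<Sum>w=1..n. sym_kernel n u w * (sqrt (real (n choose w)) * f w))"
    unfolding sum_divide_distrib sym_kernel_def by (intro sum.cong) auto
  finally show ?thesis .
qed

lemma sqrt_times_opD:
  assumes "w \<le> n"
  shows "sqrt (real (n choose w)) * opD n f w =
    (\<Sum>u=1..n. sym_kernel n u w * (sqrt (real (n choose u)) * f u))"
proof -
  have "real (n choose w) = sqrt (real (n choose w)) * sqrt (real (n choose w))" by simp
  hence "sqrt (real (n choose w)) * opD n f w =
     (\<Sum>u=1..n. real (trans_count n u w) * f u) / sqrt (real (n choose w))"
    unfolding opD_def using assms by (metis (no_types, lifting) mult_divide_mult_cancel_left_if
       times_divide_eq_right real_sqrt_eq_zero_cancel_iff of_nat_eq_0_iff binomial_eq_0_iff not_less)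
  also have "\<dots> = (\<Sum>u=1..n. sym_kernel n u w * (sqrt (real (n choose u)) * f u))"
    unfolding sum_divide_distrib sym_kernel_def by (intro sum.cong) auto
  finally show ?thesis .
qed

lemma sym_kernel_nonneg: "0 \<le> sym_kernel n u w"
  by (simp add: sym_kernel_def)

lemma sym_kernel_le_sqrt:
  assumes "real (trans_count n u w) ^ 2 \<le> b * (real (n choose u) * real (n choose w))"
    and "u \<le> n" "w \<le> n" "0 \<le> b"
  shows "sym_kernel n u w \<le> sqrt b"
proof -
  have p: "real (n choose u) > 0" "real (n choose w) > 0" using assms by auto
  have "real (trans_count n u w) \<le> sqrt (b * (real (n choose u) * real (n choose w)))"
    using assms(1) by (rule real_le_rsqrt)
  thus ?thesis using p unfolding sym_kernel_def by (simp add: real_sqrt_mult field_simps)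
qed

lemma sym_kernel_le_1:
  assumes "u \<le> n" "w \<le> n"
  shows "sym_kernel n u w \<le> 1"
proof -
  have "real (trans_count n u w) ^ 2 \<le> 1 * (real (n choose u) * real (n choose w))"
    using trans_count_le_left[of n u w] trans_count_le_right[OF assms(2), of u]
    by (simp add: power2_eq_square mult_mono)
  from sym_kernel_le_sqrt[OF this assms] show ?thesis by simp
qed

lemma surv_nonneg_le_1: "1 \<le> w \<Longrightarrow> w \<le> n \<Longrightarrow> 0 \<le> surv \<eta> n k w \<and> surv \<eta> n k w \<le> 1"
proof (induction k arbitrary: w)
  case 0
  then show ?case by (simp add: surv_0)
next
  case (Suc k)
  have K: "0 \<le> opK \<eta> n (surv \<eta> n k) u \<and> opK \<eta> n (surv \<eta> n k) u \<le> 1" if "1 \<le> u" "u \<le> n" for u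
  proof -
    have "opA n (\<lambda>_. 0) u \<le> opK \<eta> n (surv \<eta> n k) u" unfolding opK_def
      using Suc.IH by (intro opA_mono) auto
    moreover have "opK \<eta> n (surv \<eta> n k) u \<le> opA n (\<lambda>_. 1) u" unfolding opK_def
      using Suc.IH by (intro opA_mono) auto
    ultimately show ?thesis using that by (simp add: opA_const)
  qed
  have "opD n (\<lambda>_. 0) w \<le> surv \<eta> n (Suc k) w" unfolding surv_Suc
    using K by (intro opD_mono) auto
  moreover have "surv \<eta> n (Suc k) w \<le> opD n (\<lambda>_. 1) w" unfolding surv_Suc
    using K by (intro opD_mono) auto
  ultimately show ?case using Suc.prems by (simp add: opD_const)
qed

lemma opK_surv_le_1: "1 \<le> u \<Longrightarrow> u \<le> n \<Longrightarrow> opK \<eta> n (surv \<eta> n k) u \<le> 1"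
proof -
  assume u: "1 \<le> u" "u \<le> n"
  have "opK \<eta> n (surv \<eta> n k) u \<le> opA n (\<lambda>_. 1) u" unfolding opK_def
    using surv_nonneg_le_1 by (intro opA_mono) auto
  thus ?thesis using u by (simp add: opA_const)
qed

lemma surv_decreasing: "1 \<le> w \<Longrightarrow> w \<le> n \<Longrightarrow> surv \<eta> n (Suc k) w \<le> surv \<eta> n k w"
proof (induction k arbitrary: w)
  case 0
  then show ?case using surv_nonneg_le_1[of w n \<eta> "Suc 0"] by (simp add: surv_0)
next
  case (Suc k)
  have "opD n (opK \<eta> n (surv \<eta> n (Suc k))) w \<le> opD n (opK \<eta> n (surv \<eta> n k)) w"
    using Suc.IH by (intro opD_mono opK_mono) auto
  thus ?case by (simp add: surv_Suc)
qed

lemma surv_antimono: "j \<le> k \<Longrightarrow> 1 \<le> w \<Longrightarrow> w \<le> n \<Longrightarrow> surv \<eta> n k w \<le> surv \<eta> n j w"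
  by (induction k rule: dec_induct) (auto intro: order_trans[OF surv_decreasing])

text \<open>One round of the recursion after symmetrisation. The bound \<open>M\<close> may vary
  with the weight and is required at unbalanced weights only, since the killed step visits no
  others; both freedoms are used below.\<close>

lemma surv_step:
  assumes w: "w \<le> n" and M: "\<And>v. 1 \<le> v \<Longrightarrow> v \<le> n \<Longrightarrow> unbal \<eta> n v \<Longrightarrow>
      sqrt (real (n choose v)) * surv \<eta> n k v \<le> M v"
  shows "sqrt (real (n choose w)) * surv \<eta> n (Suc k) w \<le>
    (\<Sum>u=1..n. sym_kernel n u w * (\<Sum>v | v \<in> {1..n} \<and> unbal \<eta> n v. sym_kernel n u v * M v))"
proof -
  have "sqrt (real (n choose u)) * opK \<eta> n (surv \<eta> n k) u \<le>
      (\<Sum>v | v \<in> {1..n} \<and> unbal \<eta> n v. sym_kernel n u v * M v)" if u: "u \<in> {1..n}" for u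
  proof -
    have "sqrt (real (n choose u)) * opK \<eta> n (surv \<eta> n k) u =
       (\<Sum>v\<in>{1..n}. if unbal \<eta> n v then sym_kernel n u v * (sqrt (real (n choose v)) * surv \<eta> n k v) else 0)"
      unfolding opK_def using u by (subst sqrt_times_opA) (auto intro!: sum.cong)
    also have "\<dots> = (\<Sum>v | v \<in> {1..n} \<and> unbal \<eta> n v. sym_kernel n u v * (sqrt (real (n choose v)) * surv \<eta> n k v))"
      by (subst sum.inter_filter) auto
    also have "\<dots> \<le> (\<Sum>v | v \<in> {1..n} \<and> unbal \<eta> n v. sym_kernel n u v * M v)"
      using M by (intro sum_mono mult_left_mono) (auto simp: sym_kernel_nonneg)
    finally show ?thesis .
  qed
  thus ?thesis unfolding surv_Suc sqrt_times_opD[OF w]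
    by (intro sum_mono mult_left_mono) (auto simp: sym_kernel_nonneg)
qed

lemma unbal_imp:
  assumes "unbal \<eta> n w" "0 < \<eta>" "1 \<le> n" "w \<le> n"
  shows "4 * real w * real (n - w) / real n ^ 2 \<le> 1 - 4 * \<eta>\<^sup>2"
proof -
  have "\<eta>\<^sup>2 \<le> \<bar>real w / real n - 1/2\<bar>\<^sup>2" using assms by (intro power_mono) (auto simp: unbal_def)
  hence "\<eta>\<^sup>2 \<le> (real w / real n - 1/2)\<^sup>2" by simp
  moreover have "4 * real w * real (n - w) / real n ^ 2 = 1 - 4 * (real w / real n - 1/2)\<^sup>2"
    using assms by (simp add: of_nat_diff field_simps power2_eq_square)
  ultimately show ?thesis by simp
qed

text \<open>Complements \<open>unbal_imp\<close>: at small folded weights the base of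
  \<open>trans_count_le_choose\<close> is not merely below 1 but tends to 0, which the sharper
  estimates exploit.\<close>

lemma wbar_bound:
  assumes "1 \<le> n" "w \<le> n"
  shows "4 * real w * real (n - w) / real n ^ 2 \<le> 4 * real (wbar n w) / real n"
proof -
  have "w * (n - w) \<le> wbar n w * n" unfolding wbar_def
    by (cases "w \<le> n - w") (auto simp: min_def mult.commute intro: mult_le_mono)
  hence "real w * real (n - w) \<le> real (wbar n w) * real n" by (metis of_nat_le_iff of_nat_mult)
  hence "4 * (real w * real (n - w)) / real n ^ 2 \<le> 4 * (real (wbar n w) * real n) / real n ^ 2"
    by (intro divide_right_mono mult_left_mono) auto
  also have "\<dots> = 4 * real (wbar n w) / real n" using assms by (simp add: power2_eq_square)
  finally show ?thesis by (simp add: mult.assoc)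
qed

text \<open>A single term of the exponential series of \<open>c * x\<close> is at most the whole
  series.\<close>

lemma power_times_exp_le:
  assumes "0 < (c::real)" "0 \<le> x"
  shows "x ^ a * exp (- c * x) \<le> fact a / c ^ a"
proof -
  have "(c * x) ^ a / fact a \<le> exp (c * x)"
  proof -
    have s: "(\<lambda>n. (c * x) ^ n /\<^sub>R fact n) sums exp (c * x)" by (rule exp_converges)
    have "(\<Sum>n\<in>{a}. (c * x) ^ n /\<^sub>R fact n) \<le> (\<Sum>n. (c * x) ^ n /\<^sub>R fact n)"
      using assms s by (intro sum_le_suminf) (auto simp: sums_iff)
    thus ?thesis using s by (simp add: sums_iff divide_inverse mult.commute)
  qed
  thus ?thesis using assms by (simp add: exp_minus power_mult_distrib field_simps)
qed

subsection \<open>Decay of the survival probabilities\<close>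

lemma one_minus_four_sq_bounds:
  fixes \<eta> :: real
  assumes "0 < \<eta>" "\<eta> \<le> 1/6"
  shows "0 < 1 - 4 * \<eta>\<^sup>2" "1 - 4 * \<eta>\<^sup>2 < 1"
proof -
  have "\<eta>\<^sup>2 \<le> (1/6)\<^sup>2" using assms by (intro power_mono) auto
  thus "0 < 1 - 4 * \<eta>\<^sup>2" by (simp add: power2_eq_square)
qed (use assms in simp)

section \<open>Exponential gains for a fixed even length\<close>

context
  fixes \<eta> r q c K :: real and n h :: nat
  assumes eta: "0 < \<eta>" "\<eta> \<le> 1/6"
    and r_def: "r = 1 - 4 * \<eta>\<^sup>2" and q_def: "q = max r (1/2)" and c_def: "c = - ln q / 6"
    and K_def: "K = max 1 (4 / c)" and n_def: "n = 2 * h" and n1: "1 \<le> n"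
begin

lemmas r_bounds = one_minus_four_sq_bounds[OF eta, folded r_def]

lemma q_bounds: "1/2 \<le> q" "q < 1" "0 < q" "r \<le> q"
  using r_bounds by (auto simp: q_def)

lemma c_pos: "0 < c"
  using q_bounds by (simp add: c_def)

lemma K_ge: "1 \<le> K" "4 / c \<le> K"
  by (auto simp: K_def)

lemma trans_unbal:
  assumes "1 \<le> u" "u \<le> n" "1 \<le> w" "w \<le> n" "unbal \<eta> n w"
  shows "real (trans_count n u w) \<le> real n * r ^ (u div 2) * real (n choose u)"
proof -
  have "(4 * real w * real (n - w) / real n ^ 2) ^ (u div 2) \<le> r ^ (u div 2)"
    using unbal_imp[OF assms(5) eta(1) n1 assms(4)] unfolding r_def by (intro power_mono) auto
  hence "real n * (4 * real w * real (n - w) / real n ^ 2) ^ (u div 2) * real (n choose u)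
     \<le> real n * r ^ (u div 2) * real (n choose u)"
    by (intro mult_right_mono mult_left_mono) auto
  thus ?thesis using trans_count_le_choose[OF n_def assms(1-4)] by (rule order_trans[rotated])
qed

text \<open>By the choice of \<open>c\<close>, \<open>exp (- c * k)\<close> is \<open>q\<close> to
  the power \<open>k / 6\<close>. Rounding this exponent down loses less than one factor
  \<open>q\<close>, and \<open>q \<ge> 1/2\<close> turns the loss into the 2.\<close>

lemma q_power_le_exp: "q ^ (k div 6) \<le> 2 * exp (- c * real k)"
proof -
  have "real k \<le> 6 * real (k div 6) + 5" by linarith
  hence "c * (real k - 5) \<le> c * (6 * real (k div 6))" using c_pos by (intro mult_left_mono) auto
  hence "- (6 * c) * real (k div 6) \<le> - c * real k + 5 * c" by (simp add: algebra_simps)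
  moreover have "5 * c \<le> - ln q" using q_bounds by (simp add: c_def)
  ultimately have "ln q * real (k div 6) \<le> - c * real k - ln q" by (simp add: c_def)
  hence "exp (ln q * real (k div 6)) \<le> exp (- c * real k - ln q)" by simp
  also have "\<dots> = exp (- c * real k) / q" using q_bounds by (simp add: exp_diff)
  also have "\<dots> \<le> exp (- c * real k) / (1/2)" using q_bounds by (intro divide_left_mono) auto
  also have "exp (ln q * real (k div 6)) = q ^ (k div 6)"
    using q_bounds by (metis exp_ln exp_of_nat2_mult)
  finally show ?thesis by simp
qed

lemma opK_one_le:
  assumes "1 \<le> u" "u \<le> n"
  shows "opK \<eta> n (surv \<eta> n 0) u \<le> real n ^ 2 * r ^ (u div 2)"
proof -
  have "(\<Sum>w=1..n. real (trans_count n u w) * (if unbal \<eta> n w then surv \<eta> n 0 w else 0))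
      \<le> (\<Sum>w=1..n. real n * r ^ (u div 2) * real (n choose u))"
    using trans_unbal[OF assms] r_bounds by (intro sum_mono) (auto simp: surv_0)
  hence "opK \<eta> n (surv \<eta> n 0) u \<le> (\<Sum>w=1..n. real n * r ^ (u div 2) * real (n choose u)) / real (n choose u)"
    unfolding opK_def opA_def by (rule divide_right_mono) simp
  also have "\<dots> = real n ^ 2 * r ^ (u div 2)" using assms by (simp add: power2_eq_square)
  finally show ?thesis .
qed

text \<open>The dichotomy of \<open>choose_or_power_small\<close>, applied to the weight
  \<open>u\<close> after the derivative: either \<open>u\<close> is so small that few sets of size
  \<open>w\<close> can lead there, or the accumulator step from \<open>u\<close> ends unbalanced
  only with exponentially small probability.\<close>

lemma surv_1_le:
  assumes w: "1 \<le> w" "w \<le> n"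
  shows "surv \<eta> n 1 w \<le> 2 * real n ^ 3 * exp (- c * real (wbar n w))"
proof -
  let ?Q = "q ^ (wbar n w div 6)"
  have Q0: "0 \<le> ?Q" using q_bounds by simp
  have "real (trans_count n u w) * opK \<eta> n (surv \<eta> n 0) u \<le> real n ^ 2 * ?Q * real (n choose w)"
    if u: "u \<in> {1..n}" for u
  proof -
    have one: "opK \<eta> n (surv \<eta> n 0) u \<le> 1" using u opK_surv_le_1 by auto
    have nn: "0 \<le> opK \<eta> n (surv \<eta> n 0) u" unfolding opK_def opA_def
      by (intro divide_nonneg_nonneg sum_nonneg) (auto simp: surv_0)
    consider "real (n choose u) \<le> ?Q * real (n choose w)" | "r ^ (u div 2) \<le> ?Q"
      using choose_or_power_small[OF r_bounds w(2), of u] by (auto simp: q_def)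
    thus ?thesis
    proof cases
      case 1
      have "real (trans_count n u w) * opK \<eta> n (surv \<eta> n 0) u \<le> real (n choose u) * 1"
        using one nn trans_count_le_left[of n u w] by (intro mult_mono) auto
      also have "\<dots> \<le> 1 * (?Q * real (n choose w))" using 1 by simp
      also have "\<dots> \<le> real n ^ 2 * (?Q * real (n choose w))"
        using n1 Q0 by (intro mult_right_mono) auto
      finally show ?thesis by (simp add: mult.assoc)
    next
      case 2
      have "opK \<eta> n (surv \<eta> n 0) u \<le> real n ^ 2 * r ^ (u div 2)" using opK_one_le u by auto
      also have "\<dots> \<le> real n ^ 2 * ?Q" using 2 by (intro mult_left_mono) auto
      finally have "real (trans_count n u w) * opK \<eta> n (surv \<eta> n 0) u
          \<le> real (n choose w) * (real n ^ 2 * ?Q)"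
        using nn trans_count_le_right[OF w(2), of u] by (intro mult_mono) auto
      thus ?thesis by (simp add: mult_ac)
    qed
  qed
  hence "(\<Sum>u=1..n. real (trans_count n u w) * opK \<eta> n (surv \<eta> n 0) u)
     \<le> (\<Sum>u=1..n. real n ^ 2 * ?Q * real (n choose w))" by (intro sum_mono) auto
  hence "surv \<eta> n 1 w \<le> (\<Sum>u=1..n. real n ^ 2 * ?Q * real (n choose w)) / real (n choose w)"
    unfolding One_nat_def surv_Suc opD_def by (rule divide_right_mono) simp
  also have "\<dots> = real n ^ 3 * ?Q" using w by (simp add: power2_eq_square power3_eq_cube)
  also have "\<dots> \<le> real n ^ 3 * (2 * exp (- c * real (wbar n w)))"
    using q_power_le_exp by (intro mult_left_mono) auto
  finally show ?thesis by simp
qed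

text \<open>Surviving the next round favours landing at a small folded weight \<open>v\<close>, by
  the factor \<open>exp (- c * v)\<close>; but the accumulator reaches such a weight from
  \<open>u\<close> only with probability about \<open>(4 * v / n) ^ (u div 2)\<close>. The product
  of the two is bounded uniformly in \<open>v\<close> by \<open>power_times_exp_le\<close>, which is
  where the factorial arises.\<close>

lemma opK_surv_1_le:
  assumes u: "1 \<le> u" "u \<le> n"
  shows "opK \<eta> n (surv \<eta> n 1) u \<le> 2 * real n ^ 5 * (fact (u div 2) * (4 / (c * real n)) ^ (u div 2))"
proof -
  let ?a = "u div 2"
  let ?B = "2 * real n ^ 4 * (fact ?a * (4 / (c * real n)) ^ ?a)"
  have B0: "0 \<le> ?B" using c_pos by simp
  have "real (trans_count n u w) * (if unbal \<eta> n w then surv \<eta> n 1 w else 0) \<le> ?B * real (n choose u)"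
    if w: "w \<in> {1..n}" for w
  proof -
    have w': "1 \<le> w" "w \<le> n" using w by auto
    let ?v = "real (wbar n w)"
    have "(4 * real w * real (n - w) / real n ^ 2) ^ ?a \<le> (4 * ?v / real n) ^ ?a"
      using wbar_bound[OF n1 w'(2)] by (intro power_mono) auto
    hence "real n * (4 * real w * real (n - w) / real n ^ 2) ^ ?a * real (n choose u)
       \<le> real n * (4 * ?v / real n) ^ ?a * real (n choose u)"
      by (intro mult_right_mono mult_left_mono) auto
    with trans_count_le_choose[OF n_def u w']
    have T: "real (trans_count n u w) \<le> real n * (4 * ?v / real n) ^ ?a * real (n choose u)"
      by (rule order_trans)
    have "real (trans_count n u w) * surv \<eta> n 1 w
       \<le> (real n * (4 * ?v / real n) ^ ?a * real (n choose u)) * (2 * real n ^ 3 * exp (- c * ?v))"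
      using T surv_1_le[OF w'] surv_nonneg_le_1[OF w', of \<eta> 1] by (intro mult_mono) auto
    also have "\<dots> = 2 * real n ^ 4 * (4 / real n) ^ ?a * real (n choose u) * (?v ^ ?a * exp (- c * ?v))"
      by (simp add: power_mult_distrib power_divide power4_eq_xxxx power3_eq_cube)
    also have "\<dots> \<le> 2 * real n ^ 4 * (4 / real n) ^ ?a * real (n choose u) * (fact ?a / c ^ ?a)"
      using power_times_exp_le[OF c_pos, of ?v ?a] by (intro mult_left_mono) auto
    also have "\<dots> = ?B * real (n choose u)"
      by (simp add: power_mult_distrib power_divide mult_ac)
    finally show ?thesis using B0 by auto
  qed
  hence "(\<Sum>w=1..n. real (trans_count n u w) * (if unbal \<eta> n w then surv \<eta> n 1 w else 0))
     \<le> (\<Sum>w=1..n. ?B * real (n choose u))" by (intro sum_mono) auto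
  hence "opK \<eta> n (surv \<eta> n 1) u \<le> (\<Sum>w=1..n. ?B * real (n choose u)) / real (n choose u)"
    unfolding opK_def opA_def by (rule divide_right_mono) simp
  also have "\<dots> = real n * ?B" using u by simp
  also have "\<dots> = 2 * real n ^ 5 * (fact ?a * (4 / (c * real n)) ^ ?a)"
    by (simp add: eval_nat_numeral)
  finally show ?thesis .
qed

text \<open>The factorial and the powers of \<open>n\<close> cancel between
  \<open>trans_count_fact_le\<close> and \<open>opK_surv_1_le\<close>. What remains is divided by
  \<open>n choose w\<close> itself, although only its square root is wanted; the surplus pays for
  \<open>(2 * K) ^ wbar n w\<close> in \<open>surv_low\<close>.\<close>

lemma surv_2_le:
  assumes w: "1 \<le> w" "w \<le> n"
  shows "surv \<eta> n 2 w \<le> 2 * real n ^ 6 * (2 * K) ^ wbar n w / real (n choose w)"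
proof -
  have "real (trans_count n u w) * opK \<eta> n (surv \<eta> n 1) u \<le> 2 * real n ^ 5 * (2 * K) ^ wbar n w"
    if u: "u \<in> {1..n}" for u
  proof (cases "trans_count n u w = 0")
    case True
    thus ?thesis using K_ge by simp
  next
    case False
    have u': "1 \<le> u" "u \<le> n" using u by auto
    let ?a = "u div 2"
    have a: "?a \<le> wbar n w" using trans_count_fact_le(2)[OF u'(1) w False] .
    have "real (trans_count n u w * fact ?a) \<le> real (2 ^ wbar n w * n ^ ?a)"
      using trans_count_fact_le(1)[OF u'(1) w] by (rule of_nat_mono)
    hence T: "real (trans_count n u w) * fact ?a \<le> 2 ^ wbar n w * real n ^ ?a" by simp
    have "real (trans_count n u w) * opK \<eta> n (surv \<eta> n 1) u
      \<le> real (trans_count n u w) * (2 * real n ^ 5 * (fact ?a * (4 / (c * real n)) ^ ?a))"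
      using opK_surv_1_le[OF u'] by (intro mult_left_mono) auto
    also have "\<dots> = (real (trans_count n u w) * fact ?a) * (2 * real n ^ 5 * (4 / (c * real n)) ^ ?a)"
      by simp
    also have "\<dots> \<le> (2 ^ wbar n w * real n ^ ?a) * (2 * real n ^ 5 * (4 / (c * real n)) ^ ?a)"
      using T c_pos by (intro mult_right_mono) auto
    also have "\<dots> = 2 * real n ^ 5 * (2 ^ wbar n w * (4 / c) ^ ?a)"
      using n1 by (simp add: power_mult_distrib power_divide)
    also have "\<dots> \<le> 2 * real n ^ 5 * (2 ^ wbar n w * K ^ wbar n w)"
    proof -
      have "(4 / c) ^ ?a \<le> K ^ ?a" using K_ge c_pos by (intro power_mono) auto
      also have "\<dots> \<le> K ^ wbar n w" using K_ge a by (intro power_increasing) auto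
      finally show ?thesis by (intro mult_left_mono) auto
    qed
    finally show ?thesis by (simp add: power_mult_distrib)
  qed
  hence "(\<Sum>u=1..n. real (trans_count n u w) * opK \<eta> n (surv \<eta> n 1) u)
     \<le> (\<Sum>u=1..n. 2 * real n ^ 5 * (2 * K) ^ wbar n w)" by (intro sum_mono) auto
  also have "\<dots> = 2 * real n ^ 6 * (2 * K) ^ wbar n w" by (simp add: eval_nat_numeral)
  finally show ?thesis
    unfolding numeral_2_eq_2 surv_Suc[of \<eta> n "Suc 0"] opD_def by (simp add: divide_right_mono)
qed

text \<open>The threshold is the one that gives \<open>4 * K^2 \<le> n / wbar n w\<close>, hence
  \<open>((2 * K) ^ wbar n w)^2 \<le> n choose w\<close> by the lower bound \<open>(n / k)^k\<close>
  for binomial coefficients.\<close>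

lemma surv_low:
  assumes w: "1 \<le> w" "w \<le> n" and low: "4 * K\<^sup>2 * real (wbar n w) \<le> real n" and k: "2 \<le> k"
  shows "sqrt (real (n choose w)) * surv \<eta> n k w \<le> 2 * real n ^ 6"
proof -
  let ?v = "wbar n w"
  have "(4 * K\<^sup>2) ^ ?v \<le> real (n choose ?v)"
  proof (cases "?v = 0")
    case False
    have "4 * K\<^sup>2 \<le> real n / real ?v" using low False by (simp add: field_simps)
    hence "(4 * K\<^sup>2) ^ ?v \<le> (real n / real ?v) ^ ?v" by (intro power_mono) auto
    also have "\<dots> \<le> real (n choose ?v)"
      by (rule binomial_ge_n_over_k_pow_k) (rule wbar_le)
    finally show ?thesis .
  qed simp
  hence "((2 * K) ^ ?v)\<^sup>2 \<le> real (n choose w)"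
  proof -
    have "4 * K\<^sup>2 = (2 * K)\<^sup>2" by (simp add: power_mult_distrib)
    thus ?thesis using \<open>(4 * K\<^sup>2) ^ ?v \<le> real (n choose ?v)\<close> choose_wbar[OF w(2)]
      by (metis power_mult mult.commute)
  qed
  hence s: "(2 * K) ^ ?v \<le> sqrt (real (n choose w))" by (rule real_le_rsqrt)
  have pos: "0 < sqrt (real (n choose w))" using w by simp
  have "surv \<eta> n k w \<le> 2 * real n ^ 6 * (2 * K) ^ ?v / real (n choose w)"
    using surv_antimono[OF k w, of \<eta>] surv_2_le[OF w] by linarith
  also have "\<dots> \<le> 2 * real n ^ 6 * sqrt (real (n choose w)) / real (n choose w)"
    using s by (intro divide_right_mono mult_left_mono) auto
  also have "\<dots> = 2 * real n ^ 6 / sqrt (real (n choose w))"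
    using w by (simp add: real_div_sqrt divide_simps)
  finally show ?thesis using pos by (simp add: field_simps)
qed

text \<open>The dichotomy of \<open>surv_1_le\<close> for a single kernel entry: one factor of
  \<open>T^2\<close> is estimated trivially by a binomial coefficient, the other by the case at
  hand.\<close>

lemma sym_kernel_unbal:
  assumes u: "1 \<le> u" "u \<le> n" and w: "1 \<le> w" "w \<le> n" "unbal \<eta> n w"
  shows "sym_kernel n u w \<le> sqrt (2 * real n * exp (- c * real (wbar n w)))"
proof (rule sym_kernel_le_sqrt[OF _ u(2) w(2)])
  let ?Q = "q ^ (wbar n w div 6)" and ?T = "real (trans_count n u w)"
  have Q0: "0 \<le> ?Q" using q_bounds by simp
  have TX: "?T \<le> real (n choose u)" using trans_count_le_left[of n u w] by simp
  have TY: "?T \<le> real (n choose w)" using trans_count_le_right[OF w(2), of u] by simp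
  consider "real (n choose u) \<le> ?Q * real (n choose w)" | "r ^ (u div 2) \<le> ?Q"
    using choose_or_power_small[OF r_bounds w(2), of u] by (auto simp: q_def)
  hence "?T ^ 2 \<le> real n * ?Q * (real (n choose u) * real (n choose w))"
  proof cases
    case 1
    have "?T * ?T \<le> real (n choose u) * (?Q * real (n choose w))"
      using TX 1 by (intro mult_mono) auto
    also have "\<dots> \<le> real n * (real (n choose u) * (?Q * real (n choose w)))"
      using n1 Q0 mult_right_mono[of 1 "real n" "real (n choose u) * (?Q * real (n choose w))"] by simp
    finally show ?thesis by (simp add: power2_eq_square mult_ac)
  next
    case 2
    have "?T \<le> real n * r ^ (u div 2) * real (n choose u)" using trans_unbal u w by simp
    also have "\<dots> \<le> real n * ?Q * real (n choose u)" using 2 by (intro mult_right_mono mult_left_mono) auto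
    finally have "?T * ?T \<le> (real n * ?Q * real (n choose u)) * real (n choose w)"
      using TY Q0 by (intro mult_mono) auto
    thus ?thesis by (simp add: power2_eq_square mult_ac)
  qed
  also have "\<dots> \<le> real n * (2 * exp (- c * real (wbar n w))) * (real (n choose u) * real (n choose w))"
    using q_power_le_exp by (intro mult_right_mono mult_left_mono) auto
  finally show "?T ^ 2 \<le> 2 * real n * exp (- c * real (wbar n w)) * (real (n choose u) * real (n choose w))"
    by (simp add: mult_ac)
qed simp

text \<open>Targets with \<open>wbar n v \<le> n / (4 * K^2)\<close> are covered by
  \<open>surv_low\<close>, with kernel entries at most 1. Every other unbalanced target has an
  exponentially small kernel entry in front of the old bound \<open>M\<close>. The two sums over
  \<open>u\<close> and \<open>v\<close> turn \<open>n^6\<close> into \<open>n^8\<close>.\<close>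

lemma surv_step_crude:
  assumes M: "\<And>v. 1 \<le> v \<Longrightarrow> v \<le> n \<Longrightarrow> sqrt (real (n choose v)) * surv \<eta> n k v \<le> M"
    and k: "2 \<le> k" and w: "1 \<le> w" "w \<le> n"
  shows "sqrt (real (n choose w)) * surv \<eta> n (Suc k) w
           \<le> 2 * real n ^ 8 + real n ^ 2 * sqrt (2 * real n) * exp (- (c / (8 * K\<^sup>2)) * real n) * M"
proof -
  let ?e = "sqrt (2 * real n) * exp (- (c / (8 * K\<^sup>2)) * real n)"
  let ?M = "\<lambda>v. if 4 * K\<^sup>2 * real (wbar n v) \<le> real n then 2 * real n ^ 6 else M"
  have M0: "0 \<le> M" using M[OF w] surv_nonneg_le_1[OF w, of \<eta> k]
    by (meson mult_nonneg_nonneg of_nat_0_le_iff order_trans real_sqrt_ge_zero)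
  have K0: "0 < K" using K_ge by simp
  have "sym_kernel n u v * ?M v \<le> 2 * real n ^ 6 + ?e * M" if u: "u \<in> {1..n}" and v: "v \<in> {1..n}" "unbal \<eta> n v" for u v
  proof (cases "4 * K\<^sup>2 * real (wbar n v) \<le> real n")
    case True
    have "sym_kernel n u v * (2 * real n ^ 6) \<le> 1 * (2 * real n ^ 6)"
      using sym_kernel_le_1 u v by (intro mult_right_mono) auto
    moreover have "0 \<le> ?e * M" using M0 by simp
    ultimately show ?thesis using True by simp
  next
    case False
    have "sym_kernel n u v \<le> sqrt (2 * real n * exp (- c * real (wbar n v)))"
      using sym_kernel_unbal u v by auto
    \<comment> \<open>The exponent is written as a double so that the square root halves it, from
      \<open>c / (4 * K^2)\<close> to \<open>c / (8 * K^2)\<close>.\<close>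
    also have "\<dots> \<le> sqrt (2 * real n * exp (2 * (- (c / (8 * K\<^sup>2)) * real n)))"
    proof -
      have "real n / (4 * K\<^sup>2) \<le> real (wbar n v)" using False K0 by (simp add: field_simps)
      hence "c * (real n / (4 * K\<^sup>2)) \<le> c * real (wbar n v)" using c_pos by (intro mult_left_mono) auto
      thus ?thesis by (intro real_sqrt_le_mono mult_left_mono) (auto simp: field_simps)
    qed
    also have "\<dots> = ?e" by (simp only: real_sqrt_mult exp_double real_sqrt_abs abs_exp_cancel)
    finally have "sym_kernel n u v * M \<le> ?e * M" using M0 by (rule mult_right_mono)
    moreover have "0 \<le> 2 * real n ^ 6" by simp
    ultimately have "sym_kernel n u v * M \<le> 2 * real n ^ 6 + ?e * M" by linarith
    thus ?thesis using False by simp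
  qed
  hence inner: "(\<Sum>v | v \<in> {1..n} \<and> unbal \<eta> n v. sym_kernel n u v * ?M v) \<le> real n * (2 * real n ^ 6 + ?e * M)"
    if "u \<in> {1..n}" for u
  proof -
    have "(\<Sum>v | v \<in> {1..n} \<and> unbal \<eta> n v. sym_kernel n u v * ?M v)
        \<le> of_nat (card {v. v \<in> {1..n} \<and> unbal \<eta> n v}) * (2 * real n ^ 6 + ?e * M)"
      using \<open>\<And>u v. u \<in> {1..n} \<Longrightarrow> v \<in> {1..n} \<Longrightarrow> unbal \<eta> n v \<Longrightarrow> sym_kernel n u v * ?M v \<le> 2 * real n ^ 6 + ?e * M\<close> that
      by (intro sum_bounded_above) auto
    also have "\<dots> \<le> real n * (2 * real n ^ 6 + ?e * M)"
    proof (rule mult_right_mono)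
      have "card {v. v \<in> {1..n} \<and> unbal \<eta> n v} \<le> card {1..n}" by (intro card_mono) auto
      thus "real (card {v. v \<in> {1..n} \<and> unbal \<eta> n v}) \<le> real n" by simp
    qed (use M0 in auto)
    finally show ?thesis .
  qed
  have "sqrt (real (n choose w)) * surv \<eta> n (Suc k) w \<le>
      (\<Sum>u=1..n. sym_kernel n u w * (\<Sum>v | v \<in> {1..n} \<and> unbal \<eta> n v. sym_kernel n u v * ?M v))"
    using surv_low[OF _ _ _ k] M by (intro surv_step[OF w(2)]) auto
  also have "\<dots> \<le> (\<Sum>u=1..n. 1 * (real n * (2 * real n ^ 6 + ?e * M)))"
    using inner sym_kernel_le_1 w M0
    by (intro sum_mono mult_mono sum_nonneg mult_nonneg_nonneg) (auto simp: sym_kernel_nonneg)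
  also have "\<dots> = 2 * real n ^ 8 + real n ^ 2 * ?e * M"
    by (simp add: eval_nat_numeral algebra_simps)
  finally show ?thesis by (simp add: mult.assoc)
qed

text \<open>Iterates the map that takes \<open>x\<close> to
  \<open>2 * n^8 + exp (- \<kappa> * n) * x\<close>. The exponential term starts from
  \<open>sqrt (2^n) \<le> exp n\<close>, and \<open>4 * n^8\<close> reproduces itself because the
  factor in front of it is at most \<open>1/2\<close>.\<close>

lemma surv_iterate:
  assumes e: "real n ^ 2 * sqrt (2 * real n) * exp (- (c / (8 * K\<^sup>2)) * real n) \<le> exp (- \<kappa> * real n)"
    and half: "exp (- \<kappa> * real n) \<le> 1/2" and w: "1 \<le> w" "w \<le> n"
  shows "sqrt (real (n choose w)) * surv \<eta> n (2 + j) w \<le> 4 * real n ^ 8 + exp (real n - \<kappa> * real n * real j)"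
  using w
proof (induction j arbitrary: w)
  case 0
  have "real (n choose w) \<le> 2 ^ n" using binomial_le_pow2[of n w] by (metis of_nat_le_iff of_nat_numeral of_nat_power)
  also have "(2::real) ^ n \<le> exp 1 ^ n" using exp_ge_add_one_self[of 1] by (intro power_mono) auto
  also have "\<dots> = exp (real n)" by (simp add: exp_of_nat_mult[symmetric])
  also have "\<dots> \<le> exp (real n) ^ 2" by (simp add: self_le_power)
  finally have "sqrt (real (n choose w)) \<le> exp (real n)" by (simp add: real_le_lsqrt)
  hence "sqrt (real (n choose w)) * surv \<eta> n 2 w \<le> exp (real n) * 1"
    using surv_nonneg_le_1[of w n \<eta> 2] 0 by (intro mult_mono) auto
  then show ?case by (simp add: add_increasing)
next
  case (Suc j)
  let ?M = "4 * real n ^ 8 + exp (real n - \<kappa> * real n * real j)"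
  have M0: "0 \<le> ?M" by (simp add: add_nonneg_nonneg)
  have "sqrt (real (n choose w)) * surv \<eta> n (Suc (2 + j)) w
     \<le> 2 * real n ^ 8 + real n ^ 2 * sqrt (2 * real n) * exp (- (c / (8 * K\<^sup>2)) * real n) * ?M"
    using Suc by (intro surv_step_crude) auto
  also have "\<dots> \<le> 2 * real n ^ 8 + exp (- \<kappa> * real n) * ?M"
    using mult_right_mono[OF e M0] by simp
  also have "\<dots> = 2 * real n ^ 8 + exp (- \<kappa> * real n) * (4 * real n ^ 8)
      + exp (real n - \<kappa> * real n * real (Suc j))"
    by (simp add: distrib_left algebra_simps flip: exp_add)
  also have "exp (- \<kappa> * real n) * (4 * real n ^ 8) \<le> (1/2) * (4 * real n ^ 8)"
    using half by (intro mult_right_mono) auto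
  finally show ?case by simp
qed

end

lemma surv_eventually_polynomial:
  assumes eta: "0 < \<eta>" "\<eta> \<le> 1/6"
  shows "\<exists>k. \<forall>\<^sub>F n in sequentially. even n \<longrightarrow> (\<forall>w. 1 \<le> w \<longrightarrow> w \<le> n \<longrightarrow>
           sqrt (real (n choose w)) * surv \<eta> n k w \<le> 5 * real n ^ 8)" (is "\<exists>k. ?P k")
proof -
  define r where "r = 1 - 4 * \<eta>\<^sup>2"
  define q where "q = max r (1/2)"
  define c where "c = - ln q / 6"
  define K where "K = max 1 (4 / c)"
  define d where "d = c / (8 * K\<^sup>2)"
  \<comment> \<open>Half of the rate \<open>d\<close> is given up to absorb
    \<open>n^2 * sqrt (2 * n)\<close>; then \<open>j\<close> rounds at the remaining rate cancel the
    initial \<open>exp n\<close>.\<close>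
  define \<kappa> where "\<kappa> = d / 2"
  define j where "j = nat \<lceil>1 / \<kappa>\<rceil>"
  have q: "0 < q" "q < 1" using eta by (auto simp: q_def r_def)
  have "0 < c" using q by (simp add: c_def)
  moreover have "1 \<le> K" by (simp add: K_def)
  ultimately have d: "0 < d" by (simp add: d_def)
  hence kappa: "0 < \<kappa>" by (simp add: \<kappa>_def)
  have kj: "1 \<le> \<kappa> * real j"
  proof -
    have "1 / \<kappa> \<le> real j" unfolding j_def using kappa by linarith
    thus ?thesis using kappa by (simp add: field_simps)
  qed
  have "\<forall>\<^sub>F n in sequentially. real n ^ 2 * sqrt (2 * real n) * exp (- d * real n) \<le> exp (- (d / 2) * real n)"
    using d by real_asymp
  moreover have "\<forall>\<^sub>F n in sequentially. exp (- \<kappa> * real n) \<le> 1/2"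
    using kappa by real_asymp
  moreover have "\<forall>\<^sub>F n in sequentially. 1 \<le> (n::nat)" by (rule eventually_ge_at_top)
  ultimately have "?P (2 + j)"
  proof eventually_elim
    case (elim n)
    show ?case
    proof (intro impI allI)
      fix w assume n: "even n" and w: "1 \<le> w" "w \<le> n"
      have "sqrt (real (n choose w)) * surv \<eta> n (2 + j) w
          \<le> 4 * real n ^ 8 + exp (real n - \<kappa> * real n * real j)"
        using elim n w
        by (intro surv_iterate[OF eta r_def q_def c_def K_def, of n "n div 2"])
           (auto simp: d_def \<kappa>_def)
      also have "exp (real n - \<kappa> * real n * real j) \<le> exp 0"
      proof -
        have "real n * 1 \<le> real n * (\<kappa> * real j)" using kj by (intro mult_left_mono) auto
        thus ?thesis by (simp add: mult_ac)
      qed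
      also have "exp 0 \<le> real n ^ 8" using elim by simp
      finally show "sqrt (real (n choose w)) * surv \<eta> n (2 + j) w \<le> 5 * real n ^ 8" by simp
    qed
  qed
  thus ?thesis by blast
qed

section \<open>Polynomial gains from the row and column sums of the kernel\<close>

text \<open>Four cases. For \<open>u div 2 \<ge> s\<close> the power of \<open>r\<close> is small
  enough by itself. For smaller \<open>u\<close> with \<open>wbar n w \<ge> u + 7\<close>, seven
  binomial ratios of size \<open>n powr (6/7)\<close> give \<open>n^6\<close>. If
  \<open>wbar n w \<le> u + 6\<close> and \<open>u \<ge> 16\<close>, eight factors
  \<open>4 * wbar n w / n\<close> do. What remains is \<open>u \<le> 15\<close> and
  \<open>wbar n w \<le> 21\<close>, where only the order \<open>1 / sqrt n\<close> is available. The
  target \<open>n^6\<close> refers to the squared kernel; the resulting \<open>1 / n^3\<close> per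
  entry stays negligible when summed over \<open>n\<close> weights.\<close>

lemma sym_kernel_pointwise:
  fixes \<eta> r s :: real and n h :: nat
  assumes eta: "0 < \<eta>" "\<eta> \<le> 1/6" and r_def: "r = 1 - 4 * \<eta>\<^sup>2" and n_def: "n = 2 * h" and n1: "1 \<le> n"
    and e1: "real n * r powr s \<le> 1 / real n ^ 6"
    and e2: "real n powr (6/7) * (2 * s + 8) + 2 * s + 7 \<le> real n"
    and e3: "real n * (4 * (2 * s + 7) / real n) ^ 8 \<le> 1 / real n ^ 6" "4 * (2 * s + 7) / real n \<le> 1"
    and u: "1 \<le> u" "u \<le> n" and w: "1 \<le> w" "w \<le> n" "unbal \<eta> n w"
  shows "sym_kernel n u w \<le> 1 / real n ^ 3 \<or>
     u \<le> 15 \<and> wbar n w \<le> 21 \<and> sym_kernel n u w \<le> sqrt (15^15 * 2^42 * 21^21 / real n)"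
proof -
  let ?T = "real (trans_count n u w)" and ?X = "real (n choose u)" and ?Y = "real (n choose w)"
  let ?a = "u div 2" and ?v = "wbar n w"
  have TX: "?T \<le> ?X" using trans_count_le_left[of n u w] by simp
  have TY: "?T \<le> ?Y" using trans_count_le_right[OF w(2), of u] by simp
  note r = one_minus_four_sq_bounds[OF eta, folded r_def]
  have small: "sym_kernel n u w \<le> 1 / real n ^ 3" if "?T ^ 2 \<le> 1 / real n ^ 6 * (?X * ?Y)"
  proof -
    have "sym_kernel n u w \<le> sqrt (1 / real n ^ 6)"
      by (rule sym_kernel_le_sqrt[OF that u(2) w(2)]) simp
    also have "1 / real n ^ 6 = (1 / real n ^ 3) ^ 2" by (simp add: power_divide flip: power_mult)
    finally show ?thesis by simp
  qed
  have byX: "sym_kernel n u w \<le> 1 / real n ^ 3" if "?T \<le> 1 / real n ^ 6 * ?X"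
  proof (rule small)
    have "?T * ?T \<le> (1 / real n ^ 6 * ?X) * ?Y" using that TY by (intro mult_mono) auto
    thus "?T ^ 2 \<le> 1 / real n ^ 6 * (?X * ?Y)" by (simp add: power2_eq_square)
  qed
  show ?thesis
  proof (cases "s \<le> real ?a")
    case True
    have "?T \<le> real n * r ^ ?a * ?X"
      using trans_unbal[OF eta r_def refl refl refl n_def n1 u w] .
    also have "r ^ ?a = r powr real ?a" using r by (simp add: powr_realpow)
    also have "r powr real ?a \<le> r powr s" using True r by (intro powr_mono') auto
    hence "real n * r powr real ?a * ?X \<le> real n * r powr s * ?X" by (intro mult_right_mono mult_left_mono) auto
    also have "\<dots> \<le> 1 / real n ^ 6 * ?X" using e1 by (intro mult_right_mono) auto
    finally show ?thesis using byX by blast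
  next
    case a: False
    have us: "real u \<le> 2 * s + 1" using a by linarith
    show ?thesis
    proof (cases "u + 7 \<le> ?v")
      case True
      have "(real n powr (6/7)) ^ 7 * ?X \<le> real (n choose (u + 7))"
      proof (rule choose_ratio)
        fix i assume i: "u \<le> i" "i < u + 7"
        have "real n powr (6/7) * real (Suc i) \<le> real n powr (6/7) * (2 * s + 8)"
          using i us by (intro mult_left_mono) auto
        moreover have "real i \<le> 2 * s + 7" using i us by linarith
        ultimately show "real n powr (6/7) * real (Suc i) \<le> real n - real i" using e2 by linarith
      qed simp
      also have "(real n powr (6/7)) ^ 7 = real n ^ 6" using n1
        by (simp add: powr_power)
      also have "real (n choose (u + 7)) \<le> real (n choose ?v)"
        using True wbar_le(1)[of n w] by (intro of_nat_mono binomial_mono) auto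
      finally have "?X \<le> 1 / real n ^ 6 * ?Y"
        using n1 unfolding choose_wbar[OF w(2)] by (simp add: field_simps)
      hence "?T * ?T \<le> ?X * (1 / real n ^ 6 * ?Y)" using TX by (intro mult_mono) auto
      hence "?T ^ 2 \<le> 1 / real n ^ 6 * (?X * ?Y)" by (simp add: power2_eq_square)
      thus ?thesis using small by blast
    next
      case v: False
      show ?thesis
      proof (cases "8 \<le> ?a")
        case True
        let ?y = "4 * (2 * s + 7) / real n"
        have s0: "0 \<le> s" using a by linarith
        have "4 * real ?v / real n \<le> ?y" using v us by (intro divide_right_mono) auto
        hence "(4 * real w * real (n - w) / real n ^ 2) ^ ?a \<le> ?y ^ ?a"
          using wbar_bound[OF n1 w(2)] by (intro power_mono) auto
        also have "\<dots> \<le> ?y ^ 8" using True e3(2) s0 by (intro power_decreasing) auto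
        finally have "real n * (4 * real w * real (n - w) / real n ^ 2) ^ ?a * ?X \<le> real n * ?y ^ 8 * ?X"
          by (intro mult_right_mono mult_left_mono) auto
        hence "?T \<le> real n * ?y ^ 8 * ?X"
          using trans_count_le_choose[OF n_def u w(1,2)] by linarith
        also have "\<dots> \<le> 1 / real n ^ 6 * ?X" using e3(1) by (intro mult_right_mono) auto
        finally show ?thesis using byX by blast
      next
        case False
        hence b: "u \<le> 15" "?v \<le> 21" using v by auto
        have "?T ^ 2 * real n \<le> (15^15 * ?X) * 2^42 * (21^21 * ?Y)"
          using trans_count_small_weights[OF u(1) b(1) u(2) w(1,2) b(2)] .
        hence "?T ^ 2 \<le> (15^15 * ?X) * 2^42 * (21^21 * ?Y) / real n"
          using n1 by (simp add: pos_le_divide_eq)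
        also have "\<dots> = 15^15 * 2^42 * 21^21 / real n * (?X * ?Y)" by simp
        finally have "sym_kernel n u w \<le> sqrt (15^15 * 2^42 * 21^21 / real n)"
          by (rule sym_kernel_le_sqrt[OF _ u(2) w(2)]) simp
        thus ?thesis using b by blast
      qed
    qed
  qed
qed

lemma card_wbar_le: "card {v \<in> {1..n}. wbar n v \<le> 21} \<le> 44"
proof -
  have "{v \<in> {1..n}. wbar n v \<le> 21} \<subseteq> {..21} \<union> {n-21..n}" by (auto simp: wbar_def min_def split: if_splits)
  hence "card {v \<in> {1..n}. wbar n v \<le> 21} \<le> card ({..21} \<union> {n-21..n})" by (intro card_mono) auto
  also have "\<dots> \<le> card {..21::nat} + card {n-21..n}" by (rule card_Un_le)
  also have "\<dots> \<le> 44" by simp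
  finally show ?thesis .
qed

lemma sym_kernel_sums:
  assumes eta: "0 < \<eta>" "\<eta> \<le> 1/6"
  shows "\<forall>\<^sub>F n in sequentially. even n \<longrightarrow>
     (\<forall>u\<in>{1..n}. (\<Sum>v | v \<in> {1..n} \<and> unbal \<eta> n v. sym_kernel n u v) \<le> real n powr (-1/4)) \<and>
     (\<forall>w\<in>{1..n}. unbal \<eta> n w \<longrightarrow> (\<Sum>u=1..n. sym_kernel n u w) \<le> real n powr (-1/4))"
proof -
  define r where "r = 1 - 4 * \<eta>\<^sup>2"
  define C :: real where "C = 15^15 * 2^42 * 21^21"
  have C: "C > 0" by (simp add: C_def)
  note r = one_minus_four_sq_bounds[OF eta, folded r_def]
  \<comment> \<open>The threshold \<open>s = n powr (1/20)\<close> has to make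
    \<open>r powr s\<close> smaller than any power of \<open>n\<close>, while being small enough for
    \<open>6/7 + 1/20 < 1\<close> and \<open>1 - 8 * (1 - 1/20) < -6\<close>.\<close>
  have "\<forall>\<^sub>F n in sequentially. real n * r powr (real n powr (1/20)) \<le> 1 / real n ^ 6"
    using r by real_asymp
  moreover have "\<forall>\<^sub>F n in sequentially. real n powr (6/7) * (2 * real n powr (1/20) + 8) + 2 * real n powr (1/20) + 7 \<le> real n"
    by real_asymp
  moreover have "\<forall>\<^sub>F n in sequentially. real n * (4 * (2 * real n powr (1/20) + 7) / real n) ^ 8 \<le> 1 / real n ^ 6"
    by real_asymp
  moreover have "\<forall>\<^sub>F n in sequentially. 4 * (2 * real n powr (1/20) + 7) / real n \<le> 1"
    by real_asymp
  \<comment> \<open>The bounded weights dominate, at most 22 near \<open>0\<close> and 22 near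
    \<open>n\<close>, with total of order \<open>n powr (-1/2)\<close>. The weaker exponent
    \<open>-1/4\<close> swallows the constant \<open>C\<close>.\<close>
  moreover have "\<forall>\<^sub>F n in sequentially. real n * (1 / real n ^ 3) + 44 * sqrt (C / real n) \<le> real n powr (-1/4)"
    using C by real_asymp
  moreover have "\<forall>\<^sub>F n in sequentially. 1 \<le> (n::nat)" by (rule eventually_ge_at_top)
  ultimately show ?thesis
  proof eventually_elim
    case (elim n)
    have pw: "sym_kernel n u w \<le> 1 / real n ^ 3 + (if u \<le> 15 \<and> wbar n w \<le> 21 then sqrt (C / real n) else 0)"
      if "even n" "u \<in> {1..n}" "w \<in> {1..n}" "unbal \<eta> n w" for u w
      using sym_kernel_pointwise[OF eta r_def, of n "n div 2" "real n powr (1/20)" u w] elim that C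
      unfolding C_def[symmetric] by (auto intro: add_increasing2 add_increasing)
    have sq: "0 \<le> sqrt (C / real n)" using C by simp
    show ?case
    proof (intro impI conjI ballI)
      fix u assume n: "even n" and u: "u \<in> {1..n}"
      have "(\<Sum>v | v \<in> {1..n} \<and> unbal \<eta> n v. sym_kernel n u v)
         \<le> (\<Sum>v | v \<in> {1..n} \<and> unbal \<eta> n v. 1 / real n ^ 3 + (if wbar n v \<le> 21 then sqrt (C / real n) else 0))"
      proof (intro sum_mono)
        fix v assume "v \<in> {v. v \<in> {1..n} \<and> unbal \<eta> n v}"
        thus "sym_kernel n u v \<le> 1 / real n ^ 3 + (if wbar n v \<le> 21 then sqrt (C / real n) else 0)"
          using pw[OF n u, of v] sq by (cases "u \<le> 15") (auto simp del: real_sqrt_ge_0_iff)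
      qed
      also have "\<dots> \<le> (\<Sum>v\<in>{1..n}. 1 / real n ^ 3 + (if wbar n v \<le> 21 then sqrt (C / real n) else 0))"
        using sq by (intro sum_mono2) auto
      also have "\<dots> = real n * (1 / real n ^ 3) + real (card {v \<in> {1..n}. wbar n v \<le> 21}) * sqrt (C / real n)"
        by (simp add: sum.distrib sum.If_cases Int_def)
      also have "\<dots> \<le> real n * (1 / real n ^ 3) + 44 * sqrt (C / real n)"
        using card_wbar_le[of n] sq by (intro add_left_mono mult_right_mono) auto
      finally show "(\<Sum>v | v \<in> {1..n} \<and> unbal \<eta> n v. sym_kernel n u v) \<le> real n powr (-1/4)"
        using elim by linarith
    next
      fix w assume n: "even n" and w: "w \<in> {1..n}" and b: "unbal \<eta> n w"
      have "(\<Sum>u=1..n. sym_kernel n u w)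
         \<le> (\<Sum>u=1..n. 1 / real n ^ 3 + (if u \<le> 15 then sqrt (C / real n) else 0))"
      proof (intro sum_mono)
        fix u assume "u \<in> {1..n}"
        thus "sym_kernel n u w \<le> 1 / real n ^ 3 + (if u \<le> 15 then sqrt (C / real n) else 0)"
          using pw[OF n _ w b, of u] sq by (cases "wbar n w \<le> 21") (auto simp del: real_sqrt_ge_0_iff)
      qed
      also have "\<dots> = real n * (1 / real n ^ 3) + real (card {u \<in> {1..n}. u \<le> 15}) * sqrt (C / real n)"
        by (simp add: sum.distrib sum.If_cases Int_def)
      also have "\<dots> \<le> real n * (1 / real n ^ 3) + 44 * sqrt (C / real n)"
      proof -
        have "card {u \<in> {1..n}. u \<le> 15} \<le> card {..15::nat}" by (intro card_mono) auto
        thus ?thesis using sq by (intro add_left_mono mult_right_mono) auto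
      qed
      finally show "(\<Sum>u=1..n. sym_kernel n u w) \<le> real n powr (-1/4)"
        using elim by linarith
    qed
  qed
qed

text \<open>Each further round costs one column sum of the kernel for the derivative and one row sum
  for the accumulator, \<open>n powr (-1/4)\<close> each. The column bound is available at
  unbalanced \<open>w\<close> only, hence the restriction in the claim; the recursion stays within
  these weights. The 8 is the degree left by \<open>surv_eventually_polynomial\<close>.\<close>

lemma surv_decay:
  assumes eta: "0 < \<eta>" "\<eta> \<le> 1/6"
  shows "\<exists>k. \<forall>\<^sub>F n in sequentially. even n \<longrightarrow> (\<forall>m\<ge>k. \<forall>w. 1 \<le> w \<longrightarrow> w \<le> n \<longrightarrow> unbal \<eta> n w \<longrightarrow>
           sqrt (real (n choose w)) * surv \<eta> n m w \<le> 5 * real n powr (8 - (real m - real k) / 2))" (is "\<exists>k. ?P k")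
proof -
  obtain k where k: "\<forall>\<^sub>F n in sequentially. even n \<longrightarrow> (\<forall>w. 1 \<le> w \<longrightarrow> w \<le> n \<longrightarrow>
           sqrt (real (n choose w)) * surv \<eta> n k w \<le> 5 * real n ^ 8)"
    using surv_eventually_polynomial[OF eta] by blast
  have "\<forall>\<^sub>F n in sequentially. 1 \<le> (n::nat)" by (rule eventually_ge_at_top)
  with k sym_kernel_sums[OF eta]
  have "?P k"
  proof eventually_elim
    case (elim n)
    show ?case
    proof (intro impI allI)
      fix m w assume n: "even n" and m: "k \<le> m" and w: "1 \<le> w" "w \<le> n" "unbal \<eta> n w"
      from m w show "sqrt (real (n choose w)) * surv \<eta> n m w \<le> 5 * real n powr (8 - (real m - real k) / 2)"
      proof (induction m arbitrary: w rule: dec_induct)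
        case base
        have "real n powr 8 = real n ^ 8" using elim by (simp add: powr_realpow[of _ 8, simplified])
        then show ?case using elim n base by simp
      next
        case (step m)
        let ?M = "5 * real n powr (8 - (real m - real k) / 2)" and ?g = "real n powr (-1/4)"
        have "sqrt (real (n choose w)) * surv \<eta> n (Suc m) w \<le>
          (\<Sum>u=1..n. sym_kernel n u w * (\<Sum>v | v \<in> {1..n} \<and> unbal \<eta> n v. sym_kernel n u v * ?M))"
          using step by (intro surv_step) auto
        also have "\<dots> \<le> (\<Sum>u=1..n. sym_kernel n u w * (?g * ?M))"
        proof (intro sum_mono mult_left_mono)
          fix u assume "u \<in> {1..n}"
          hence "(\<Sum>v | v \<in> {1..n} \<and> unbal \<eta> n v. sym_kernel n u v) * ?M \<le> ?g * ?M"
            using elim n by (intro mult_right_mono) auto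
          thus "(\<Sum>v | v \<in> {1..n} \<and> unbal \<eta> n v. sym_kernel n u v * ?M) \<le> ?g * ?M"
            by (simp add: sum_distrib_right)
        qed (rule sym_kernel_nonneg)
        also have "\<dots> = (\<Sum>u=1..n. sym_kernel n u w) * (?g * ?M)"
          by (simp add: sum_distrib_right)
        also have "\<dots> \<le> ?g * (?g * ?M)"
          using elim n step.prems by (intro mult_right_mono) auto
        also have "\<dots> = 5 * real n powr (8 - (real (Suc m) - real k) / 2)"
        proof -
          have "8 - (real (Suc m) - real k) / 2 = - 1/4 + (- 1/4 + (8 - (real m - real k) / 2))"
            by (simp add: field_simps)
          thus ?thesis by (simp only: powr_add)
        qed
        finally show ?case .
      qed
    qed
  qed
  thus ?thesis by blast
qed

subsection \<open>The expected number of codewords of low weight\<close>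

text \<open>At a balanced weight the bound \<open>t\<close> holds after any number of rounds: by
  invariance, one term of the total mass of \<open>f\<close> is at most the whole. A path from an
  unbalanced weight is split at the first round that ends balanced, from where on it contributes at
  most \<open>t\<close>; otherwise it is counted by \<open>surv\<close>.\<close>

lemma round_le_surv:
  assumes f: "\<And>w. 1 \<le> w \<Longrightarrow> w \<le> n \<Longrightarrow> 0 \<le> f w \<and> f w \<le> 1"
    and t: "\<And>w. 1 \<le> w \<Longrightarrow> w \<le> n \<Longrightarrow> \<not> unbal \<eta> n w \<Longrightarrow>
              (\<Sum>v=1..n. real (n choose v) * f v) \<le> t * real (n choose w)"
    and t0: "0 \<le> t" and w: "1 \<le> w" "w \<le> n"
  shows "((opD n \<circ> opA n) ^^ k) f w \<le> t + (if unbal \<eta> n w then surv \<eta> n k w else 0)"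
proof -
  define F where "F k = ((opD n \<circ> opA n) ^^ k) f" for k
  have F0: "F 0 = f" and FS: "F (Suc k) = opD n (opA n (F k))" for k
    by (simp_all add: F_def)
  have nn: "0 \<le> F k v" if "1 \<le> v" "v \<le> n" for k v
    using that
  proof (induction k arbitrary: v)
    case (Suc k)
    have "0 \<le> opA n (F k) u" if "1 \<le> u" "u \<le> n" for u
      using opA_mono[of n "\<lambda>_. 0" "F k" u] Suc.IH that by (simp add: opA_const)
    thus ?case using opD_mono[of n "\<lambda>_. 0" "opA n (F k)" v] Suc.prems by (simp add: opD_const FS)
  qed (use f in \<open>auto simp: F0\<close>)
  have inv: "(\<Sum>v=1..n. real (n choose v) * F k v) = (\<Sum>v=1..n. real (n choose v) * f v)" for k
  proof (induction k)
    case (Suc k)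
    show ?case unfolding Suc.IH[symmetric] FS by (simp only: sum_opD sum_opA)
  qed (simp add: F0)
  have bal: "F k w \<le> t" if "1 \<le> w" "w \<le> n" "\<not> unbal \<eta> n w" for k w
  proof -
    have "real (n choose w) * F k w \<le> (\<Sum>v=1..n. real (n choose v) * F k v)"
      using that nn by (intro member_le_sum) auto
    hence "real (n choose w) * F k w \<le> real (n choose w) * t"
      using t[OF that] unfolding inv by (simp add: mult.commute)
    thus ?thesis using that by simp
  qed
  have "F k w \<le> t + (if unbal \<eta> n w then surv \<eta> n k w else 0)"
    using w
  proof (induction k arbitrary: w)
    case 0
    then show ?case using f[OF 0] t0 bal[of w 0] by (simp add: surv_0 F0)
  next
    case (Suc k)
    have opA_le: "opA n (F k) u \<le> t + opK \<eta> n (surv \<eta> n k) u" if "1 \<le> u" "u \<le> n" for u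
      using opA_mono[of n "F k" "\<lambda>w. t + (if unbal \<eta> n w then surv \<eta> n k w else 0)" u] Suc.IH that
      by (simp add: opA_add_const opK_def)
    have "F (Suc k) w \<le> t + surv \<eta> n (Suc k) w"
      using opD_mono[of n "opA n (F k)" "\<lambda>u. t + opK \<eta> n (surv \<eta> n k) u" w] opA_le Suc.prems
      by (simp add: opD_add_const surv_Suc FS)
    thus ?case using bal[OF Suc.prems, of "Suc k"] by simp
  qed
  thus ?thesis by (simp only: F_def)
qed

lemma choose_le_sqrt_choose: "real (h choose j) \<le> sqrt (real ((2 * h) choose (2 * j)))"
proof (rule real_le_rsqrt)
  show "real (h choose j) ^ 2 \<le> real ((2 * h) choose (2 * j))"
    using choose_mult_choose_le[of h j h j]
    by (simp add: power2_eq_square mult_2 flip: of_nat_mult)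
qed

lemma sum_choose_le: "(\<Sum>j=1..h. real (h choose j)) \<le> 2 ^ h"
proof -
  have "(\<Sum>j=1..h. real (h choose j)) \<le> (\<Sum>j\<le>h. real (h choose j))" by (intro sum_mono2) auto
  also have "\<dots> = real (\<Sum>j\<le>h. h choose j)" by simp
  also have "\<dots> = 2 ^ h" by (subst choose_row_sum) simp
  finally show ?thesis .
qed

context
  fixes f :: "nat \<Rightarrow> real" and n h m :: nat and \<eta> t M :: real
  assumes f: "\<And>w. 1 \<le> w \<Longrightarrow> w \<le> n \<Longrightarrow> 0 \<le> f w \<and> f w \<le> 1"
    and t: "\<And>w. 1 \<le> w \<Longrightarrow> w \<le> n \<Longrightarrow> \<not> unbal \<eta> n w \<Longrightarrow>
              (\<Sum>v=1..n. real (n choose v) * f v) \<le> t * real (n choose w)"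
    and t0: "0 \<le> t" and n: "n = 2 * h"
    and M: "\<And>w. 1 \<le> w \<Longrightarrow> w \<le> n \<Longrightarrow> unbal \<eta> n w \<Longrightarrow> sqrt (real (n choose w)) * surv \<eta> n m w \<le> M" and M0: "0 \<le> M"
begin

lemma first_moment_DA:
  shows "(\<Sum>j=1..h. real (h choose j) * ((opD n \<circ> opA n) ^^ m) f (2 * j)) \<le> 2 ^ h * t + real n * M"
proof -
  have "real (h choose j) * ((opD n \<circ> opA n) ^^ m) f (2 * j) \<le> real (h choose j) * t + M" if j: "j \<in> {1..h}" for j
  proof -
    have j': "1 \<le> 2 * j" "2 * j \<le> n" using j n by auto
    have "real (h choose j) * ((opD n \<circ> opA n) ^^ m) f (2 * j) \<le>
        real (h choose j) * (t + (if unbal \<eta> n (2 * j) then surv \<eta> n m (2 * j) else 0))"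
      by (intro mult_left_mono round_le_surv[OF f t t0 j']) auto
    also have "\<dots> \<le> real (h choose j) * t + M"
    proof (cases "unbal \<eta> n (2 * j)")
      case True
      have "real (h choose j) * surv \<eta> n m (2 * j) \<le> sqrt (real (n choose (2 * j))) * surv \<eta> n m (2 * j)"
        using choose_le_sqrt_choose[of h j] n surv_nonneg_le_1[OF j'] by (intro mult_right_mono) auto
      thus ?thesis using M[OF j' True] True by (simp add: distrib_left)
    qed (use M0 in simp)
    finally show ?thesis .
  qed
  hence "(\<Sum>j=1..h. real (h choose j) * ((opD n \<circ> opA n) ^^ m) f (2 * j))
     \<le> (\<Sum>j=1..h. real (h choose j) * t + M)" by (intro sum_mono) auto
  also have "\<dots> = (\<Sum>j=1..h. real (h choose j)) * t + real h * M" by (simp add: sum.distrib sum_distrib_right)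
  also have "\<dots> \<le> 2 ^ h * t + real n * M"
    using n M0 t0 by (intro add_mono mult_right_mono sum_choose_le) auto
  finally show ?thesis .
qed

text \<open>The product \<open>A D A D ... A D\<close> is bracketed as \<open>A (D A)^m D\<close>.
  The final derivative is absorbed into \<open>f\<close>, which keeps its values in the unit
  interval and its invariant sum; the leading accumulator is estimated by kernel entries at most 1.
  So one round and one factor \<open>n\<close> are lost against the other code.\<close>

lemma first_moment_AD:
  shows "(\<Sum>j=1..h. real (h choose j) * ((opA n \<circ> opD n) ^^ Suc m) f (2 * j)) \<le> 2 ^ h * t + real n ^ 2 * M"
proof -
  let ?F = "((opD n \<circ> opA n) ^^ m) (opD n f)"
  have rotate: "((opA n \<circ> opD n) ^^ Suc m) f = opA n ?F"
    by (induction m) (simp_all only: funpow.simps o_apply id_apply)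
  have Df: "0 \<le> opD n f w \<and> opD n f w \<le> 1" if "1 \<le> w" "w \<le> n" for w
    using opD_mono[of n "\<lambda>_. 0" f w] opD_mono[of n f "\<lambda>_. 1" w] f that by (simp add: opD_const)
  have F: "?F w \<le> t + (if unbal \<eta> n w then surv \<eta> n m w else 0)" if "1 \<le> w" "w \<le> n" for w
    by (rule round_le_surv) (use Df t t0 that in \<open>auto simp only: sum_opD\<close>)
  have "real (h choose j) * opA n ?F (2 * j) \<le> real (h choose j) * t + real n * M" if j: "j \<in> {1..h}" for j
  proof -
    have j': "1 \<le> 2 * j" "2 * j \<le> n" using j n by auto
    let ?g = "\<lambda>w. if unbal \<eta> n w then surv \<eta> n m w else 0"
    have "opA n ?F (2 * j) \<le> t + opA n ?g (2 * j)"
      using opA_mono[of n ?F "\<lambda>w. t + ?g w" "2 * j"] F j' by (simp add: opA_add_const)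
    from mult_left_mono[OF this, of "real (h choose j)"]
    have "real (h choose j) * opA n ?F (2 * j) \<le> real (h choose j) * t + real (h choose j) * opA n ?g (2 * j)"
      by (simp only: distrib_left of_nat_0_le_iff)
    moreover have "real (h choose j) * opA n ?g (2 * j) \<le> sqrt (real (n choose (2 * j))) * opA n ?g (2 * j)"
    proof (rule mult_right_mono)
      show "0 \<le> opA n ?g (2 * j)"
        unfolding opA_def using surv_nonneg_le_1
        by (intro divide_nonneg_nonneg sum_nonneg mult_nonneg_nonneg) auto
    qed (use choose_le_sqrt_choose[of h j] n in simp)
    moreover have "sqrt (real (n choose (2 * j))) * opA n ?g (2 * j)
        = (\<Sum>w=1..n. sym_kernel n (2 * j) w * (sqrt (real (n choose w)) * ?g w))"
      using j' by (simp add: sqrt_times_opA)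
    moreover have "(\<Sum>w=1..n. sym_kernel n (2 * j) w * (sqrt (real (n choose w)) * ?g w)) \<le> (\<Sum>w=1..n. 1 * M)"
      using M M0 j' sym_kernel_le_1 surv_nonneg_le_1
      by (intro sum_mono mult_mono) auto
    moreover have "(\<Sum>w=1..n. 1 * M) = real n * M" by simp
    ultimately show ?thesis by linarith
  qed
  hence "(\<Sum>j=1..h. real (h choose j) * opA n ?F (2 * j))
     \<le> (\<Sum>j=1..h. real (h choose j) * t + real n * M)" by (intro sum_mono) auto
  also have "\<dots> = (\<Sum>j=1..h. real (h choose j)) * t + real h * (real n * M)"
    by (simp add: sum.distrib sum_distrib_right)
  also have "\<dots> \<le> 2 ^ h * t + real n * (real n * M)"
    using n M0 t0 by (intro add_mono mult_right_mono sum_choose_le) auto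
  finally show ?thesis unfolding rotate by (simp add: power2_eq_square mult.assoc)
qed

end

section \<open>Entropy estimates for tails and for balanced binomial coefficients\<close>

text \<open>For \<open>w \<le> \<delta> * n\<close> and \<open>\<delta> \<le> 1/2\<close> the factor
  \<open>\<delta> ^ w * (1 - \<delta>) ^ (n - w)\<close> of the binomial distribution is at least
  its value at \<open>w = \<delta> * n\<close>, which is
  \<open>2 powr (- n * binary_entropy \<delta>)\<close>; and the binomial probabilities sum to
  1.\<close>

lemma sum_choose_entropy:
  assumes d: "0 < \<delta>" "\<delta> \<le> 1/2"
  shows "(\<Sum>w=1..n. real (n choose w) * of_bool (real w < \<delta> * real n)) \<le> 2 powr (real n * binary_entropy \<delta>)"
proof -
  let ?E = "exp (- real n * (\<delta> * ln \<delta> + (1 - \<delta>) * ln (1 - \<delta>)))"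
  have "2 powr (real n * binary_entropy \<delta>) = exp (real n * (binary_entropy \<delta> * ln 2))"
    by (simp add: powr_def mult_ac)
  also have "binary_entropy \<delta> * ln 2 = - (\<delta> * ln \<delta> + (1 - \<delta>) * ln (1 - \<delta>))"
    by (simp add: binary_entropy_def log_def field_simps)
  finally have E: "2 powr (real n * binary_entropy \<delta>) = ?E" by (simp only: mult_minus_right mult_minus_left)
  have "real (n choose w) * of_bool (real w < \<delta> * real n) \<le> ?E * (real (n choose w) * \<delta> ^ w * (1 - \<delta>) ^ (n - w))"
    if w: "w \<in> {1..n}" for w
  proof (cases "real w < \<delta> * real n")
    case True
    have lnle: "ln \<delta> \<le> ln (1 - \<delta>)" using d by simp
    have "\<delta> ^ w * (1 - \<delta>) ^ (n - w) = exp (real w * ln \<delta> + real (n - w) * ln (1 - \<delta>))"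
      using d by (simp add: exp_add exp_of_nat_mult)
    moreover have "real n * (\<delta> * ln \<delta> + (1 - \<delta>) * ln (1 - \<delta>)) \<le> real w * ln \<delta> + real (n - w) * ln (1 - \<delta>)"
    proof -
      have "(\<delta> * real n - real w) * ln \<delta> \<le> (\<delta> * real n - real w) * ln (1 - \<delta>)"
        using True lnle by (intro mult_left_mono) auto
      thus ?thesis using w by (simp add: of_nat_diff algebra_simps)
    qed
    ultimately have "1 \<le> ?E * (\<delta> ^ w * (1 - \<delta>) ^ (n - w))"
      by (simp flip: exp_add)
    hence "real (n choose w) * 1 \<le> real (n choose w) * (?E * (\<delta> ^ w * (1 - \<delta>) ^ (n - w)))"
      by (intro mult_left_mono) auto
    thus ?thesis using True by (simp add: mult_ac)
  qed (use d in simp)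
  hence "(\<Sum>w=1..n. real (n choose w) * of_bool (real w < \<delta> * real n))
     \<le> (\<Sum>w=1..n. ?E * (real (n choose w) * \<delta> ^ w * (1 - \<delta>) ^ (n - w)))" by (intro sum_mono) auto
  also have "\<dots> \<le> (\<Sum>w\<le>n. ?E * (real (n choose w) * \<delta> ^ w * (1 - \<delta>) ^ (n - w)))"
    using d by (intro sum_mono2) auto
  also have "\<dots> = ?E * (\<delta> + (1 - \<delta>)) ^ n" unfolding binomial_ring sum_distrib_left by simp
  finally show ?thesis using E by simp
qed

text \<open>The central coefficient is at least \<open>2^n / (n + 1)\<close>, being the largest of
  \<open>n + 1\<close> terms. Between the folded weight and the middle lie at most
  \<open>\<eta> * n\<close> steps, each changing the coefficient by a factor of at most 2, since
  \<open>\<eta> \<le> 1/6\<close> keeps the folded weight above \<open>n / 3\<close>.\<close>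

lemma choose_balanced_ge:
  assumes eta: "0 < \<eta>" "\<eta> \<le> 1/6" and n: "n = 2 * h" "1 \<le> n" and w: "w \<le> n" "\<not> unbal \<eta> n w"
  shows "2 powr (real n * (1 - \<eta>)) \<le> real (n + 1) * real (n choose w)"
proof -
  let ?v = "wbar n w"
  have vh: "?v \<le> h" using wbar_le(1)[of n w] n by simp
  have "\<bar>real w / real n - 1/2\<bar> < \<eta>" using w by (simp add: unbal_def)
  hence v: "real n / 2 - \<eta> * real n \<le> real ?v"
    using n w unfolding wbar_def min_def abs_less_iff
    by (auto simp: field_simps of_nat_diff)
  have "\<eta> * real n \<le> 1/6 * real n" using eta by (intro mult_right_mono) auto
  hence v3: "real n / 3 \<le> real ?v" using v by simp
  have up: "real (n choose (?v + k)) \<le> 2 ^ k * real (n choose ?v)" for k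
  proof (induction k)
    case (Suc k)
    let ?i = "?v + k"
    have "real n \<le> 3 * real ?v" using v3 by simp
    hence "n \<le> 3 * ?v" by linarith
    hence "n - ?i \<le> 2 * Suc ?i" by (simp add: le_diff_conv)
    hence "real (n - ?i) \<le> 2 * real (Suc ?i)" by linarith
    hence "real (n - ?i) * real (n choose ?i) \<le> 2 * real (Suc ?i) * (2 ^ k * real (n choose ?v))"
      using Suc.IH by (intro mult_mono) auto
    moreover have "real (Suc ?i) * real (n choose Suc ?i) = real (n - ?i) * real (n choose ?i)"
      using Suc_mult_choose_Suc[of ?i n] by (metis of_nat_mult)
    ultimately have "real (Suc ?i) * real (n choose Suc ?i) \<le> real (Suc ?i) * (2 ^ Suc k * real (n choose ?v))"
      by (simp add: mult_ac del: of_nat_Suc)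
    thus ?case by (simp del: of_nat_Suc)
  qed simp
  have "real n * (1 - \<eta>) \<le> real n - real (h - ?v)"
    using v vh n by (simp add: of_nat_diff algebra_simps)
  hence "2 powr (real n * (1 - \<eta>)) \<le> 2 powr (real n - real (h - ?v))" by simp
  also have "\<dots> = 2 ^ n / 2 ^ (h - ?v)" by (simp add: powr_diff powr_realpow)
  also have "\<dots> \<le> (real (n + 1) * (2 ^ (h - ?v) * real (n choose ?v))) / 2 ^ (h - ?v)"
  proof (rule divide_right_mono)
    have "(2::real) ^ n = real (\<Sum>k\<le>n. n choose k)" by (subst choose_row_sum) simp
    also have "\<dots> \<le> (\<Sum>k\<le>n. real (n choose h))"
      unfolding of_nat_sum using binomial_maximum'[of h] n by (intro sum_mono) auto
    also have "\<dots> = real (n + 1) * real (n choose h)" by simp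
    also have "\<dots> \<le> real (n + 1) * (2 ^ (h - ?v) * real (n choose ?v))"
      using up[of "h - ?v"] vh by (intro mult_left_mono) auto
    finally show "2 ^ n \<le> real (n + 1) * (2 ^ (h - ?v) * real (n choose ?v))" .
  qed simp
  finally show ?thesis using choose_wbar[OF w(1)] by simp
qed

theorem first_moment_bounds:
  assumes d: "0 < \<delta>" "\<delta> \<le> 1/2" "binary_entropy \<delta> < 1/2"
  shows "\<exists>m0. \<forall>m\<ge>m0. \<forall>\<^sub>F n in sequentially. even n \<longrightarrow>
      (\<Sum>j=1..n div 2. real ((n div 2) choose j) * ((opD n \<circ> opA n) ^^ m) (\<lambda>w. of_bool (real w < \<delta> * real n)) (2 * j))
         \<le> real n powr (1/2 - real m / 4) / 2 \<and>
      (\<Sum>j=1..n div 2. real ((n div 2) choose j) * ((opA n \<circ> opD n) ^^ m) (\<lambda>w. of_bool (real w < \<delta> * real n)) (2 * j))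
         \<le> real n powr (1/2 - real m / 4) / 2"
    (is "\<exists>m0. \<forall>m\<ge>m0. \<forall>\<^sub>F n in sequentially. even n \<longrightarrow> ?bounds m n")
proof -
  \<comment> \<open>At most half of the gap between \<open>binary_entropy \<delta>\<close> and
    \<open>1/2\<close> is spent on \<eta>, so a positive exponent \<open>g\<close> is left. The cap
    \<open>1/6\<close> is what the decay estimates and \<open>choose_balanced_ge\<close>
    assume.\<close>
  define \<eta> where "\<eta> = min (1/6) ((1/2 - binary_entropy \<delta>) / 2)"
  define g where "g = 1/2 - binary_entropy \<delta> - \<eta>"
  have eta: "0 < \<eta>" "\<eta> \<le> 1/6" using d by (auto simp: \<eta>_def)
  have g: "0 < g" using d by (auto simp: g_def \<eta>_def min_def)
  obtain k where k: "\<forall>\<^sub>F n in sequentially. even n \<longrightarrow> (\<forall>m\<ge>k. \<forall>w. 1 \<le> w \<longrightarrow> w \<le> n \<longrightarrow> unbal \<eta> n w \<longrightarrow>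
           sqrt (real (n choose w)) * surv \<eta> n m w \<le> 5 * real n powr (8 - (real m - real k) / 2))"
    using surv_decay[OF eta] by blast
  show ?thesis
  proof (intro exI allI impI)
    \<comment> \<open>\<open>8 - (m - 1 - k) / 2 \<le> - 2 - m / 4\<close> holds from
      \<open>m = 2 * k + 42\<close> on. The right side is \<open>e' - 2 - 1/2\<close>, where the 2
      pays for \<open>n^2\<close> and the \<open>1/2\<close> for the constants.\<close>
    fix m assume m: "2 * k + 50 \<le> m"
    \<comment> \<open>The accumulator-first code loses a round to the rotation, so the survival
      bound is required from \<open>m' = m - 1\<close> rounds on and then serves both codes.\<close>
    then obtain m' where m': "m = Suc m'" by (cases m) auto
    have e: "8 - (real m' - real k) / 2 \<le> - 2 - real m / 4" using m m' by (simp add: field_simps)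
    define e' where "e' = 1/2 - real m / 4"
    have "\<forall>\<^sub>F n in sequentially. real (n + 1) * 2 powr (- (g * real n)) \<le> real n powr e' / 4"
      using g by real_asymp
    moreover have "\<forall>\<^sub>F n in sequentially. real n ^ 2 * (5 * real n powr (e' - 2 - 1/2)) \<le> real n powr e' / 4"
    proof -
      have "\<forall>\<^sub>F n in sequentially. 5 * real n powr (-1/2) \<le> 1/4" by real_asymp
      with eventually_ge_at_top[of 1] show ?thesis
      proof eventually_elim
        case (elim n)
        have "real n ^ 2 * (5 * real n powr (e' - 2 - 1/2)) = real n powr e' * (5 * real n powr (-1/2))"
        proof -
          have "real n ^ 2 = real n powr 2" using elim by (simp add: powr_numeral)
          hence "real n ^ 2 * real n powr (e' - 2 - 1/2) = real n powr (2 + (e' - 2 - 1/2))"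
            by (simp only: powr_add)
          also have "2 + (e' - 2 - 1/2) = e' + (-1/2)" by simp
          also have "real n powr (e' + (-1/2)) = real n powr e' * real n powr (-1/2)"
            by (simp only: powr_add)
          finally show ?thesis by (simp only: mult_ac)
        qed
        also have "\<dots> \<le> real n powr e' * (1/4)" using elim by (intro mult_left_mono) auto
        finally show ?case by simp
      qed
    qed
    moreover have "\<forall>\<^sub>F n in sequentially. 1 \<le> (n::nat)" by (rule eventually_ge_at_top)
    ultimately show "\<forall>\<^sub>F n in sequentially. even n \<longrightarrow> ?bounds m n"
      using k
    proof eventually_elim
      case (elim n)
      show ?case
      proof
        assume ev: "even n"
        let ?h = "n div 2" and ?f = "\<lambda>w. of_bool (real w < \<delta> * real n) :: real"
        let ?t = "real (n + 1) * 2 powr (real n * (binary_entropy \<delta> - 1 + \<eta>))"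
        let ?M = "5 * real n powr (e' - 2 - 1/2)"
        have n: "n = 2 * ?h" using ev by simp
        have f: "0 \<le> ?f w \<and> ?f w \<le> 1" for w by simp
        have t: "(\<Sum>v=1..n. real (n choose v) * ?f v) \<le> ?t * real (n choose w)"
          if "1 \<le> w" "w \<le> n" "\<not> unbal \<eta> n w" for w
        proof -
          have "(\<Sum>v=1..n. real (n choose v) * ?f v) \<le> 2 powr (real n * binary_entropy \<delta>)"
            by (rule sum_choose_entropy[OF d(1,2)])
          also have "\<dots> = 2 powr (real n * (binary_entropy \<delta> - 1 + \<eta>)) * 2 powr (real n * (1 - \<eta>))"
            by (simp add: powr_add[symmetric] algebra_simps)
          also have "\<dots> \<le> 2 powr (real n * (binary_entropy \<delta> - 1 + \<eta>)) * (real (n + 1) * real (n choose w))"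
            using choose_balanced_ge[OF eta n _ that(2,3)] elim by (intro mult_left_mono) auto
          finally show ?thesis by (simp add: mult_ac)
        qed
        have M: "sqrt (real (n choose w)) * surv \<eta> n i w \<le> ?M"
          if "m' \<le> i" "1 \<le> w" "w \<le> n" "unbal \<eta> n w" for w i
        proof -
          have "sqrt (real (n choose w)) * surv \<eta> n i w \<le> 5 * real n powr (8 - (real i - real k) / 2)"
            using elim(4) ev that m m' by simp
          also have "\<dots> \<le> ?M"
          proof (intro mult_left_mono powr_mono)
            have "real m' \<le> real i" using that by simp
            thus "8 - (real i - real k) / 2 \<le> e' - 2 - 1/2" using e unfolding e'_def by argo
          qed (use elim in auto)
          finally show ?thesis .
        qed
        have th: "2 ^ ?h * ?t = real (n + 1) * 2 powr (- (g * real n))"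
        proof -
          have h: "real ?h = real n / 2" using ev by (simp add: real_of_nat_div)
          have "(2::real) ^ ?h = 2 powr (real n / 2)" unfolding h[symmetric] by (simp add: powr_realpow)
          thus ?thesis by (simp add: g_def powr_add[symmetric] algebra_simps)
        qed
        have n1: "real n * ?M \<le> real n ^ 2 * ?M"
          using elim by (intro mult_right_mono) (auto simp: power2_eq_square)
        have fin: "real (n + 1) * 2 powr (- (g * real n)) + real n ^ 2 * ?M \<le> real n powr (1/2 - real m / 4) / 2"
          using elim by (simp add: e'_def)
        have "(\<Sum>j=1..?h. real (?h choose j) * ((opD n \<circ> opA n) ^^ m) ?f (2 * j)) \<le> 2 ^ ?h * ?t + real n * ?M"
          by (rule first_moment_DA[OF f t _ n M]) (use m' in auto)
        moreover have "(\<Sum>j=1..?h. real (?h choose j) * ((opA n \<circ> opD n) ^^ m) ?f (2 * j)) \<le> 2 ^ ?h * ?t + real n ^ 2 * ?M"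
          unfolding m' by (rule first_moment_AD[OF f t _ n M]) auto
        ultimately show "?bounds m n"
          using n1 fin unfolding th by linarith
      qed
    qed
  qed
qed

subsection \<open>Random permutations of supports\<close>

lemma ex_permutes_image:
  fixes X Y N :: "nat set"
  assumes "finite N" "X \<subseteq> N" "Y \<subseteq> N" "card X = card Y"
  obtains q where "q permutes N" "q ` X = Y"
proof -
  have fin: "finite X" "finite Y" using assms finite_subset by auto
  obtain a where a: "bij_betw a X Y" using finite_same_card_bij[OF fin assms(4)] by blast
  have "card (N - X) = card (N - Y)" using assms fin by (simp add: card_Diff_subset)
  then obtain b where b: "bij_betw b (N - X) (N - Y)"
    using finite_same_card_bij[of "N - X" "N - Y"] assms by auto
  define q where "q i = (if i \<in> X then a i else if i \<in> N then b i else i)" for i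
  have qX: "bij_betw q X Y" using a by (rule bij_betw_cong[THEN iffD1, rotated]) (simp add: q_def)
  have "bij_betw q (N - X) (N - Y)" using b by (rule bij_betw_cong[THEN iffD1, rotated]) (simp add: q_def)
  with qX have "bij_betw q (X \<union> (N - X)) (Y \<union> (N - Y))" by (rule bij_betw_combine) auto
  moreover have "X \<union> (N - X) = N" "Y \<union> (N - Y) = N" using assms by auto
  ultimately have "bij_betw q N N" by simp
  hence "q permutes N" using assms by (intro bij_imp_permutes) (auto simp: q_def)
  moreover have "q ` X = Y" using qX by (simp add: bij_betw_def)
  ultimately show ?thesis using that by blast
qed

text \<open>A preimage rather than an image: row \<open>i\<close> of \<open>perm_mat n p\<close> has
  its one in column \<open>p i\<close>, so entry \<open>i\<close> of the product is entry
  \<open>p i\<close> of the vector.\<close>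

definition pull_set :: "nat \<Rightarrow> (nat \<Rightarrow> nat) \<Rightarrow> nat set \<Rightarrow> nat set" where
  "pull_set n p S = {i. i < n \<and> p i \<in> S}"

lemma card_pull_set:
  assumes "p permutes {..<n}" "S \<subseteq> {..<n}"
  shows "card (pull_set n p S) = card S"
proof -
  have "bij_betw p (pull_set n p S) S"
  proof (rule bij_betwI')
    fix y assume y: "y \<in> S"
    have "inv_into UNIV p y \<in> {..<n}" using assms y permutes_in_image[OF permutes_inv[OF assms(1)], of y] by blast
    moreover have "p (inv_into UNIV p y) = y" using assms(1) by (simp add: permutes_inverses)
    ultimately show "\<exists>x\<in>pull_set n p S. y = p x" using y by (intro bexI[of _ "inv_into UNIV p y"]) (auto simp: pull_set_def)
  qed (use assms in \<open>auto simp: pull_set_def dest: permutes_inj injD\<close>)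
  thus ?thesis by (rule bij_betw_same_card)
qed

text \<open>By right multiplication all fibres of \<open>p \<mapsto> pull_set n p S\<close> have the same size.\<close>

lemma average_pull_set:
  fixes g :: "nat set \<Rightarrow> real"
  assumes S: "S \<subseteq> {..<n}"
  shows "(\<Sum>p | p permutes {..<n}. g (pull_set n p S)) / fact n =
         (\<Sum>X | X \<subseteq> {..<n} \<and> card X = card S. g X) / real (n choose card S)"
proof -
  let ?P = "{p. p permutes {..<n}}" and ?F = "{X. X \<subseteq> {..<n} \<and> card X = card S}"
  define fib where "fib X = {p \<in> ?P. pull_set n p S = X}" for X
  have finP: "finite ?P" by (rule finite_permutations) simp
  have finF: "finite ?F" by (rule finite_subset[of _ "Pow {..<n}"]) auto
  have le: "card (fib X) \<le> card (fib Y)" if XY: "X \<in> ?F" "Y \<in> ?F" for X Y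
  proof -
    obtain q where q: "q permutes {..<n}" "q ` Y = X"
      using ex_permutes_image[of "{..<n}" Y X] XY by auto
    have "(\<lambda>p. p \<circ> q) ` fib X \<subseteq> fib Y"
    proof safe
      fix p assume p: "p \<in> fib X"
      have "pull_set n (p \<circ> q) S = Y"
      proof -
        have "i \<in> pull_set n (p \<circ> q) S \<longleftrightarrow> i < n \<and> q i \<in> pull_set n p S" for i
          using permutes_in_image[OF q(1), of i] by (auto simp: pull_set_def)
        also have "\<dots> i \<longleftrightarrow> i < n \<and> q i \<in> q ` Y" for i using p q by (auto simp: fib_def)
        also have "\<dots> i \<longleftrightarrow> i \<in> Y" for i
          using XY permutes_inj[OF q(1)] by (auto simp: inj_image_mem_iff)
        finally show ?thesis by blast
      qed
      thus "p \<circ> q \<in> fib Y" using p q by (auto simp: fib_def permutes_compose)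
    qed
    moreover have "inj_on (\<lambda>p. p \<circ> q) (fib X)"
    proof (rule inj_onI)
      fix p p' assume e: "p \<circ> q = p' \<circ> q"
      show "p = p'"
      proof
        fix y
        obtain x where "y = q x" using permutes_surj[OF q(1)] by (metis surjD)
        thus "p y = p' y" using fun_cong[OF e, of x] by simp
      qed
    qed
    moreover have "finite (fib Y)" using finP by (simp add: fib_def)
    ultimately show ?thesis by (meson card_inj_on_le)
  qed
  have SF: "S \<in> ?F" using S by simp
  have eq: "card (fib X) = card (fib S)" if "X \<in> ?F" for X using le that SF by (meson le_antisym)
  have group: "(\<Sum>p\<in>?P. h (pull_set n p S)) = real (card (fib S)) * (\<Sum>X\<in>?F. h X)" for h :: "nat set \<Rightarrow> real"
  proof -
    have "(\<Sum>p\<in>?P. h (pull_set n p S)) = (\<Sum>X\<in>?F. \<Sum>p\<in>{p \<in> ?P. pull_set n p S = X}. h (pull_set n p S))"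
      by (rule sum.group[symmetric]) (use finP finF card_pull_set S in \<open>auto simp: pull_set_def\<close>)
    also have "\<dots> = (\<Sum>X\<in>?F. real (card (fib X)) * h X)"
      by (intro sum.cong refl) (simp add: fib_def)
    also have "\<dots> = (\<Sum>X\<in>?F. real (card (fib S)) * h X)" using eq by (intro sum.cong) auto
    finally show ?thesis by (simp add: sum_distrib_left)
  qed
  have cardP: "card ?P = fact n" by (subst card_permutations[of _ n]) auto
  have cardF: "card ?F = n choose card S" by (subst n_subsets) auto
  have "real (fact n) = real (card (fib S)) * real (n choose card S)"
    using group[of "\<lambda>_. 1"] cardP cardF by simp
  moreover have "card S \<le> n" using card_mono[OF _ S] by simp
  hence "real (n choose card S) > 0" by simp
  moreover have "real (fact n) \<noteq> 0" by simp
  ultimately show ?thesis unfolding group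
    by (metis (no_types, lifting) mult_divide_mult_cancel_left_if mult_zero_left of_nat_fact)
qed

section \<open>Expected weights along a random encoding\<close>

fun encode :: "nat \<Rightarrow> (nat \<Rightarrow> nat set \<Rightarrow> nat set) \<Rightarrow> (nat \<Rightarrow> nat \<Rightarrow> nat) \<Rightarrow> nat \<Rightarrow> nat set \<Rightarrow> nat set" where
  "encode n L \<pi> 0 S = S"
| "encode n L \<pi> (Suc k) S = L (Suc k) (pull_set n (\<pi> (Suc k)) (encode n L \<pi> k S))"

lemma encode_cong: "(\<And>i. 1 \<le> i \<Longrightarrow> i \<le> k \<Longrightarrow> \<pi> i = \<pi>' i) \<Longrightarrow> encode n L \<pi> k S = encode n L \<pi>' k S"
  by (induction k) auto

text \<open>All that the probabilistic part has to know about a layer. Accumulator, derivative and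
  their transposes are instances, so the expectation is computed once for both codes. Empty sets are
  excluded because the operators leave out weight \<open>0\<close>.\<close>

definition weight_kernel :: "nat \<Rightarrow> (nat set \<Rightarrow> nat set) \<Rightarrow> ((nat \<Rightarrow> real) \<Rightarrow> nat \<Rightarrow> real) \<Rightarrow> bool" where
  "weight_kernel n L K \<longleftrightarrow>
     (\<forall>S. S \<subseteq> {..<n} \<longrightarrow> S \<noteq> {} \<longrightarrow> L S \<subseteq> {..<n} \<and> L S \<noteq> {}) \<and>
     (\<forall>f u. 1 \<le> u \<longrightarrow> u \<le> n \<longrightarrow>
        (\<Sum>X | X \<subseteq> {..<n} \<and> card X = u. f (card (L X))) = real (n choose u) * K f u)"

lemma pull_set_nonempty:
  assumes "p permutes {..<n}" "S \<subseteq> {..<n}" "S \<noteq> {}"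
  shows "pull_set n p S \<noteq> {}" "pull_set n p S \<subseteq> {..<n}"
proof -
  have "finite S" using assms finite_subset by blast
  hence "card (pull_set n p S) \<noteq> 0" using card_pull_set[OF assms(1,2)] assms(3) by simp
  thus "pull_set n p S \<noteq> {}" by auto
qed (auto simp: pull_set_def)

lemma encode_nonempty:
  assumes "\<And>i. 1 \<le> i \<Longrightarrow> i \<le> k \<Longrightarrow> \<pi> i permutes {..<n}"
    and "\<And>i. 1 \<le> i \<Longrightarrow> i \<le> k \<Longrightarrow> weight_kernel n (L i) (K i)"
    and "S \<subseteq> {..<n}" "S \<noteq> {}"
  shows "encode n L \<pi> k S \<subseteq> {..<n} \<and> encode n L \<pi> k S \<noteq> {}"
  using assms
proof (induction k)
  case (Suc k)
  hence IH: "encode n L \<pi> k S \<subseteq> {..<n} \<and> encode n L \<pi> k S \<noteq> {}" by simp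
  have p: "\<pi> (Suc k) permutes {..<n}" and w: "weight_kernel n (L (Suc k)) (K (Suc k))" using Suc.prems by auto
  show ?case using pull_set_nonempty[OF p] IH w by (simp add: weight_kernel_def)
qed simp

lemma finite_perms: "finite {p. p permutes {..<n::nat}}" "{p. p permutes {..<n::nat}} \<noteq> {}"
  by (auto intro: finite_permutations permutes_id)

lemma set_pmf_perms: "set_pmf (pmf_of_set {p. p permutes {..<n::nat}}) = {p. p permutes {..<n}}"
  by (rule set_pmf_of_set[OF finite_perms(2) finite_perms(1)])

lemma set_random_permutations:
  "set_pmf (random_permutations n k) = {\<pi>. (\<forall>i\<in>{1..k}. \<pi> i permutes {..<n}) \<and> (\<forall>i. i \<notin> {1..k} \<longrightarrow> \<pi> i = id)}"
  unfolding random_permutations_def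
  by (subst set_Pi_pmf) (auto simp: PiE_dflt_def set_pmf_perms)

lemma finite_set_random_permutations: "finite (set_pmf (random_permutations n k))"
  unfolding random_permutations_def
  by (subst set_Pi_pmf) (auto intro!: finite_PiE_dflt simp: set_pmf_perms finite_perms)

text \<open>By independence the last permutation can be averaged with the earlier ones held
  fixed.\<close>

lemma expectation_random_permutations_Suc:
  fixes h :: "(nat \<Rightarrow> nat \<Rightarrow> nat) \<Rightarrow> real"
  shows "measure_pmf.expectation (random_permutations n (Suc k)) h =
    measure_pmf.expectation (random_permutations n k)
      (\<lambda>\<pi>. (\<Sum>p | p permutes {..<n}. h (\<pi>(Suc k := p))) / fact n)"
proof -
  let ?U = "pmf_of_set {p. p permutes {..<n}}"
  have ins: "{1..Suc k} = insert (Suc k) {1..k}" by auto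
  have "random_permutations n (Suc k) =
      random_permutations n k \<bind> (\<lambda>\<pi>. map_pmf (\<lambda>p. \<pi>(Suc k := p)) ?U)"
    unfolding random_permutations_def ins
    by (subst Pi_pmf_insert') (auto simp: map_pmf_def intro: bind_commute_pmf)
  hence "measure_pmf.expectation (random_permutations n (Suc k)) h =
     (\<Sum>\<pi>\<in>set_pmf (random_permutations n k). pmf (random_permutations n k) \<pi> *\<^sub>R
        measure_pmf.expectation (map_pmf (\<lambda>p. \<pi>(Suc k := p)) ?U) h)"
    by (simp only:) (subst pmf_expectation_bind, auto simp: finite_set_random_permutations set_pmf_perms finite_perms)
  also have "\<dots> = (\<Sum>\<pi>\<in>set_pmf (random_permutations n k). pmf (random_permutations n k) \<pi> *\<^sub>R
       ((\<Sum>p | p permutes {..<n}. h (\<pi>(Suc k := p))) / fact n))"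
    using integral_pmf_of_set[OF finite_perms(2,1), of n] card_permutations[OF refl, of "{..<n}"]
    by (intro sum.cong refl) simp
  also have "\<dots> = measure_pmf.expectation (random_permutations n k)
      (\<lambda>\<pi>. (\<Sum>p | p permutes {..<n}. h (\<pi>(Suc k := p))) / fact n)"
    by (subst integral_measure_pmf[OF finite_set_random_permutations]) auto
  finally show ?thesis .
qed

text \<open>With the first \<open>k\<close> permutations fixed, the pulled back support is uniform
  among the sets of its size. Averaging over the last permutation therefore replaces
  \<open>f\<close> by its image under the operator of the last layer.\<close>

lemma expectation_encode_Suc:
  assumes "\<And>i. 1 \<le> i \<Longrightarrow> i \<le> Suc k \<Longrightarrow> weight_kernel n (L i) (K i)" and S: "S \<subseteq> {..<n}" "S \<noteq> {}"
  shows "measure_pmf.expectation (random_permutations n (Suc k)) (\<lambda>\<pi>. f (card (encode n L \<pi> (Suc k) S))) =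
         measure_pmf.expectation (random_permutations n k) (\<lambda>\<pi>. K (Suc k) f (card (encode n L \<pi> k S)))"
  unfolding expectation_random_permutations_Suc
proof (intro integral_cong_AE AE_pmfI)
  fix \<pi> assume pi: "\<pi> \<in> set_pmf (random_permutations n k)"
  let ?E = "encode n L \<pi> k S"
  have E: "?E \<subseteq> {..<n}" "?E \<noteq> {}"
    using encode_nonempty[of k \<pi> n L K S] assms pi by (auto simp: set_random_permutations)
  have "finite ?E" using E finite_subset by blast
  hence c: "1 \<le> card ?E" "card ?E \<le> n" using E card_mono[OF _ E(1)] by (auto simp: Suc_le_eq card_gt_0_iff)
  have "(\<Sum>p | p permutes {..<n}. f (card (encode n L (\<pi>(Suc k := p)) (Suc k) S))) / fact n
      = (\<Sum>p | p permutes {..<n}. f (card (L (Suc k) (pull_set n p ?E)))) / fact n"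
    by (simp add: encode_cong[of k "\<pi>(Suc k := _)" \<pi>])
  also have "\<dots> = (\<Sum>X | X \<subseteq> {..<n} \<and> card X = card ?E. f (card (L (Suc k) X))) / real (n choose card ?E)"
    by (rule average_pull_set[OF E(1)])
  also have "\<dots> = K (Suc k) f (card ?E)"
    using assms(1)[of "Suc k"] c by (simp add: weight_kernel_def)
  finally show "(\<Sum>p | p permutes {..<n}. f (card (encode n L (\<pi>(Suc k := p)) (Suc k) S))) / fact n
     = K (Suc k) f (card ?E)" .
qed auto

text \<open>Layers are peeled off from the last one inwards and applied to \<open>f\<close>, so the
  operator of layer 1 ends up outermost.\<close>

lemma expectation_encode_alternating:
  fixes f :: "nat \<Rightarrow> real"
  assumes L: "\<And>i. weight_kernel n (L i) (if odd i then K1 else K2)" and S: "S \<subseteq> {..<n}" "S \<noteq> {}"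
  shows "measure_pmf.expectation (random_permutations n (2 * m)) (\<lambda>\<pi>. f (card (encode n L \<pi> (2 * m) S))) =
         ((K1 \<circ> K2) ^^ m) f (card S)"
proof (induction m arbitrary: f)
  case 0
  show ?case by simp
next
  case (Suc m)
  have "measure_pmf.expectation (random_permutations n (2 * Suc m)) (\<lambda>\<pi>. f (card (encode n L \<pi> (2 * Suc m) S)))
     = measure_pmf.expectation (random_permutations n (Suc (2 * m))) (\<lambda>\<pi>. K2 f (card (encode n L \<pi> (Suc (2 * m)) S)))"
    using expectation_encode_Suc[of "Suc (2*m)" n L "\<lambda>i. if odd i then K1 else K2" S f] L S
    by (simp del: encode.simps)
  also have "\<dots> = measure_pmf.expectation (random_permutations n (2 * m)) (\<lambda>\<pi>. K1 (K2 f) (card (encode n L \<pi> (2 * m) S)))"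
    using expectation_encode_Suc[of "2*m" n L "\<lambda>i. if odd i then K1 else K2" S "K2 f"] L S
    by (simp del: encode.simps)
  also have "\<dots> = ((K1 \<circ> K2) ^^ m) (K1 (K2 f)) (card S)" by (rule Suc.IH)
  also have "((K1 \<circ> K2) ^^ m) (K1 (K2 f)) = ((K1 \<circ> K2) ^^ Suc m) f"
    unfolding funpow_Suc_right by (subst o_apply, subst o_apply) (rule refl)
  finally show ?case .
qed

section \<open>Repetition and the union bound over messages\<close>

definition repeat_set :: "nat set \<Rightarrow> nat set" where
  "repeat_set X = {i. i div 2 \<in> X}"

lemma repeat_set_props:
  assumes "X \<subseteq> {..<n div 2}" "even n"
  shows "repeat_set X \<subseteq> {..<n}" "card (repeat_set X) = 2 * card X" "X \<noteq> {} \<Longrightarrow> repeat_set X \<noteq> {}"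
proof -
  have fin: "finite X" using assms finite_subset by blast
  show "repeat_set X \<subseteq> {..<n}" using assms by (auto simp: repeat_set_def elim!: evenE)
  have "i \<in> repeat_set X \<longleftrightarrow> i \<in> (\<lambda>j. 2 * j) ` X \<union> (\<lambda>j. 2 * j + 1) ` X" for i
  proof
    assume "i \<in> repeat_set X"
    moreover have "i = 2 * (i div 2) \<or> i = 2 * (i div 2) + 1" by presburger
    ultimately show "i \<in> (\<lambda>j. 2 * j) ` X \<union> (\<lambda>j. 2 * j + 1) ` X" by (auto simp: repeat_set_def)
  qed (auto simp: repeat_set_def)
  hence e: "repeat_set X = (\<lambda>j. 2 * j) ` X \<union> (\<lambda>j. 2 * j + 1) ` X" by blast
  have "card ((\<lambda>j. 2 * j) ` X \<union> (\<lambda>j. 2 * j + 1) ` X) = card ((\<lambda>j. 2 * j) ` X) + card ((\<lambda>j. 2 * j + 1) ` X)"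
    using fin by (intro card_Un_disjoint) (auto, presburger)
  also have "\<dots> = card X + card X" by (subst (1 2) card_image) (auto simp: inj_on_def)
  finally show "card (repeat_set X) = 2 * card X" unfolding e by simp
  show "X \<noteq> {} \<Longrightarrow> repeat_set X \<noteq> {}" unfolding e by auto
qed

text \<open>In the union bound a message enters only through its weight \<open>j\<close>: the
  expectation depends on the support of its repetition only through the size
  \<open>2 * j\<close>.\<close>

lemma prob_low_weight:
  assumes L: "\<And>i. weight_kernel n (L i) (if odd i then K1 else K2)" and n: "even n"
  shows "measure_pmf.prob (random_permutations n (2 * m))
     {\<pi>. \<exists>X. X \<subseteq> {..<n div 2} \<and> X \<noteq> {} \<and> real (card (encode n L \<pi> (2 * m) (repeat_set X))) < b}
   \<le> (\<Sum>j=1..n div 2. real ((n div 2) choose j) * ((K1 \<circ> K2) ^^ m) (\<lambda>w. of_bool (real w < b)) (2 * j))"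
proof -
  let ?P = "random_permutations n (2 * m)" and ?F = "{X. X \<subseteq> {..<n div 2} \<and> X \<noteq> {}}"
  let ?ev = "\<lambda>X. {\<pi>. real (card (encode n L \<pi> (2 * m) (repeat_set X))) < b}"
  let ?E = "\<lambda>w. ((K1 \<circ> K2) ^^ m) (\<lambda>w. of_bool (real w < b)) w"
  have finF: "finite ?F" by (rule finite_subset[of _ "Pow {..<n div 2}"]) auto
  have "{\<pi>. \<exists>X. X \<subseteq> {..<n div 2} \<and> X \<noteq> {} \<and> real (card (encode n L \<pi> (2 * m) (repeat_set X))) < b} = (\<Union>X\<in>?F. ?ev X)"
    by auto
  hence "measure_pmf.prob ?P
     {\<pi>. \<exists>X. X \<subseteq> {..<n div 2} \<and> X \<noteq> {} \<and> real (card (encode n L \<pi> (2 * m) (repeat_set X))) < b}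
    \<le> (\<Sum>X\<in>?F. measure_pmf.prob ?P (?ev X))"
    using measure_pmf.finite_measure_subadditive_finite[OF finF, of ?ev ?P] by simp
  also have "\<dots> = (\<Sum>X\<in>?F. ?E (2 * card X))"
  proof (intro sum.cong refl)
    fix X assume X: "X \<in> ?F"
    have "measure_pmf.prob ?P (?ev X) = measure_pmf.expectation ?P (indicator (?ev X))" by simp
    also have "\<dots> = measure_pmf.expectation ?P (\<lambda>\<pi>. of_bool (real (card (encode n L \<pi> (2 * m) (repeat_set X))) < b))"
      by (intro Bochner_Integration.integral_cong) (auto simp: indicator_def)
    also have "\<dots> = ?E (card (repeat_set X))"
      using X n repeat_set_props[of X n] by (intro expectation_encode_alternating L) auto
    finally show "measure_pmf.prob ?P (?ev X) = ?E (2 * card X)" using X n repeat_set_props(2)[of X n] by simp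
  qed
  also have "\<dots> = (\<Sum>j=1..n div 2. \<Sum>X | X \<in> ?F \<and> card X = j. ?E (2 * card X))"
  proof (rule sum.group[symmetric])
    have "card X \<in> {1..n div 2}" if "X \<in> ?F" for X
      using that card_mono[of "{..<n div 2}" X] finite_subset[of X "{..<n div 2}"]
      by (auto simp: Suc_le_eq card_gt_0_iff)
    thus "card ` ?F \<subseteq> {1..n div 2}" by blast
  qed (use finF in auto)
  also have "\<dots> = (\<Sum>j=1..n div 2. real ((n div 2) choose j) * ?E (2 * j))"
  proof (intro sum.cong refl)
    fix j assume "j \<in> {1..n div 2}"
    hence "{X. X \<in> ?F \<and> card X = j} = {X. X \<subseteq> {..<n div 2} \<and> card X = j}" by auto
    hence "card {X. X \<in> ?F \<and> card X = j} = (n div 2) choose j" by (simp only: n_subsets finite_lessThan card_lessThan)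
    thus "(\<Sum>X | X \<in> ?F \<and> card X = j. ?E (2 * card X)) = real ((n div 2) choose j) * ?E (2 * j)" by simp
  qed
  finally show ?thesis .
qed

subsection \<open>Supports of codewords\<close>

definition supp :: "bit vec \<Rightarrow> nat set" where
  "supp v = {i. i < dim_vec v \<and> v $ i \<noteq> 0}"

lemma of_nat_bit: "(of_nat k :: bit) = of_bool (odd k)"
  by (induction k) auto

lemma sum_of_bool_bit: "finite J \<Longrightarrow> (\<Sum>j\<in>J. of_bool (P j) :: bit) = of_bool (odd (card {j \<in> J. P j}))"
  by (simp add: sum_of_bool_eq of_nat_bit Int_def)

lemma supp_mult_mat_vec:
  assumes "x \<in> carrier_vec k"
  shows "supp (mat n k (\<lambda>(i, j). of_bool (R i j)) *\<^sub>v x) = {i. i < n \<and> odd (card {j \<in> supp x. R i j})}"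
proof -
  have "(mat n k (\<lambda>(i, j). of_bool (R i j)) *\<^sub>v x) $ i = of_bool (odd (card {j \<in> supp x. R i j}))" if i: "i < n" for i
  proof -
    have "(mat n k (\<lambda>(i, j). of_bool (R i j)) *\<^sub>v x) $ i = (\<Sum>j\<in>{0..<k}. of_bool (R i j) * x $ j)"
      using assms i by (simp add: scalar_prod_def)
    also have "\<dots> = (\<Sum>j\<in>{0..<k}. of_bool (R i j \<and> j \<in> supp x))"
      using assms by (intro sum.cong) (auto simp: supp_def)
    also have "\<dots> = of_bool (odd (card {j \<in> {0..<k}. R i j \<and> j \<in> supp x}))"
      by (rule sum_of_bool_bit) simp
    also have "{j \<in> {0..<k}. R i j \<and> j \<in> supp x} = {j \<in> supp x. R i j}"
      using assms by (auto simp: supp_def)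
    finally show ?thesis .
  qed
  thus ?thesis by (auto simp: supp_def)
qed

definition accumT_set :: "nat \<Rightarrow> nat set \<Rightarrow> nat set" where
  "accumT_set n S = {i. i < n \<and> odd (card {j \<in> S. i \<le> j})}"

definition derivT_set :: "nat \<Rightarrow> nat set \<Rightarrow> nat set" where
  "derivT_set n S = {i. i < n \<and> (i \<in> S) \<noteq> (Suc i \<in> S)}"

lemma supp_subset: "x \<in> carrier_vec n \<Longrightarrow> supp x \<subseteq> {..<n}"
  by (auto simp: supp_def)

lemma supp_accumulator: "x \<in> carrier_vec n \<Longrightarrow> supp (accumulator_mat n *\<^sub>v x) = accum_set n (supp x)"
  unfolding accumulator_mat_def by (subst supp_mult_mat_vec) (auto simp: accum_set_def)

lemma odd_card_at_most_two:
  fixes a b :: nat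
  assumes "a \<noteq> b"
  shows "odd (card {j \<in> S. j = a \<or> j = b}) \<longleftrightarrow> (a \<in> S) \<noteq> (b \<in> S)"
proof -
  have "{j \<in> S. j = a \<or> j = b} = (if a \<in> S then {a} else {}) \<union> (if b \<in> S then {b} else {})" by auto
  thus ?thesis using assms by auto
qed

lemma odd_card_at_most_one: "odd (card {j. j = a \<and> j \<in> S}) \<longleftrightarrow> a \<in> S"
proof -
  have "{j. j = a \<and> j \<in> S} = (if a \<in> S then {a} else {})" by auto
  thus ?thesis by auto
qed

lemma supp_derivative: "x \<in> carrier_vec n \<Longrightarrow> supp (derivative_mat n *\<^sub>v x) = deriv_set n (supp x)"
proof -
  assume x: "x \<in> carrier_vec n"
  have "odd (card {j \<in> supp x. j = i \<or> j + 1 = i}) \<longleftrightarrow> (i \<in> supp x) \<noteq> (0 < i \<and> i - 1 \<in> supp x)" for i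
  proof (cases i)
    case 0
    thus ?thesis by (simp add: odd_card_at_most_one)
  next
    case (Suc k)
    thus ?thesis using odd_card_at_most_two[of i k "supp x"] by simp
  qed
  thus ?thesis unfolding derivative_mat_def using x by (subst supp_mult_mat_vec) (auto simp: deriv_set_def)
qed

lemma supp_perm: "x \<in> carrier_vec n \<Longrightarrow> supp (perm_mat n p *\<^sub>v x) = pull_set n p (supp x)"
  unfolding perm_mat_def
  by (subst supp_mult_mat_vec) (auto simp: pull_set_def eq_commute[of "p _"] odd_card_at_most_one)

lemma supp_repetition:
  assumes "x \<in> carrier_vec (n div 2)" "even n"
  shows "supp (repetition_mat n *\<^sub>v x) = repeat_set (supp x)"
proof -
  have "supp (repetition_mat n *\<^sub>v x) = {i. i < n \<and> i div 2 \<in> supp x}"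
    unfolding repetition_mat_def using assms
    by (subst supp_mult_mat_vec) (auto simp: eq_commute[of "_ div 2"] odd_card_at_most_one)
  also have "\<dots> = repeat_set (supp x)"
    using repeat_set_props(1)[OF supp_subset[OF assms(1)] assms(2)] by (auto simp: repeat_set_def)
  finally show ?thesis .
qed

lemma transpose_accumulator: "transpose_mat (accumulator_mat n) = mat n n (\<lambda>(i, j). of_bool (i \<le> j))"
  by (rule eq_matI) (auto simp: accumulator_mat_def)

lemma transpose_derivative: "transpose_mat (derivative_mat n) = mat n n (\<lambda>(i, j). of_bool (j = i \<or> j = Suc i))"
  by (rule eq_matI) (auto simp: derivative_mat_def)

lemma supp_accumulatorT: "x \<in> carrier_vec n \<Longrightarrow> supp (transpose_mat (accumulator_mat n) *\<^sub>v x) = accumT_set n (supp x)"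
  unfolding transpose_accumulator by (subst supp_mult_mat_vec) (auto simp: accumT_set_def)

lemma supp_derivativeT: "x \<in> carrier_vec n \<Longrightarrow> supp (transpose_mat (derivative_mat n) *\<^sub>v x) = derivT_set n (supp x)"
  unfolding transpose_derivative
  by (subst supp_mult_mat_vec) (auto simp: derivT_set_def odd_card_at_most_two)

lemma mats_carrier:
  "accumulator_mat n \<in> carrier_mat n n" "derivative_mat n \<in> carrier_mat n n" "perm_mat n p \<in> carrier_mat n n"
  "repetition_mat n \<in> carrier_mat n (n div 2)"
  by (auto simp: accumulator_mat_def derivative_mat_def perm_mat_def repetition_mat_def)

lemma RDA_carrier: "RDA_mat n \<pi> m \<in> carrier_mat n (n div 2)"
  by (induction m) (auto intro!: mult_carrier_mat[of _ n n] simp: mats_carrier)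

lemma RAD_carrier: "RAD_mat n \<pi> m \<in> carrier_mat n (n div 2)"
  by (induction m) (auto intro!: mult_carrier_mat[of _ n n] simp: mats_carrier)

lemma mult_five_mat_vec:
  assumes "M2 \<in> carrier_mat n n" "M1 \<in> carrier_mat n n" "G \<in> carrier_mat n (n div 2)" and x: "x \<in> carrier_vec (n div 2)"
  shows "(M2 * (perm_mat n q * (M1 * (perm_mat n p * G)))) *\<^sub>v x =
    M2 *\<^sub>v (perm_mat n q *\<^sub>v (M1 *\<^sub>v (perm_mat n p *\<^sub>v (G *\<^sub>v x))))"
proof -
  have assoc: "(M * N) *\<^sub>v x = M *\<^sub>v (N *\<^sub>v x)" if "M \<in> carrier_mat n n" "N \<in> carrier_mat n (n div 2)" for M N :: "bit mat"
    using assoc_mult_mat_vec[OF that x] .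
  show ?thesis using assms mats_carrier[of n] by (simp add: assoc mult_carrier_mat[of _ n n])
qed

lemma RDA_mult_vec:
  assumes "x \<in> carrier_vec (n div 2)"
  shows "RDA_mat n \<pi> (Suc m) *\<^sub>v x = accumulator_mat n *\<^sub>v (perm_mat n (\<pi> (2 * m + 2)) *\<^sub>v
           (derivative_mat n *\<^sub>v (perm_mat n (\<pi> (2 * m + 1)) *\<^sub>v (RDA_mat n \<pi> m *\<^sub>v x))))"
  unfolding RDA_mat.simps by (intro mult_five_mat_vec mats_carrier RDA_carrier assms)

lemma RAD_mult_vec:
  assumes "x \<in> carrier_vec (n div 2)"
  shows "RAD_mat n \<pi> (Suc m) *\<^sub>v x = transpose_mat (derivative_mat n) *\<^sub>v (perm_mat n (\<pi> (2 * m + 2)) *\<^sub>v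
           (transpose_mat (accumulator_mat n) *\<^sub>v (perm_mat n (\<pi> (2 * m + 1)) *\<^sub>v (RAD_mat n \<pi> m *\<^sub>v x))))"
  unfolding RAD_mat.simps
  by (intro mult_five_mat_vec RAD_carrier assms transpose_carrier_mat[THEN iffD2] mats_carrier)

abbreviation DA_steps :: "nat \<Rightarrow> nat \<Rightarrow> nat set \<Rightarrow> nat set" where
  "DA_steps n i \<equiv> (if odd i then deriv_set n else accum_set n)"

abbreviation AD_steps :: "nat \<Rightarrow> nat \<Rightarrow> nat set \<Rightarrow> nat set" where
  "AD_steps n i \<equiv> (if odd i then accumT_set n else derivT_set n)"

lemma supp_RDA:
  assumes x: "x \<in> carrier_vec (n div 2)" and n: "even n"
  shows "supp (RDA_mat n \<pi> m *\<^sub>v x) = encode n (DA_steps n) \<pi> (2 * m) (repeat_set (supp x))"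
proof (induction m)
  case 0
  show ?case using supp_repetition[OF x n] by simp
next
  case (Suc m)
  have c: "M *\<^sub>v v \<in> carrier_vec n" if "M \<in> carrier_mat n n" "v \<in> carrier_vec n" for M :: "bit mat" and v
    using that by (rule mult_mat_vec_carrier)
  have v: "RDA_mat n \<pi> m *\<^sub>v x \<in> carrier_vec n" using mult_mat_vec_carrier[OF RDA_carrier x] .
  show ?case unfolding RDA_mult_vec[OF x] using v mats_carrier[of n]
    by (simp add: supp_accumulator supp_perm supp_derivative c Suc.IH)
qed

lemma supp_RAD:
  assumes x: "x \<in> carrier_vec (n div 2)" and n: "even n"
  shows "supp (RAD_mat n \<pi> m *\<^sub>v x) = encode n (AD_steps n) \<pi> (2 * m) (repeat_set (supp x))"
proof (induction m)
  case 0
  show ?case using supp_repetition[OF x n] by simp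
next
  case (Suc m)
  have c: "M *\<^sub>v v \<in> carrier_vec n" if "M \<in> carrier_mat n n" "v \<in> carrier_vec n" for M :: "bit mat" and v
    using that by (rule mult_mat_vec_carrier)
  have v: "RAD_mat n \<pi> m *\<^sub>v x \<in> carrier_vec n" using mult_mat_vec_carrier[OF RAD_carrier x] .
  show ?case unfolding RAD_mult_vec[OF x] using v mats_carrier[of n]
    by (simp add: supp_accumulatorT supp_perm supp_derivativeT c Suc.IH)
qed

section \<open>Weight operators of the four layers\<close>

lemma card_le_of_subset: "X \<subseteq> {..<n} \<Longrightarrow> card X \<le> n"
  using card_mono[of "{..<n}" X] by simp

lemma sum_by_card:
  fixes f :: "nat \<Rightarrow> real"
  assumes L: "\<And>S. S \<subseteq> {..<n} \<Longrightarrow> S \<noteq> {} \<Longrightarrow> L S \<subseteq> {..<n} \<and> L S \<noteq> {}" and u: "1 \<le> u"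
  shows "(\<Sum>X | X \<subseteq> {..<n} \<and> card X = u. f (card (L X))) =
         (\<Sum>w=1..n. real (card {X. X \<subseteq> {..<n} \<and> card X = u \<and> card (L X) = w}) * f w)"
proof -
  let ?F = "{X. X \<subseteq> {..<n} \<and> card X = u}"
  have finF: "finite ?F" by (rule finite_subset[of _ "Pow {..<n}"]) auto
  have "card (L X) \<in> {1..n}" if "X \<in> ?F" for X
  proof -
    have "X \<noteq> {}" using that u by auto
    hence LX: "L X \<subseteq> {..<n}" "L X \<noteq> {}" using L that by auto
    moreover have "finite (L X)" using LX finite_subset by blast
    ultimately show ?thesis using card_le_of_subset[of "L X" n] by (auto simp: Suc_le_eq card_gt_0_iff)
  qed
  hence "(\<Sum>X\<in>?F. f (card (L X))) = (\<Sum>w\<in>{1..n}. \<Sum>X\<in>{X \<in> ?F. card (L X) = w}. f (card (L X)))"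
    by (intro sum.group[symmetric] finF) auto
  also have "\<dots> = (\<Sum>w=1..n. real (card {X. X \<subseteq> {..<n} \<and> card X = u \<and> card (L X) = w}) * f w)"
    by (intro sum.cong refl) (simp add: conj_assoc)
  finally show ?thesis .
qed

lemma weight_kernel_accum: "weight_kernel n (accum_set n) (opA n)"
proof -
  have L: "accum_set n S \<subseteq> {..<n} \<and> accum_set n S \<noteq> {}" if "S \<subseteq> {..<n}" "S \<noteq> {}" for S
  proof
    show "accum_set n S \<noteq> {}"
    proof
      assume "accum_set n S = {}"
      hence "S = deriv_set n {}" using deriv_accum_set[OF that(1)] by simp
      thus False using that by (simp add: deriv_set_def)
    qed
  qed (rule accum_set_subset)
  have "(\<Sum>X | X \<subseteq> {..<n} \<and> card X = u. f (card (accum_set n X))) = real (n choose u) * opA n f u"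
    if "1 \<le> u" "u \<le> n" for f u
    using sum_by_card[of n "accum_set n" u f] L that by (simp add: trans_count_accum opA_def)
  thus ?thesis unfolding weight_kernel_def using L by blast
qed

lemma weight_kernel_deriv: "weight_kernel n (deriv_set n) (opD n)"
proof -
  have L: "deriv_set n S \<subseteq> {..<n} \<and> deriv_set n S \<noteq> {}" if "S \<subseteq> {..<n}" "S \<noteq> {}" for S
  proof
    show "deriv_set n S \<noteq> {}"
    proof
      assume "deriv_set n S = {}"
      hence "S = accum_set n {}" using accum_deriv_set[OF that(1)] by simp
      thus False using that by (simp add: accum_set_def)
    qed
  qed (rule deriv_set_subset)
  have "(\<Sum>X | X \<subseteq> {..<n} \<and> card X = w. f (card (deriv_set n X))) = real (n choose w) * opD n f w"
    if "1 \<le> w" "w \<le> n" for f w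
    using sum_by_card[of n "deriv_set n" w f] L that by (simp add: trans_count_def opD_def)
  thus ?thesis unfolding weight_kernel_def using L by blast
qed

text \<open>Reversal of the coordinates. The accumulator and derivative matrices are constant along
  diagonals, so conjugation by the reversal transposes them; and it preserves weights.\<close>

definition reflect :: "nat \<Rightarrow> nat \<Rightarrow> nat" where
  "reflect n i = n - 1 - i"

lemma reflect_less: "i < n \<Longrightarrow> reflect n i < n"
  by (simp add: reflect_def)

lemma reflect_reflect: "i < n \<Longrightarrow> reflect n (reflect n i) = i"
  by (simp add: reflect_def)

lemma inj_on_reflect: "X \<subseteq> {..<n} \<Longrightarrow> inj_on (reflect n) X"
  by (rule inj_on_inverseI[of _ "reflect n"]) (auto simp: reflect_reflect)

lemma reflect_image_subset: "X \<subseteq> {..<n} \<Longrightarrow> reflect n ` X \<subseteq> {..<n}"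
  by (auto simp: reflect_less)

lemma reflect_image_image: "X \<subseteq> {..<n} \<Longrightarrow> reflect n ` reflect n ` X = X"
  by (force simp: image_iff reflect_reflect)

lemma in_reflect_image: "X \<subseteq> {..<n} \<Longrightarrow> i < n \<Longrightarrow> i \<in> reflect n ` X \<longleftrightarrow> reflect n i \<in> X"
proof -
  assume X: "X \<subseteq> {..<n}" and i: "i < n"
  have "reflect n i \<in> X" if "x \<in> X" "i = reflect n x" for x
    using X that by (auto simp: reflect_reflect)
  moreover have "i \<in> reflect n ` X" if "reflect n i \<in> X"
    using that i by (intro image_eqI[of _ _ "reflect n i"]) (simp_all add: reflect_reflect)
  ultimately show ?thesis by blast
qed

text \<open>Reversal permutes the sets of a given size, and sizes are all that the operator sees.
  This transfers the operators to the transposed layers.\<close>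

lemma weight_kernel_reflect:
  assumes W: "weight_kernel n L K" and L': "\<And>S. S \<subseteq> {..<n} \<Longrightarrow> L' S = reflect n ` L (reflect n ` S)"
  shows "weight_kernel n L' K"
proof -
  have L: "L S \<subseteq> {..<n} \<and> L S \<noteq> {}" if "S \<subseteq> {..<n}" "S \<noteq> {}" for S
    using W that by (simp add: weight_kernel_def)
  have "(\<Sum>X | X \<subseteq> {..<n} \<and> card X = u. f (card (L' X))) = (\<Sum>X | X \<subseteq> {..<n} \<and> card X = u. f (card (L X)))"
    if u: "1 \<le> u" for u and f :: "nat \<Rightarrow> real"
  proof (rule sum.reindex_bij_witness[of _ "image (reflect n)" "image (reflect n)"])
    fix X assume X: "X \<in> {X. X \<subseteq> {..<n} \<and> card X = u}"
    hence ne: "reflect n ` X \<noteq> {}" using u by auto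
    show "f (card (L (reflect n ` X))) = f (card (L' X))"
      using L[OF reflect_image_subset[of X n] ne] X by (simp add: L' card_image inj_on_reflect)
  qed (auto simp: reflect_image_image reflect_less card_image inj_on_reflect)
  moreover have "L' S \<subseteq> {..<n} \<and> L' S \<noteq> {}" if "S \<subseteq> {..<n}" "S \<noteq> {}" for S
    using L[OF reflect_image_subset[OF that(1)]] that reflect_image_subset[of "L (reflect n ` S)" n] by (simp add: L')
  ultimately show ?thesis using W by (simp add: weight_kernel_def)
qed

lemma weight_kernel_accumT: "weight_kernel n (accumT_set n) (opA n)"
proof (rule weight_kernel_reflect[OF weight_kernel_accum])
  fix S assume S: "S \<subseteq> {..<n}"
  have "card {j \<in> reflect n ` S. j \<le> reflect n i} = card {j \<in> S. i \<le> j}" if "i < n" for i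
  proof -
    have "{j \<in> reflect n ` S. j \<le> reflect n i} = reflect n ` {j \<in> S. i \<le> j}"
      using S that by (force simp: reflect_def)
    thus ?thesis using S by (simp add: card_image inj_on_reflect[THEN inj_on_subset[of _ _ "{j \<in> S. i \<le> j}"]])
  qed
  hence "i \<in> accumT_set n S \<longleftrightarrow> i < n \<and> reflect n i \<in> accum_set n (reflect n ` S)" for i
    by (auto simp: accumT_set_def accum_set_def reflect_less)
  also have "\<dots> i \<longleftrightarrow> i \<in> reflect n ` accum_set n (reflect n ` S)" for i
    using in_reflect_image[OF accum_set_subset, of i n] reflect_image_subset[OF accum_set_subset, of n] by blast
  finally show "accumT_set n S = reflect n ` accum_set n (reflect n ` S)" by blast
qed

lemma weight_kernel_derivT: "weight_kernel n (derivT_set n) (opD n)"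
proof (rule weight_kernel_reflect[OF weight_kernel_deriv])
  fix S assume S: "S \<subseteq> {..<n}"
  have "i \<in> derivT_set n S \<longleftrightarrow> i < n \<and> reflect n i \<in> deriv_set n (reflect n ` S)" for i
  proof (cases "i < n")
    case True
    have 1: "reflect n i \<in> reflect n ` S \<longleftrightarrow> i \<in> S"
      using S True by (simp add: in_reflect_image reflect_less reflect_reflect)
    have 2: "0 < reflect n i \<and> reflect n i - 1 \<in> reflect n ` S \<longleftrightarrow> Suc i \<in> S"
    proof (cases "Suc i < n")
      case True
      hence "reflect n i - 1 = reflect n (Suc i)" "0 < reflect n i" by (auto simp: reflect_def)
      thus ?thesis using S True by (simp add: in_reflect_image reflect_less reflect_reflect)
    next
      \<comment> \<open>The boundary case \<open>Suc i = n\<close>: both sides are false, as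
        \<open>reflect n i = 0\<close> and \<open>n\<close> is outside \<open>S\<close>.\<close>
      case False
      thus ?thesis using S by (auto simp: reflect_def)
    qed
    show ?thesis unfolding derivT_set_def deriv_set_def mem_Collect_eq
      using True 1 2 reflect_less[OF True] by argo
  qed (simp add: derivT_set_def)
  also have "\<dots> i \<longleftrightarrow> i \<in> reflect n ` deriv_set n (reflect n ` S)" for i
    using in_reflect_image[OF deriv_set_subset, of i n] reflect_image_subset[OF deriv_set_subset, of n] by blast
  finally show "derivT_set n S = reflect n ` deriv_set n (reflect n ` S)" by blast
qed

section \<open>From low minimum distance to a message with a light codeword\<close>

lemma relative_weight_supp: "relative_weight v = real (card (supp v)) / real (dim_vec v)"
  by (simp add: relative_weight_def supp_def)

lemma supp_empty_iff: "v \<in> carrier_vec n \<Longrightarrow> supp v = {} \<longleftrightarrow> v = 0\<^sub>v n"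
  by (auto simp: supp_def)

text \<open>\<open>Min\<close> is attained only on a finite nonempty set. Finiteness holds because
  relative weights are multiples of \<open>1/n\<close> up to 1; a nonzero codeword exists because
  \<open>G\<close> kills no nonzero message.\<close>

lemma low_distance_imp:
  assumes G: "G \<in> carrier_mat n (n div 2)" and n: "2 \<le> n"
    and inj: "\<And>x. x \<in> carrier_vec (n div 2) \<Longrightarrow> supp x \<noteq> {} \<Longrightarrow> supp (G *\<^sub>v x) \<noteq> {}"
    and low: "relative_min_distance (linear_code G) < d"
  shows "\<exists>x. x \<in> carrier_vec (n div 2) \<and> supp x \<noteq> {} \<and> real (card (supp (G *\<^sub>v x))) < d * real n"
proof -
  let ?W = "relative_weight ` {v \<in> linear_code G. v \<noteq> 0\<^sub>v (dim_vec v)}"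
  have C: "v \<in> carrier_vec n" if "v \<in> linear_code G" for v
    using that G by (auto simp: linear_code_def)
  have "?W \<subseteq> (\<lambda>k. real k / real n) ` {..n}"
  proof
    fix y assume "y \<in> ?W"
    then obtain v where v: "v \<in> linear_code G" "y = relative_weight v" by auto
    hence "y = real (card (supp v)) / real n" using C[of v] by (simp add: relative_weight_supp)
    moreover have "card (supp v) \<le> n" using card_le_of_subset[OF supp_subset[OF C[OF v(1)]]] .
    ultimately show "y \<in> (\<lambda>k. real k / real n) ` {..n}" by auto
  qed
  hence fin: "finite ?W" using finite_subset by blast
  \<comment> \<open>The all-ones message; it is nonzero because \<open>2 \<le> n\<close>, and its
    codeword shows that the minimum is over a nonempty set.\<close>
  define e :: "bit vec" where "e = vec (n div 2) (\<lambda>_. 1)"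
  have "0 \<in> supp e" using n by (simp add: e_def supp_def)
  hence e: "e \<in> carrier_vec (n div 2)" "supp e \<noteq> {}" by (auto simp: e_def)
  have Ge: "G *\<^sub>v e \<in> linear_code G" using G e by (auto simp: linear_code_def)
  moreover have "G *\<^sub>v e \<noteq> 0\<^sub>v (dim_vec (G *\<^sub>v e))"
    using inj[OF e] supp_empty_iff[OF C[OF Ge]] carrier_vecD[OF C[OF Ge]] by metis
  ultimately have "?W \<noteq> {}" by blast
  hence "relative_min_distance (linear_code G) \<in> ?W"
    unfolding relative_min_distance_def using fin by (intro Min_in) auto
  then obtain v where v: "v \<in> linear_code G" "v \<noteq> 0\<^sub>v (dim_vec v)" "relative_weight v < d"
    using low by auto
  then obtain x where x: "x \<in> carrier_vec (n div 2)" "v = G *\<^sub>v x" using G by (auto simp: linear_code_def)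
  have "supp x \<noteq> {}"
  proof
    assume "supp x = {}"
    hence "x = 0\<^sub>v (n div 2)" using supp_empty_iff[OF x(1)] by simp
    hence "v = 0\<^sub>v n" using x(2) G by auto
    thus False using v(2) by simp
  qed
  moreover have "real (card (supp v)) < d * real n"
    using v(3) C[OF v(1)] n by (simp add: relative_weight_supp field_simps)
  ultimately show ?thesis using x by blast
qed

lemma prob_low_distance:
  assumes L: "\<And>i. weight_kernel n (L i) (if odd i then K1 else K2)" and n: "even n" "2 \<le> n"
    and G: "\<And>\<pi>. G \<pi> \<in> carrier_mat n (n div 2)"
    and supp: "\<And>\<pi> x. x \<in> carrier_vec (n div 2) \<Longrightarrow> supp (G \<pi> *\<^sub>v x) = encode n L \<pi> (2 * m) (repeat_set (supp x))"
  shows "measure_pmf.prob (random_permutations n (2 * m)) {\<pi>. \<not> d \<le> relative_min_distance (linear_code (G \<pi>))}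
   \<le> (\<Sum>j=1..n div 2. real ((n div 2) choose j) * ((K1 \<circ> K2) ^^ m) (\<lambda>w. of_bool (real w < d * real n)) (2 * j))"
proof -
  let ?P = "random_permutations n (2 * m)"
  let ?A = "{\<pi>. \<not> d \<le> relative_min_distance (linear_code (G \<pi>))}"
  let ?B = "{\<pi>. \<exists>X. X \<subseteq> {..<n div 2} \<and> X \<noteq> {} \<and> real (card (encode n L \<pi> (2 * m) (repeat_set X))) < d * real n}"
  \<comment> \<open>On the support of the distribution every \<open>\<pi> i\<close> in range is a
    permutation, so nonzero messages have nonzero codewords and the minimum is meaningful.\<close>
  have "?A \<inter> set_pmf ?P \<subseteq> ?B"
  proof
    fix \<pi> assume pi: "\<pi> \<in> ?A \<inter> set_pmf ?P"
    have "supp (G \<pi> *\<^sub>v x) \<noteq> {}" if "x \<in> carrier_vec (n div 2)" "supp x \<noteq> {}" for x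
      unfolding supp[OF that(1)]
      using encode_nonempty[where k = "2 * m" and \<pi> = \<pi> and n = n and L = L
          and K = "\<lambda>i. if odd i then K1 else K2" and S = "repeat_set (supp x)"]
        pi L repeat_set_props[OF supp_subset[OF that(1)] n(1)] that(2)
      by (auto simp: set_random_permutations)
    with pi have "\<exists>x. x \<in> carrier_vec (n div 2) \<and> supp x \<noteq> {} \<and> real (card (supp (G \<pi> *\<^sub>v x))) < d * real n"
      by (intro low_distance_imp[OF G n(2)]) auto
    then obtain x where x: "x \<in> carrier_vec (n div 2)" "supp x \<noteq> {}" "real (card (supp (G \<pi> *\<^sub>v x))) < d * real n"
      by blast
    have "real (card (encode n L \<pi> (2 * m) (repeat_set (supp x)))) < d * real n"
      using x(3) unfolding supp[OF x(1)] .
    thus "\<pi> \<in> ?B" using supp_subset[OF x(1)] x(2) by blast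
  qed
  hence "measure_pmf.prob ?P (?A \<inter> set_pmf ?P) \<le> measure_pmf.prob ?P ?B"
    by (intro measure_pmf.finite_measure_mono) auto
  also have "measure_pmf.prob ?P (?A \<inter> set_pmf ?P) = measure_pmf.prob ?P ?A"
    by (rule measure_Int_set_pmf)
  finally show ?thesis using prob_low_weight[OF L n(1)] by (rule order_trans)
qed

subsection \<open>Circuits\<close>

lemma wire_values_append:
  "wire_values (gs @ [g]) xs = wire_values gs xs @
     [gate_op g (wire_values gs xs ! gate_left g) (wire_values gs xs ! gate_right g)]"
  by (simp add: wire_values_def)

lemma wire_depths_append:
  "wire_depths (gs @ [g]) k = wire_depths gs k @
     [Suc (max (wire_depths gs k ! gate_left g) (wire_depths gs k ! gate_right g))]"
  by (simp add: wire_depths_def)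

lemma length_wire_values: "length (wire_values gs xs) = length xs + length gs"
  by (induction gs rule: rev_induct) (simp add: wire_values_def, simp add: wire_values_append)

lemma length_wire_depths: "length (wire_depths gs k) = k + length gs"
  by (induction gs rule: rev_induct) (simp add: wire_depths_def, simp add: wire_depths_append)

lemma wire_values_nth_append:
  "w < length xs + length gs \<Longrightarrow> wire_values (gs @ hs) xs ! w = wire_values gs xs ! w"
proof (induction hs rule: rev_induct)
  case (snoc h hs)
  then show ?case
    using wire_values_append[of "gs @ hs" h xs] by (simp add: nth_append length_wire_values)
qed simp

lemma wire_depths_nth_append:
  "w < k + length gs \<Longrightarrow> wire_depths (gs @ hs) k ! w = wire_depths gs k ! w"
proof (induction hs rule: rev_induct)
  case (snoc h hs)
  then show ?case
    using wire_depths_append[of "gs @ hs" h k] by (simp add: nth_append length_wire_depths)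
qed simp

definition wf_gates :: "nat \<Rightarrow> gate list \<Rightarrow> bool" where
  "wf_gates k gs \<longleftrightarrow> (\<forall>l < length gs. gate_left (gs ! l) < k + l \<and> gate_right (gs ! l) < k + l)"

definition depth_le :: "nat \<Rightarrow> gate list \<Rightarrow> nat \<Rightarrow> bool" where
  "depth_le k gs D \<longleftrightarrow> (\<forall>w < k + length gs. wire_depths gs k ! w \<le> D)"

text \<open>The wire is existentially bound, so the property survives appending gates and is blind
  to wire numbers; permuting and repeating coordinates is then free. Its depth is bounded separately
  from that of the whole gate list, as later layers may read shallow wires.\<close>

definition computes_at :: "nat \<Rightarrow> gate list \<Rightarrow> nat \<Rightarrow> (bit list \<Rightarrow> bit) \<Rightarrow> bool" where
  "computes_at k gs d f \<longleftrightarrow> (\<exists>w < k + length gs. wire_depths gs k ! w \<le> d \<and>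
     (\<forall>xs. length xs = k \<longrightarrow> wire_values gs xs ! w = f xs))"

lemma computes_at_append: "computes_at k gs d f \<Longrightarrow> computes_at k (gs @ hs) d f"
  unfolding computes_at_def
  by (elim exE conjE, rule_tac x = w in exI) (auto simp: wire_values_nth_append wire_depths_nth_append)

lemma computes_at_mono: "computes_at k gs d f \<Longrightarrow> d \<le> e \<Longrightarrow> computes_at k gs e f"
  unfolding computes_at_def by (meson le_trans)

lemma computes_at_cong:
  "(\<And>xs. length xs = k \<Longrightarrow> f xs = g xs) \<Longrightarrow> computes_at k gs d f \<longleftrightarrow> computes_at k gs d g"
  unfolding computes_at_def by auto

lemma add_gate:
  assumes wf: "wf_gates k gs" and f: "computes_at k gs d f" and g: "computes_at k gs d g"
  obtains h where "wf_gates k (gs @ [h])" "computes_at k (gs @ [h]) (Suc d) (\<lambda>xs. f xs + g xs)"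
    "\<forall>D. depth_le k gs D \<longrightarrow> depth_le k (gs @ [h]) (max D (Suc d))"
proof -
  obtain u where u: "u < k + length gs" "wire_depths gs k ! u \<le> d" "\<And>xs. length xs = k \<Longrightarrow> wire_values gs xs ! u = f xs"
    using f by (auto simp: computes_at_def)
  obtain v where v: "v < k + length gs" "wire_depths gs k ! v \<le> d" "\<And>xs. length xs = k \<Longrightarrow> wire_values gs xs ! v = g xs"
    using g by (auto simp: computes_at_def)
  let ?h = "Gate (+) u v"
  have wf': "wf_gates k (gs @ [?h])"
    using wf u(1) v(1) by (auto simp: wf_gates_def nth_append less_Suc_eq)
  have last: "wire_depths (gs @ [?h]) k ! (k + length gs) \<le> Suc d"
    using u v by (simp add: wire_depths_append nth_append length_wire_depths)
  hence "computes_at k (gs @ [?h]) (Suc d) (\<lambda>xs. f xs + g xs)"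
    unfolding computes_at_def
    by (intro exI[of _ "k + length gs"]) (auto simp: wire_values_append nth_append length_wire_values u v)
  moreover have "depth_le k (gs @ [?h]) (max D (Suc d))" if "depth_le k gs D" for D
    unfolding depth_le_def
  proof (intro allI impI)
    fix w assume w: "w < k + length (gs @ [?h])"
    show "wire_depths (gs @ [?h]) k ! w \<le> max D (Suc d)"
    proof (cases "w < k + length gs")
      case True
      thus ?thesis using that by (auto simp: wire_depths_nth_append depth_le_def le_max_iff_disj)
    next
      case False
      hence "w = k + length gs" using w by simp
      thus ?thesis using last by (simp add: le_max_iff_disj)
    qed
  qed
  ultimately show ?thesis using wf' that by blast
qed

text \<open>The new gates read wires of depth at most \<open>d\<close> only, so all of them have
  depth at most \<open>Suc d\<close> although they are appended one after the other.\<close>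

lemma add_layer:
  assumes wf: "wf_gates k gs" and dep: "depth_le k gs D"
    and fg: "\<And>i. i < N \<Longrightarrow> computes_at k gs d (f i)" "\<And>i. i < N \<Longrightarrow> computes_at k gs d (g i)"
  shows "\<exists>hs. length hs = N \<and> wf_gates k (gs @ hs) \<and> depth_le k (gs @ hs) (max D (Suc d)) \<and>
     (\<forall>i<N. computes_at k (gs @ hs) (Suc d) (\<lambda>xs. f i xs + g i xs))"
  using fg
proof (induction N)
  case 0
  show ?case using wf dep by (intro exI[of _ "[]"]) (auto simp: depth_le_def le_max_iff_disj)
next
  case (Suc N)
  then obtain hs where hs: "length hs = N" "wf_gates k (gs @ hs)" "depth_le k (gs @ hs) (max D (Suc d))"
     "\<forall>i<N. computes_at k (gs @ hs) (Suc d) (\<lambda>xs. f i xs + g i xs)" by auto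
  obtain h where h: "wf_gates k ((gs @ hs) @ [h])"
      "computes_at k ((gs @ hs) @ [h]) (Suc d) (\<lambda>xs. f N xs + g N xs)"
      "depth_le k ((gs @ hs) @ [h]) (max (max D (Suc d)) (Suc d))"
    using add_gate[OF hs(2), of d "f N" "g N"] Suc.prems hs(3) by (metis computes_at_append lessI)
  show ?case
    using hs h computes_at_append[of k "gs @ hs" "Suc d" _ "[h]"]
    by (intro exI[of _ "hs @ [h]"]) (auto simp: less_Suc_eq)
qed

lemma depth_le_mono: "depth_le k gs D \<Longrightarrow> D \<le> E \<Longrightarrow> depth_le k gs E"
  unfolding depth_le_def by (meson le_trans)

section \<open>Serial and parallel prefix sums\<close>

lemma sum_atMost_0: "(\<Sum>j\<le>0. f j) = (f (0::nat) :: 'a :: comm_monoid_add)"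
  by simp

lemma sum_pairs:
  fixes Y :: "nat \<Rightarrow> 'a :: comm_monoid_add"
  shows "(\<Sum>j\<le>2 * i + 1. Y j) = (\<Sum>j\<le>i. Y (2 * j) + Y (2 * j + 1))"
  by (induction i) (auto simp: add_ac)

text \<open>The first prefix sum is an existing wire and each further one adds one term to its
  predecessor, hence \<open>n - 1\<close> gates.\<close>

lemma prefix_sums_serial:
  assumes wf: "wf_gates k gs" and dep: "depth_le k gs D"
    and Y: "\<And>i. i < n \<Longrightarrow> computes_at k gs D (Y i)"
  shows "\<exists>hs. length hs = n - 1 \<and> wf_gates k (gs @ hs) \<and> depth_le k (gs @ hs) (D + n) \<and>
     (\<forall>i<n. computes_at k (gs @ hs) (D + n) (\<lambda>xs. \<Sum>j\<le>i. Y j xs))"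
  using Y
proof (induction n)
  case 0
  show ?case using wf dep by (intro exI[of _ "[]"]) auto
next
  case (Suc n)
  then obtain hs where hs: "length hs = n - 1" "wf_gates k (gs @ hs)" "depth_le k (gs @ hs) (D + n)"
    "\<forall>i<n. computes_at k (gs @ hs) (D + n) (\<lambda>xs. \<Sum>j\<le>i. Y j xs)" by auto
  show ?case
  proof (cases n)
    case 0
    have "computes_at k gs (D + Suc n) (\<lambda>xs. \<Sum>j\<le>0. Y j xs)"
      unfolding sum_atMost_0 using Suc.prems[of 0] by (rule computes_at_mono) simp_all
    moreover have "depth_le k gs (D + Suc n)" by (rule depth_le_mono[OF dep]) simp
    ultimately show ?thesis using wf 0 by (intro exI[of _ "[]"]) simp
  next
    case (Suc n')
    have f: "computes_at k (gs @ hs) (D + n) (\<lambda>xs. \<Sum>j\<le>n'. Y j xs)" using hs(4) Suc by simp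
    have g: "computes_at k (gs @ hs) (D + n) (Y n)"
      by (rule computes_at_mono[OF computes_at_append[OF Suc.prems]]) simp_all
    from add_gate[OF hs(2) f g] obtain h where h: "wf_gates k ((gs @ hs) @ [h])"
      "computes_at k ((gs @ hs) @ [h]) (Suc (D + n)) (\<lambda>xs. (\<Sum>j\<le>n'. Y j xs) + Y n xs)"
      "\<forall>E. depth_le k (gs @ hs) E \<longrightarrow> depth_le k ((gs @ hs) @ [h]) (max E (Suc (D + n)))" .
    have dep': "depth_le k ((gs @ hs) @ [h]) (D + Suc n)" using h(3)[rule_format, OF hs(3)] by (rule depth_le_mono) simp
    have last: "(\<lambda>xs. \<Sum>j\<le>n. Y j xs) = (\<lambda>xs. (\<Sum>j\<le>n'. Y j xs) + Y n xs)"
      unfolding Suc by (rule ext) (simp only: sum.atMost_Suc)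
    have all: "computes_at k ((gs @ hs) @ [h]) (D + Suc n) (\<lambda>xs. \<Sum>j\<le>i. Y j xs)" if "i < Suc n" for i
    proof (cases "i = n")
      case True
      show ?thesis unfolding True last add_Suc_right by (rule h(2))
    next
      case False
      hence "i < n" using that by simp
      hence "computes_at k (gs @ hs) (D + n) (\<lambda>xs. \<Sum>j\<le>i. Y j xs)" by (rule hs(4)[rule_format])
      thus ?thesis by (rule computes_at_mono[OF computes_at_append]) simp
    qed
    have "length (hs @ [h]) = Suc n - 1" using hs(1) Suc by simp
    thus ?thesis using h(1) dep' all unfolding append_assoc by (intro exI[of _ "hs @ [h]"] conjI allI impI)
  qed
qed

lemma neighbour_sums:
  assumes wf: "wf_gates k gs" and dep: "depth_le k gs D" and Y: "\<And>i. i < n \<Longrightarrow> computes_at k gs d (Y i)"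
  shows "\<exists>hs. length hs = n - 1 \<and> wf_gates k (gs @ hs) \<and> depth_le k (gs @ hs) (max D (Suc d)) \<and>
     (\<forall>i<n. computes_at k (gs @ hs) (Suc d) (\<lambda>xs. if i = 0 then Y i xs else Y i xs + Y (i - 1) xs))"
proof -
  have "computes_at k gs d (Y (Suc i))" "computes_at k gs d (Y i)" if "i < n - 1" for i using Y that by auto
  from add_layer[where N = "n - 1" and f = "\<lambda>i. Y (Suc i)" and g = Y, OF wf dep this]
  obtain hs where hs: "length hs = n - 1" "wf_gates k (gs @ hs)"
     "depth_le k (gs @ hs) (max D (Suc d))" "\<forall>i<n-1. computes_at k (gs @ hs) (Suc d) (\<lambda>xs. Y (Suc i) xs + Y i xs)"
    by blast
  have "computes_at k (gs @ hs) (Suc d) (\<lambda>xs. if i = 0 then Y i xs else Y i xs + Y (i - 1) xs)" if "i < n" for i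
  proof (cases i)
    case 0
    thus ?thesis using computes_at_mono[OF computes_at_append[OF Y[OF that]], of "Suc d"] by simp
  next
    case (Suc j)
    thus ?thesis using hs(4) that by auto
  qed
  thus ?thesis using hs by blast
qed

text \<open>Recursive pairing: add neighbours, take prefix sums of the \<open>n div 2\<close> pair
  sums, which are the prefix sums at odd indices, and spend one more gate per positive even index.
  With \<open>h = n div 2\<close> the count is at most
  \<open>h + 2 * h + (n - 1) div 2 \<le> 2 * n\<close>. Each halving adds one layer before and one
  after the recursive call, hence the depth \<open>2 * t\<close>.\<close>

lemma prefix_sums_parallel:
  assumes "wf_gates k gs" "depth_le k gs D" "\<And>i. i < n \<Longrightarrow> computes_at k gs d (Y i)" "1 \<le> n" "n \<le> 2 ^ t"
  shows "\<exists>hs. length hs \<le> 2 * n \<and> wf_gates k (gs @ hs) \<and> depth_le k (gs @ hs) (max D (d + 2 * t)) \<and>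
     (\<forall>i<n. computes_at k (gs @ hs) (d + 2 * t) (\<lambda>xs. \<Sum>j\<le>i. Y j xs))"
  using assms
proof (induction t arbitrary: n Y gs D d)
  case 0
  hence "n = 1" by simp
  moreover have "computes_at k gs d (\<lambda>xs. \<Sum>j\<le>0. Y j xs)" unfolding sum_atMost_0 using 0 by simp
  ultimately show ?case using 0 by (intro exI[of _ "[]"]) (auto simp: depth_le_def le_max_iff_disj)
next
  case (Suc t)
  show ?case
  proof (cases "n = 1")
    case True
    have "computes_at k gs (d + 2 * Suc t) (Y 0)"
      using Suc.prems True by (auto intro: computes_at_mono)
    hence "computes_at k gs (d + 2 * Suc t) (\<lambda>xs. \<Sum>j\<le>0. Y j xs)" unfolding sum_atMost_0 .
    thus ?thesis using Suc.prems True by (intro exI[of _ "[]"]) (auto simp: depth_le_def le_max_iff_disj)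
  next
    case n: False
    define h where "h = n div 2"
    let ?Z = "\<lambda>i xs. Y (2 * i) xs + Y (2 * i + 1) xs"
    have h: "1 \<le> h" "h \<le> 2 ^ t" "2 * h \<le> n" "n \<le> 2 * h + 1" using n Suc.prems by (auto simp: h_def)
    have "computes_at k gs d (Y (2 * i))" "computes_at k gs d (Y (2 * i + 1))" if "i < h" for i
      using Suc.prems that h by auto
    from add_layer[where N = h and f = "\<lambda>i. Y (2 * i)" and g = "\<lambda>i. Y (2 * i + 1)", OF Suc.prems(1,2) this]
    obtain hs1 where
      hs1: "length hs1 = h" "wf_gates k (gs @ hs1)" "depth_le k (gs @ hs1) (max D (Suc d))"
        "\<forall>i<h. computes_at k (gs @ hs1) (Suc d) (?Z i)" by blast
    from Suc.IH[where Y = ?Z, OF hs1(2,3) hs1(4)[rule_format] h(1,2)] obtain hs2 where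
      hs2: "length hs2 \<le> 2 * h" "wf_gates k ((gs @ hs1) @ hs2)"
        "depth_le k ((gs @ hs1) @ hs2) (max (max D (Suc d)) (Suc d + 2 * t))"
        "\<forall>i<h. computes_at k ((gs @ hs1) @ hs2) (Suc d + 2 * t) (\<lambda>xs. \<Sum>j\<le>i. ?Z j xs)" by blast
    let ?G = "(gs @ hs1) @ hs2"
    have P: "computes_at k ?G (Suc d + 2 * t) (\<lambda>xs. \<Sum>j\<le>2 * i + 1. Y j xs)" if "i < h" for i
      using hs2(4) that unfolding sum_pairs by blast
    have E: "computes_at k ?G (Suc d + 2 * t) (Y i)" if "i < n" for i
      using Suc.prems(3)[OF that] by (auto intro!: computes_at_append intro: computes_at_mono)
    \<comment> \<open>The number of \<open>i\<close> with \<open>2 * i + 2 < n\<close>, that is, of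
      positive even indices; the prefix sum at index 0 is \<open>Y 0\<close> itself.\<close>
    let ?N = "(n - 1) div 2"
    have "computes_at k ?G (Suc d + 2 * t) (\<lambda>xs. \<Sum>j\<le>2 * i + 1. Y j xs)"
         "computes_at k ?G (Suc d + 2 * t) (Y (2 * i + 2))" if "i < ?N" for i
      using P[of i] E[of "2 * i + 2"] that h by auto
    from add_layer[where N = ?N and f = "\<lambda>i xs. \<Sum>j\<le>2 * i + 1. Y j xs" and g = "\<lambda>i. Y (2 * i + 2)",
        OF hs2(2,3) this]
    obtain hs3 where
      hs3: "length hs3 = ?N" "wf_gates k (?G @ hs3)"
        "depth_le k (?G @ hs3) (max (max (max D (Suc d)) (Suc d + 2 * t)) (Suc (Suc d + 2 * t)))"
        "\<forall>i<?N. computes_at k (?G @ hs3) (Suc (Suc d + 2 * t)) (\<lambda>xs. (\<Sum>j\<le>2 * i + 1. Y j xs) + Y (2 * i + 2) xs)"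
      by blast
    have "computes_at k (?G @ hs3) (d + 2 * Suc t) (\<lambda>xs. \<Sum>j\<le>i. Y j xs)" if i: "i < n" for i
    proof (cases "even i")
      case False
      then obtain j where j: "i = 2 * j + 1" by (elim oddE)
      have "computes_at k (?G @ hs3) (Suc d + 2 * t) (\<lambda>xs. \<Sum>j\<le>i. Y j xs)"
        unfolding j by (rule computes_at_append, rule P) (use j i h in simp)
      thus ?thesis by (rule computes_at_mono) simp
    next
      case True
      then obtain j where j: "i = 2 * j" by (elim evenE)
      show ?thesis
      proof (cases j)
        case 0
        have "computes_at k (?G @ hs3) (Suc d + 2 * t) (Y 0)" by (rule computes_at_append[OF E]) (use i in simp)
        hence "computes_at k (?G @ hs3) (d + 2 * Suc t) (Y 0)" by (rule computes_at_mono) simp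
        hence "computes_at k (?G @ hs3) (d + 2 * Suc t) (\<lambda>xs. \<Sum>j\<le>0. Y j xs)" unfolding sum_atMost_0 .
        thus ?thesis using 0 j by simp
      next
        case (Suc l)
        hence "l < ?N" using i j by auto
        hence "computes_at k (?G @ hs3) (Suc (Suc d + 2 * t)) (\<lambda>xs. (\<Sum>j\<le>2 * l + 1. Y j xs) + Y (2 * l + 2) xs)"
          using hs3(4) by blast
        moreover have "(\<lambda>xs. \<Sum>j\<le>i. Y j xs) = (\<lambda>xs. (\<Sum>j\<le>2 * l + 1. Y j xs) + Y (2 * l + 2) xs)"
          unfolding j Suc by (rule ext) (simp only: mult_Suc_right sum.atMost_Suc add_2_eq_Suc add_2_eq_Suc' Suc_eq_plus1[symmetric])
        moreover have "Suc (Suc d + 2 * t) = d + 2 * Suc t" by simp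
        ultimately show ?thesis by (simp only:)
      qed
    qed
    moreover have "max (max (max D (Suc d)) (Suc d + 2 * t)) (Suc (Suc d + 2 * t)) = max D (d + 2 * Suc t)" by auto
    moreover have "length (hs1 @ hs2 @ hs3) \<le> 2 * n" using hs1 hs2 hs3 h by auto
    ultimately show ?thesis using hs3 by (intro exI[of _ "hs1 @ hs2 @ hs3"]) auto
  qed
qed

lemma circuit_of_gates:
  assumes wf: "wf_gates k gs" and dep: "depth_le k gs D"
    and G: "G \<in> carrier_mat n k" and out: "\<And>i. i < n \<Longrightarrow> computes_at k gs D (\<lambda>xs. (G *\<^sub>v vec_of_list xs) $ i)"
  shows "\<exists>c. computes_encoding c G \<and> circuit_size c = length gs \<and> circuit_depth c \<le> D"
proof -
  have "\<forall>i<n. \<exists>w. w < k + length gs \<and> (\<forall>xs. length xs = k \<longrightarrow> wire_values gs xs ! w = (G *\<^sub>v vec_of_list xs) $ i)"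
    using out by (auto simp: computes_at_def)
  then obtain w where w: "\<And>i. i < n \<Longrightarrow> w i < k + length gs"
    "\<And>i xs. i < n \<Longrightarrow> length xs = k \<Longrightarrow> wire_values gs xs ! w i = (G *\<^sub>v vec_of_list xs) $ i"
    by metis
  let ?c = "Circuit k gs (map w [0..<n])"
  have "circuit_eval ?c x = G *\<^sub>v x" if x: "x \<in> carrier_vec k" for x
  proof (rule eq_vecI)
    show "dim_vec (circuit_eval ?c x) = dim_vec (G *\<^sub>v x)" using G by (simp add: circuit_eval_def)
    fix i assume "i < dim_vec (G *\<^sub>v x)"
    hence i: "i < n" using G by simp
    have "length (list_of_vec x) = k" using x by simp
    from w(2)[OF i this] show "circuit_eval ?c x $ i = (G *\<^sub>v x) $ i"
      using i by (simp add: circuit_eval_def vec_of_list_index vec_list)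
  qed
  moreover have "wf_circuit ?c" using wf w(1) by (auto simp: wf_circuit_def wf_gates_def)
  ultimately have "computes_encoding ?c G" using G by (simp add: computes_encoding_def)
  moreover have "circuit_depth ?c \<le> D"
    using dep unfolding circuit_depth_def depth_le_def
    by (auto simp: in_set_conv_nth length_wire_depths)
  ultimately show ?thesis by (intro exI[of _ ?c]) (auto simp: circuit_size_def)
qed

subsection \<open>Encoding circuits and the theorem\<close>

lemma mult_mat_vec_of_bool:
  assumes "y \<in> carrier_vec k" "i < n"
  shows "(mat n k (\<lambda>(i, j). of_bool (R i j)) *\<^sub>v y) $ i = (\<Sum>j\<in>{j. j < k \<and> R i j}. y $ j :: bit)"
proof -
  have "(mat n k (\<lambda>(i, j). of_bool (R i j)) *\<^sub>v y) $ i = (\<Sum>j\<in>{0..<k}. of_bool (R i j) * y $ j)"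
    using assms by (simp add: scalar_prod_def)
  also have "\<dots> = (\<Sum>j\<in>{0..<k}. if R i j then y $ j else 0)"
    by (intro sum.cong refl) (simp split: if_split)
  also have "\<dots> = (\<Sum>j\<in>{j \<in> {0..<k}. R i j}. y $ j)" by (simp only: sum.inter_filter finite_atLeastLessThan)
  also have "{j \<in> {0..<k}. R i j} = {j. j < k \<and> R i j}" by auto
  finally show ?thesis .
qed

lemma accumulator_nth:
  assumes "y \<in> carrier_vec n" "i < n"
  shows "(accumulator_mat n *\<^sub>v y) $ i = (\<Sum>j\<le>i. y $ j)"
  unfolding accumulator_mat_def mult_mat_vec_of_bool[OF assms]
  using assms by (intro sum.cong) auto

lemma derivative_nth:
  assumes "y \<in> carrier_vec n" "i < n"
  shows "(derivative_mat n *\<^sub>v y) $ i = (if i = 0 then y $ i else y $ i + y $ (i - 1))"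
proof -
  have "{j. j < n \<and> (j = i \<or> j + 1 = i)} = (if i = 0 then {i} else {i, i - 1})" using assms by auto
  moreover have "i \<noteq> i - 1" if "i \<noteq> 0" using that by simp
  ultimately show ?thesis
    unfolding derivative_mat_def mult_mat_vec_of_bool[OF assms] by (simp only: sum.insert sum.empty split: if_split) auto
qed

lemma accumulatorT_nth:
  assumes "y \<in> carrier_vec n" "i < n"
  shows "(transpose_mat (accumulator_mat n) *\<^sub>v y) $ i =
    (accumulator_mat n *\<^sub>v vec n (\<lambda>j. y $ reflect n j)) $ reflect n i"
  unfolding transpose_accumulator mult_mat_vec_of_bool[OF assms] accumulator_nth[OF vec_carrier reflect_less[OF assms(2)]]
  by (rule sum.reindex_bij_witness[of _ "reflect n" "reflect n"]) (use assms in \<open>auto simp: reflect_def\<close>)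

lemma derivativeT_nth:
  assumes "y \<in> carrier_vec n" "i < n"
  shows "(transpose_mat (derivative_mat n) *\<^sub>v y) $ i =
    (derivative_mat n *\<^sub>v vec n (\<lambda>j. y $ reflect n j)) $ reflect n i"
proof -
  have "{j. j < n \<and> (j = i \<or> j = Suc i)} = (if reflect n i = 0 then {i} else {i, Suc i})"
    using assms by (auto simp: reflect_def)
  moreover have "vec n (\<lambda>j. y $ reflect n j) $ reflect n i = y $ i"
    using assms by (simp add: reflect_less reflect_reflect)
  moreover have "vec n (\<lambda>j. y $ reflect n j) $ (reflect n i - 1) = y $ Suc i" if "reflect n i \<noteq> 0"
  proof -
    have "reflect n i - 1 < n" "reflect n (reflect n i - 1) = Suc i" using that assms by (auto simp: reflect_def)
    thus ?thesis by simp
  qed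
  ultimately show ?thesis
    unfolding transpose_derivative mult_mat_vec_of_bool[OF assms] derivative_nth[OF vec_carrier reflect_less[OF assms(2)]]
    by (simp only: split: if_split) simp
qed

lemma perm_nth:
  assumes "y \<in> carrier_vec n" "i < n" "p permutes {..<n}"
  shows "(perm_mat n p *\<^sub>v y) $ i = y $ p i"
proof -
  have "{j. j < n \<and> p i = j} = {p i}" using permutes_in_image[OF assms(3), of i] assms(2) by auto
  thus ?thesis unfolding perm_mat_def mult_mat_vec_of_bool[OF assms(1,2)] by simp
qed

lemma repetition_nth:
  assumes "y \<in> carrier_vec (n div 2)" "i < n" "even n"
  shows "(repetition_mat n *\<^sub>v y) $ i = y $ (i div 2)"
proof -
  have "i div 2 < n div 2" using assms(2,3) by presburger
  hence "{j. j < n div 2 \<and> i div 2 = j} = {i div 2}" by auto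
  thus ?thesis unfolding repetition_mat_def mult_mat_vec_of_bool[OF assms(1,2)] by simp
qed

text \<open>\<open>R\<close> is \<open>(=)\<close> for the exact size count and \<open>(\<le>)\<close> for the size of the shallow circuits.\<close>

definition circuit_step :: "(nat \<Rightarrow> nat \<Rightarrow> bool) \<Rightarrow> nat \<Rightarrow> nat \<Rightarrow> nat \<Rightarrow> bit mat \<Rightarrow> bool" where
  "circuit_step R n s e M \<longleftrightarrow> (\<forall>k gs v D. wf_gates k gs \<longrightarrow> depth_le k gs D \<longrightarrow> (\<forall>xs. v xs \<in> carrier_vec n) \<longrightarrow>
     (\<forall>i<n. computes_at k gs D (\<lambda>xs. v xs $ i)) \<longrightarrow>
     (\<exists>hs. R (length hs) s \<and> wf_gates k (gs @ hs) \<and> depth_le k (gs @ hs) (D + e) \<and>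
        (\<forall>i<n. computes_at k (gs @ hs) (D + e) (\<lambda>xs. (M *\<^sub>v v xs) $ i))))"

lemma circuit_stepI:
  assumes "\<And>k gs D (v :: bit list \<Rightarrow> bit vec). wf_gates k gs \<Longrightarrow> depth_le k gs D \<Longrightarrow> (\<And>xs. v xs \<in> carrier_vec n) \<Longrightarrow>
     (\<And>i. i < n \<Longrightarrow> computes_at k gs D (\<lambda>xs. v xs $ i)) \<Longrightarrow>
     \<exists>hs. R (length hs) s \<and> wf_gates k (gs @ hs) \<and> depth_le k (gs @ hs) (D + e) \<and>
        (\<forall>i<n. computes_at k (gs @ hs) (D + e) (\<lambda>xs. (M *\<^sub>v v xs) $ i))"
  shows "circuit_step R n s e M"
  unfolding circuit_step_def
  by (intro allI impI, rule assms) (assumption, assumption, erule spec, erule allE, erule mp)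

lemma circuit_stepE:
  fixes v :: "bit list \<Rightarrow> bit vec"
  assumes "circuit_step R n s e M" "wf_gates k gs" "depth_le k gs D" "\<And>xs. v xs \<in> carrier_vec n"
    and "\<forall>i<n. computes_at k gs D (\<lambda>xs. v xs $ i)"
  obtains hs where "R (length hs) s" "wf_gates k (gs @ hs)" "depth_le k (gs @ hs) (D + e)"
    "\<forall>i<n. computes_at k (gs @ hs) (D + e) (\<lambda>xs. (M *\<^sub>v v xs) $ i)"
proof -
  have "\<exists>hs. R (length hs) s \<and> wf_gates k (gs @ hs) \<and> depth_le k (gs @ hs) (D + e) \<and>
     (\<forall>i<n. computes_at k (gs @ hs) (D + e) (\<lambda>xs. (M *\<^sub>v v xs) $ i))"
    by (rule assms(1)[unfolded circuit_step_def, THEN spec, THEN spec, THEN spec, THEN spec, THEN mp, THEN mp, THEN mp, THEN mp])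
      (rule assms(2), rule assms(3), rule allI, rule assms(4), rule assms(5))
  thus ?thesis using that by (elim exE conjE)
qed

lemma circuit_step_accumulator:
  assumes P: "\<And>k gs D Y. wf_gates k gs \<Longrightarrow> depth_le k gs D \<Longrightarrow> (\<And>i. i < n \<Longrightarrow> computes_at k gs D (Y i)) \<Longrightarrow>
    \<exists>hs. R (length hs) s \<and> wf_gates k (gs @ hs) \<and> depth_le k (gs @ hs) (D + e) \<and>
      (\<forall>i<n. computes_at k (gs @ hs) (D + e) (\<lambda>xs. \<Sum>j\<le>i. Y j xs))"
  shows "circuit_step R n s e (accumulator_mat n)"
proof (rule circuit_stepI)
  fix k gs D and v :: "bit list \<Rightarrow> bit vec"
  assume a: "wf_gates k gs" "depth_le k gs D" and v: "\<And>xs. v xs \<in> carrier_vec n"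
    and c: "\<And>i. i < n \<Longrightarrow> computes_at k gs D (\<lambda>xs. v xs $ i)"
  from P[where Y = "\<lambda>i xs. v xs $ i", OF a c] obtain hs where
    hs: "R (length hs) s" "wf_gates k (gs @ hs)" "depth_le k (gs @ hs) (D + e)"
      "\<forall>i<n. computes_at k (gs @ hs) (D + e) (\<lambda>xs. \<Sum>j\<le>i. v xs $ j)" by blast
  show "\<exists>hs. R (length hs) s \<and> wf_gates k (gs @ hs) \<and> depth_le k (gs @ hs) (D + e) \<and>
      (\<forall>i<n. computes_at k (gs @ hs) (D + e) (\<lambda>xs. (accumulator_mat n *\<^sub>v v xs) $ i))"
  proof (intro exI[of _ hs] conjI hs(1-3) allI impI)
    fix i assume i: "i < n"
    show "computes_at k (gs @ hs) (D + e) (\<lambda>xs. (accumulator_mat n *\<^sub>v v xs) $ i)"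
      unfolding accumulator_nth[OF v i] by (rule hs(4)[rule_format, OF i])
  qed
qed

lemma circuit_step_accumulator_serial: "circuit_step (=) n (n - 1) n (accumulator_mat n)"
  by (rule circuit_step_accumulator, rule prefix_sums_serial)

lemma circuit_step_accumulator_parallel:
  assumes n: "1 \<le> n" "n \<le> 2 ^ t"
  shows "circuit_step (\<le>) n (2 * n) (2 * t) (accumulator_mat n)"
proof (rule circuit_step_accumulator)
  fix k gs D and Y :: "nat \<Rightarrow> bit list \<Rightarrow> bit"
  have D: "max D (D + 2 * t) = D + 2 * t" by simp
  assume "wf_gates k gs" "depth_le k gs D" "\<And>i. i < n \<Longrightarrow> computes_at k gs D (Y i)"
  from prefix_sums_parallel[OF this n, unfolded D]
  show "\<exists>hs. length hs \<le> 2 * n \<and> wf_gates k (gs @ hs) \<and> depth_le k (gs @ hs) (D + 2 * t) \<and>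
      (\<forall>i<n. computes_at k (gs @ hs) (D + 2 * t) (\<lambda>xs. \<Sum>j\<le>i. Y j xs))" .
qed

lemma circuit_step_derivative:
  assumes R: "R (n - 1) (n - 1)"
  shows "circuit_step R n (n - 1) 1 (derivative_mat n)"
proof (rule circuit_stepI)
  fix k gs D and v :: "bit list \<Rightarrow> bit vec"
  assume a: "wf_gates k gs" "depth_le k gs D" and v: "\<And>xs. v xs \<in> carrier_vec n"
    and c: "\<And>i. i < n \<Longrightarrow> computes_at k gs D (\<lambda>xs. v xs $ i)"
  have D: "max D (Suc D) = D + 1" "Suc D = D + 1" by simp_all
  from neighbour_sums[where n = n and Y = "\<lambda>i xs. v xs $ i", OF a c, unfolded D(1), unfolded D(2)] obtain hs where
    hs: "length hs = n - 1" "wf_gates k (gs @ hs)" "depth_le k (gs @ hs) (D + 1)"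
      "\<forall>i<n. computes_at k (gs @ hs) (D + 1) (\<lambda>xs. if i = 0 then v xs $ i else v xs $ i + v xs $ (i - 1))"
    by blast
  have "R (length hs) (n - 1)" using R hs(1) by simp
  thus "\<exists>hs. R (length hs) (n - 1) \<and> wf_gates k (gs @ hs) \<and> depth_le k (gs @ hs) (D + 1) \<and>
      (\<forall>i<n. computes_at k (gs @ hs) (D + 1) (\<lambda>xs. (derivative_mat n *\<^sub>v v xs) $ i))"
  proof (intro exI[of _ hs] conjI hs(2,3) allI impI)
    fix i assume i: "i < n"
    show "computes_at k (gs @ hs) (D + 1) (\<lambda>xs. (derivative_mat n *\<^sub>v v xs) $ i)"
      unfolding derivative_nth[OF v i] by (rule hs(4)[rule_format, OF i])
  qed
qed

text \<open>Reversing the coordinates before and after a layer only relabels wires, so a transposed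
  layer costs exactly as much as the layer itself.\<close>

lemma circuit_step_reflect:
  assumes S: "circuit_step R n s e M"
    and M': "\<And>y i. y \<in> carrier_vec n \<Longrightarrow> i < n \<Longrightarrow>
      (M' *\<^sub>v y) $ i = (M *\<^sub>v vec n (\<lambda>j. y $ reflect n j)) $ reflect n i"
  shows "circuit_step R n s e M'"
proof (rule circuit_stepI)
  fix k gs D and v :: "bit list \<Rightarrow> bit vec"
  assume a: "wf_gates k gs" "depth_le k gs D" and v: "\<And>xs. v xs \<in> carrier_vec n"
    and c: "\<And>i. i < n \<Longrightarrow> computes_at k gs D (\<lambda>xs. v xs $ i)"
  let ?v = "\<lambda>xs. vec n (\<lambda>j. v xs $ reflect n j)"
  have "\<forall>i<n. computes_at k gs D (\<lambda>xs. ?v xs $ i)"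
  proof (intro allI impI)
    fix i assume i: "i < n"
    show "computes_at k gs D (\<lambda>xs. ?v xs $ i)" unfolding index_vec[OF i] by (rule c[OF reflect_less[OF i]])
  qed
  from circuit_stepE[OF S a vec_carrier this] obtain hs where
    hs: "R (length hs) s" "wf_gates k (gs @ hs)" "depth_le k (gs @ hs) (D + e)"
      "\<forall>i<n. computes_at k (gs @ hs) (D + e) (\<lambda>xs. (M *\<^sub>v ?v xs) $ i)" .
  show "\<exists>hs. R (length hs) s \<and> wf_gates k (gs @ hs) \<and> depth_le k (gs @ hs) (D + e) \<and>
      (\<forall>i<n. computes_at k (gs @ hs) (D + e) (\<lambda>xs. (M' *\<^sub>v v xs) $ i))"
  proof (intro exI[of _ hs] conjI hs(1-3) allI impI)
    fix i assume i: "i < n"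
    show "computes_at k (gs @ hs) (D + e) (\<lambda>xs. (M' *\<^sub>v v xs) $ i)"
      unfolding M'[OF v i] by (rule hs(4)[rule_format, OF reflect_less[OF i]])
  qed
qed

text \<open>Permuting coordinates selects other wires and adds no gate, whatever property
  \<open>C\<close> is claimed of the wires.\<close>

lemma all_perm_nth:
  fixes v :: "bit list \<Rightarrow> bit vec"
  assumes p: "p permutes {..<n}" and v: "\<And>xs. v xs \<in> carrier_vec n" and C: "\<forall>i<n. C (\<lambda>xs. v xs $ i)"
  shows "\<forall>i<n. C (\<lambda>xs. (perm_mat n p *\<^sub>v v xs) $ i)"
proof (intro allI impI)
  fix i assume i: "i < n"
  have "p i < n" using permutes_in_image[OF p, of i] i by simp
  thus "C (\<lambda>xs. (perm_mat n p *\<^sub>v v xs) $ i)" unfolding perm_nth[OF v i p] by (rule C[rule_format])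
qed

lemma computes_at_input:
  assumes "j < k"
  shows "computes_at k [] d (\<lambda>xs. vec_of_list xs $ j)"
  unfolding computes_at_def using assms
  by (intro exI[of _ j]) (auto simp: wire_values_def wire_depths_def vec_of_list_index)

lemma wf_gates_Nil: "wf_gates k []" "depth_le k [] 0"
  by (auto simp: wf_gates_def depth_le_def wire_depths_def)

section \<open>Circuits for the whole encoding map\<close>

context
  fixes n :: nat and \<pi> :: "nat \<Rightarrow> nat \<Rightarrow> nat" and M1 M2 :: "bit mat" and G :: "nat \<Rightarrow> bit mat"
  assumes n: "even n"
    and M: "M1 \<in> carrier_mat n n" "M2 \<in> carrier_mat n n"
    and G0: "G 0 = repetition_mat n"
    and GSuc: "\<And>m x. x \<in> carrier_vec (n div 2) \<Longrightarrow> G (Suc m) *\<^sub>v x =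
      M2 *\<^sub>v (perm_mat n (\<pi> (2 * m + 2)) *\<^sub>v (M1 *\<^sub>v (perm_mat n (\<pi> (2 * m + 1)) *\<^sub>v (G m *\<^sub>v x))))"
    and G: "\<And>m. G m \<in> carrier_mat n (n div 2)"
begin

lemma carriers:
  "perm_mat n p *\<^sub>v v \<in> carrier_vec n" "M1 *\<^sub>v v \<in> carrier_vec n" "M2 *\<^sub>v v \<in> carrier_vec n" "G m *\<^sub>v v \<in> carrier_vec n"
proof -
  have "M *\<^sub>v v \<in> carrier_vec n" if "dim_row M = n" for M :: "bit mat"
    using that by (intro carrier_vecI) simp
  thus "perm_mat n p *\<^sub>v v \<in> carrier_vec n" "M1 *\<^sub>v v \<in> carrier_vec n" "M2 *\<^sub>v v \<in> carrier_vec n"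
      "G m *\<^sub>v v \<in> carrier_vec n"
    using carrier_matD(1)[OF M(1)] carrier_matD(1)[OF M(2)] carrier_matD(1)[OF G[of m]]
      carrier_matD(1)[OF mats_carrier(3)[of n p]] by blast+
qed

text \<open>Repetition is fan-out, so it takes no gates and has depth 0. The matrix product
  describes it only on inputs of length \<open>n div 2\<close>, which is why the functions are
  exchanged by \<open>computes_at_cong\<close>.\<close>

lemma code_input: "i < n \<Longrightarrow> computes_at (n div 2) [] 0 (\<lambda>xs. (G 0 *\<^sub>v vec_of_list xs) $ i)"
proof -
  assume i: "i < n"
  have half: "i div 2 < n div 2" using i n by presburger
  have e: "vec_of_list xs $ (i div 2) = (repetition_mat n *\<^sub>v vec_of_list xs) $ i" if "length xs = n div 2" for xs
  proof -
    have "vec_of_list xs \<in> carrier_vec (n div 2)" by (rule carrier_vecI) (simp only: dim_vec_of_list that)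
    from repetition_nth[OF this i n] show ?thesis by (rule sym)
  qed
  have "computes_at (n div 2) [] 0 (\<lambda>xs. vec_of_list xs $ (i div 2)) \<longleftrightarrow>
      computes_at (n div 2) [] 0 (\<lambda>xs. (repetition_mat n *\<^sub>v vec_of_list xs) $ i)"
    by (rule computes_at_cong) (rule e)
  from this computes_at_input[OF half] show ?thesis unfolding G0 by (rule iffD1)
qed

text \<open>Both \<open>(=)\<close> and \<open>(\<le>)\<close> are compatible with addition, so the
  exact count and the upper bound for the shallow circuits come out of one induction over the
  rounds.\<close>

lemma code_gates:
  assumes S: "circuit_step R n s1 e1 M1" "circuit_step R n s2 e2 M2"
    and R: "R 0 0" "\<And>a b a' b'. R a a' \<Longrightarrow> R b b' \<Longrightarrow> R (a + b) (a' + b')"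
    and p: "\<forall>i\<in>{1..2 * m}. \<pi> i permutes {..<n}"
  shows "\<exists>gs. R (length gs) (m * (s1 + s2)) \<and> wf_gates (n div 2) gs \<and> depth_le (n div 2) gs (m * (e1 + e2)) \<and>
    (\<forall>i<n. computes_at (n div 2) gs (m * (e1 + e2)) (\<lambda>xs. (G m *\<^sub>v vec_of_list xs) $ i))"
  using p
proof (induction m)
  case 0
  show ?case
    using code_input wf_gates_Nil R(1) by (intro exI[of _ "[]"] conjI allI impI) simp_all
next
  case (Suc m)
  let ?D = "m * (e1 + e2)"
  from Suc obtain gs where gs: "R (length gs) (m * (s1 + s2))" "wf_gates (n div 2) gs" "depth_le (n div 2) gs ?D"
    "\<forall>i<n. computes_at (n div 2) gs ?D (\<lambda>xs. (G m *\<^sub>v vec_of_list xs) $ i)" by auto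
  have p1: "\<pi> (2 * m + 1) permutes {..<n}" and p2: "\<pi> (2 * m + 2) permutes {..<n}" using Suc.prems by auto
  let ?v1 = "\<lambda>xs. perm_mat n (\<pi> (2 * m + 1)) *\<^sub>v (G m *\<^sub>v vec_of_list xs)"
  have "\<forall>i<n. computes_at (n div 2) gs ?D (\<lambda>xs. ?v1 xs $ i)"
    by (rule all_perm_nth[OF p1 carriers(4) gs(4)])
  from circuit_stepE[OF S(1) gs(2,3) carriers(1) this]
  obtain hs where hs: "R (length hs) s1" "wf_gates (n div 2) (gs @ hs)" "depth_le (n div 2) (gs @ hs) (?D + e1)"
    "\<forall>i<n. computes_at (n div 2) (gs @ hs) (?D + e1) (\<lambda>xs. (M1 *\<^sub>v ?v1 xs) $ i)" .
  let ?v2 = "\<lambda>xs. perm_mat n (\<pi> (2 * m + 2)) *\<^sub>v (M1 *\<^sub>v ?v1 xs)"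
  have "\<forall>i<n. computes_at (n div 2) (gs @ hs) (?D + e1) (\<lambda>xs. ?v2 xs $ i)"
    by (rule all_perm_nth[OF p2 carriers(2) hs(4)])
  from circuit_stepE[OF S(2) hs(2,3) carriers(1) this]
  obtain hs' where hs': "R (length hs') s2" "wf_gates (n div 2) ((gs @ hs) @ hs')"
    "depth_le (n div 2) ((gs @ hs) @ hs') (?D + e1 + e2)"
    "\<forall>i<n. computes_at (n div 2) ((gs @ hs) @ hs') (?D + e1 + e2) (\<lambda>xs. (M2 *\<^sub>v ?v2 xs) $ i)" .
  have D: "?D + e1 + e2 = Suc m * (e1 + e2)" by simp
  have "computes_at (n div 2) ((gs @ hs) @ hs') (?D + e1 + e2) (\<lambda>xs. (G (Suc m) *\<^sub>v vec_of_list xs) $ i)" if "i < n" for i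
  proof -
    have e: "(M2 *\<^sub>v ?v2 xs) $ i = (G (Suc m) *\<^sub>v vec_of_list xs) $ i" if "length xs = n div 2" for xs
    proof -
      have "vec_of_list xs \<in> carrier_vec (n div 2)" by (rule carrier_vecI) (simp only: dim_vec_of_list that)
      from GSuc[OF this] show ?thesis by (simp only:)
    qed
    have "computes_at (n div 2) ((gs @ hs) @ hs') (?D + e1 + e2) (\<lambda>xs. (M2 *\<^sub>v ?v2 xs) $ i) \<longleftrightarrow>
        computes_at (n div 2) ((gs @ hs) @ hs') (?D + e1 + e2) (\<lambda>xs. (G (Suc m) *\<^sub>v vec_of_list xs) $ i)"
      by (rule computes_at_cong) (rule e)
    from this hs'(4)[rule_format, OF that] show ?thesis by (rule iffD1)
  qed
  moreover have "R (length ((gs @ hs) @ hs')) (Suc m * (s1 + s2))"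
    using R(2)[OF gs(1) R(2)[OF hs(1) hs'(1)]] by (simp add: add_ac)
  ultimately show ?case using hs'(2,3) unfolding D by blast
qed

lemma code_circuit:
  assumes "circuit_step R n s1 e1 M1" "circuit_step R n s2 e2 M2"
    and "R 0 0" "\<And>a b a' b'. R a a' \<Longrightarrow> R b b' \<Longrightarrow> R (a + b) (a' + b')"
    and "\<forall>i\<in>{1..2 * m}. \<pi> i permutes {..<n}"
  shows "\<exists>c. computes_encoding c (G m) \<and> R (circuit_size c) (m * (s1 + s2)) \<and> circuit_depth c \<le> m * (e1 + e2)"
proof -
  obtain gs where gs: "R (length gs) (m * (s1 + s2))" "wf_gates (n div 2) gs" "depth_le (n div 2) gs (m * (e1 + e2))"
    "\<forall>i<n. computes_at (n div 2) gs (m * (e1 + e2)) (\<lambda>xs. (G m *\<^sub>v vec_of_list xs) $ i)"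
    using code_gates[OF assms] by blast
  from circuit_of_gates[OF gs(2,3) G gs(4)[rule_format]] gs(1) show ?thesis by fastforce
qed

lemma code_circuits:
  assumes S: "circuit_step (=) n (n - 1) e1 M1" "circuit_step (=) n (n - 1) e2 M2"
    and P: "circuit_step (\<le>) n s1 f1 M1" "circuit_step (\<le>) n s2 f2 M2"
    and s: "s1 + s2 \<le> 3 * n" and f: "f1 + f2 = 2 * t + 1" and t: "real t \<le> log 2 (real n) + 1" and n2: "2 \<le> n"
    and p: "\<forall>i\<in>{1..2 * m}. \<pi> i permutes {..<n}"
  shows "(\<exists>c. computes_encoding c (G m) \<and> circuit_size c = 2 * m * (n - 1)) \<and>
    (\<exists>c. computes_encoding c (G m) \<and> real (circuit_size c) \<le> 5 * real m * real n \<and>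
       real (circuit_depth c) \<le> 5 * real m * log 2 (real n))"
proof
  have "m * (n - 1 + (n - 1)) = 2 * m * (n - 1)" by (simp add: algebra_simps)
  thus "\<exists>c. computes_encoding c (G m) \<and> circuit_size c = 2 * m * (n - 1)"
    using code_circuit[OF S _ _ p] by auto
  obtain c where c: "computes_encoding c (G m)" "circuit_size c \<le> m * (s1 + s2)" "circuit_depth c \<le> m * (f1 + f2)"
    using code_circuit[OF P _ _ p] by auto
  have "circuit_size c \<le> m * (3 * n)" using c(2) mult_le_mono2[OF s] by (rule order_trans)
  hence "real (circuit_size c) \<le> real (m * (3 * n))" by (rule of_nat_mono)
  also have "\<dots> \<le> 5 * real m * real n" by simp
  finally have size: "real (circuit_size c) \<le> 5 * real m * real n" .
  have lg: "1 \<le> log 2 (real n)" using n2 by (simp add: le_log_iff)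
  have "circuit_depth c \<le> m * (2 * t + 1)" using c(3) unfolding f .
  hence "real (circuit_depth c) \<le> real (m * (2 * t + 1))" by (rule of_nat_mono)
  also have "\<dots> = real m * (2 * real t + 1)" by (simp add: distrib_left)
  \<comment> \<open>\<open>2 * t + 1 \<le> 2 * log 2 n + 3 \<le> 5 * log 2 n\<close>, as
    \<open>log 2 n \<ge> 1\<close>. This is the origin of the constant 5; the size alone would allow
    3.\<close>
  also have "\<dots> \<le> real m * (5 * log 2 (real n))" using t lg by (intro mult_left_mono) auto
  finally have "real (circuit_depth c) \<le> 5 * real m * log 2 (real n)" by simp
  thus "\<exists>c. computes_encoding c (G m) \<and> real (circuit_size c) \<le> 5 * real m * real n \<and>
       real (circuit_depth c) \<le> 5 * real m * log 2 (real n)" using c size by blast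
qed

end

lemma encoding_circuits:
  assumes n: "even n" "2 \<le> n" and p: "\<forall>i\<in>{1..2 * m}. \<pi> i permutes {..<n}" and Gm: "Gm \<in> {RDA_mat n \<pi> m, RAD_mat n \<pi> m}"
  shows "(\<exists>c. computes_encoding c Gm \<and> circuit_size c = 2 * m * (n - 1)) \<and>
    (\<exists>c. computes_encoding c Gm \<and> real (circuit_size c) \<le> 5 * real m * real n \<and>
       real (circuit_depth c) \<le> 5 * real m * log 2 (real n))"
proof -
  define t where "t = nat \<lceil>log 2 (real n)\<rceil>"
  have l0: "0 \<le> log 2 (real n)" using n by simp
  have t: "real t \<le> log 2 (real n) + 1" unfolding t_def using l0 by linarith
  have "log 2 (real n) \<le> real t" unfolding t_def using l0 by linarith
  hence "real n \<le> 2 powr real t" using n by (simp add: log_le_iff)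
  hence "real n \<le> real (2 ^ t)" by (simp add: powr_realpow)
  hence nt: "n \<le> 2 ^ t" by (simp only: of_nat_le_iff)
  have n1: "1 \<le> n" using n by simp
  note A_steps = circuit_step_accumulator_serial[of n] circuit_step_accumulator_parallel[OF n1 nt]
  note D_steps = circuit_step_derivative[of "(=)" n, OF refl] circuit_step_derivative[of "(\<le>)" n, OF order_refl]
  show ?thesis
  proof (cases "Gm = RDA_mat n \<pi> m")
    case True
    show ?thesis unfolding True
      by (rule code_circuits[where n = n and ?M1.0 = "derivative_mat n" and ?M2.0 = "accumulator_mat n" and \<pi> = \<pi>
          and t = t and G = "RDA_mat n \<pi>" and m = m and ?s1.0 = "n - 1" and ?s2.0 = "2 * n" and ?f1.0 = 1 and ?f2.0 = "2 * t"])
        (rule n mats_carrier RDA_mult_vec RDA_carrier A_steps D_steps t p | assumption | simp)+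
  next
    case False
    hence G: "Gm = RAD_mat n \<pi> m" using Gm by simp
    show ?thesis unfolding G
      by (rule code_circuits[where n = n and ?M1.0 = "transpose_mat (accumulator_mat n)"
          and ?M2.0 = "transpose_mat (derivative_mat n)" and \<pi> = \<pi> and t = t and G = "RAD_mat n \<pi>" and m = m
          and ?s1.0 = "2 * n" and ?s2.0 = "n - 1" and ?f1.0 = "2 * t" and ?f2.0 = 1])
        (rule n transpose_carrier_mat[THEN iffD2] mats_carrier RAD_mult_vec RAD_carrier
          A_steps[THEN circuit_step_reflect[OF _ accumulatorT_nth]] D_steps[THEN circuit_step_reflect[OF _ derivativeT_nth]]
          t p | assumption | simp)+
  qed
qed

section \<open>The entropy function and the Gilbert-Varshamov distance\<close>

lemma binary_entropy_ln: "binary_entropy p = (- p * ln p - (1 - p) * ln (1 - p)) / ln 2"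
  by (simp add: binary_entropy_def log_def field_simps)

text \<open>The derivative at \<open>p\<close> is \<open>log 2 ((1 - p) / p)\<close>, which is
  positive below \<open>1/2\<close>.\<close>

lemma binary_entropy_strict_mono:
  assumes "0 < x" "x < y" "y \<le> 1/2"
  shows "binary_entropy x < binary_entropy y"
proof (rule DERIV_pos_imp_increasing_open[OF assms(2)])
  fix p assume p: "x < p" "p < y"
  have p': "0 < p" "p < 1/2" using p assms by auto
  have "(binary_entropy has_real_derivative (ln (1 - p) - ln p) / ln 2) (at p)"
  proof -
    have "((\<lambda>p. - p * ln p - (1 - p) * ln (1 - p)) has_real_derivative (ln (1 - p) - ln p)) (at p)"
      using p' by (auto intro!: derivative_eq_intros)
    thus ?thesis unfolding binary_entropy_ln[abs_def] by (rule DERIV_cdivide)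
  qed
  moreover have "(ln (1 - p) - ln p) / ln 2 > 0" using p' by simp
  ultimately show "\<exists>d. (binary_entropy has_real_derivative d) (at p) \<and> 0 < d" by blast
next
  show "continuous_on {x..y} binary_entropy"
    unfolding binary_entropy_ln[abs_def] using assms by (intro continuous_intros) auto
qed

text \<open>\<open>GV_distance\<close> is an \<open>inv_into\<close>, informative only once
  \<open>1/2\<close> is known to be a value of the entropy. The intermediate value theorem provides
  this on \<open>{1/16..1/2}\<close>, away from the singularity of the logarithm at 0.\<close>

lemma GV_half: "0 < GV_distance (1/2)" "GV_distance (1/2) \<le> 1/2" "binary_entropy (GV_distance (1/2)) = 1/2"
proof -
  have half: "binary_entropy (1/2) = 1" by (simp add: binary_entropy_def log_divide)
  \<comment> \<open>At \<open>1/16\<close> the first term is exactly \<open>1/4\<close>; the second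
    is at most \<open>1 / (16 * ln 2)\<close>, by \<open>ln (16/15) \<le> 1/15\<close>.\<close>
  have low: "binary_entropy (1/16) \<le> 1/2"
  proof -
    have l16: "ln (1/16 :: real) = - 4 * ln 2"
      using ln_realpow[of 2 4] by (simp add: ln_div)
    have "ln (16/15 :: real) \<le> 16/15 - 1" by (rule ln_le_minus_one) simp
    hence l15: "- ln (15/16 :: real) \<le> 1/15" by (simp add: ln_div)
    have "ln (2::real) \<ge> 1/2" using ln2_ge_two_thirds by simp
    hence "4/16 * ln 2 + 15/16 * (- ln (15/16)) \<le> 1/2 * ln (2::real)" using l15 by linarith
    moreover have "binary_entropy (1/16) * ln 2 = 4/16 * ln 2 + 15/16 * (- ln (15/16))"
      unfolding binary_entropy_ln using l16 by (simp add: field_simps)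
    ultimately have "binary_entropy (1/16) * ln 2 \<le> 1/2 * ln 2" by linarith
    thus ?thesis by (rule mult_right_le_imp_le) simp
  qed
  have "continuous_on {1/16..1/2} binary_entropy"
    unfolding binary_entropy_ln[abs_def] by (intro continuous_intros) auto
  then obtain x where x: "1/16 \<le> x" "x \<le> 1/2" "binary_entropy x = 1/2"
    using IVT'[of binary_entropy "1/16" "1/2" "1/2"] low half by auto
  hence im: "1 - 1/2 \<in> binary_entropy ` {0..1/2}" by (auto intro!: image_eqI[of _ _ x])
  have e: "binary_entropy (GV_distance (1/2)) = 1 - 1/2" unfolding GV_distance_def by (rule f_inv_into_f[OF im])
  have mem: "GV_distance (1/2) \<in> {0..1/2}" unfolding GV_distance_def by (rule inv_into_into[OF im])
  \<comment> \<open>\<open>inv_into\<close> might pick any preimage in the closed interval; 0 is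
    ruled out because the product with \<open>log 2 0\<close> vanishes and the entropy there is
    0.\<close>
  have "GV_distance (1/2) \<noteq> 0"
  proof
    assume "GV_distance (1/2) = 0"
    thus False using e by (simp add: binary_entropy_def)
  qed
  thus "0 < GV_distance (1/2)" "GV_distance (1/2) \<le> 1/2" "binary_entropy (GV_distance (1/2)) = 1/2"
    using mem e by auto
qed

lemma good_codes_for_epsilon:
  fixes \<epsilon> :: real
  assumes eps: "0 < \<epsilon>"
  shows "\<exists>m::nat. 1/2 - real m / 4 < 0 \<and>
     (\<forall>\<^sub>F n::nat in sequentially. even n \<longrightarrow>
        measure_pmf.prob (random_permutations n (2 * m))
          {\<pi>. \<not> (relative_min_distance (linear_code (RDA_mat n \<pi> m)) \<ge> GV_distance (1/2) - \<epsilon> \<and>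
                relative_min_distance (linear_code (RAD_mat n \<pi> m)) \<ge> GV_distance (1/2) - \<epsilon>)}
          \<le> real n powr (1/2 - real m / 4) \<and>
        (\<forall>\<pi>. (\<forall>i \<in> {1..2 * m}. \<pi> i permutes {..<n}) \<longrightarrow>
          (\<forall>G \<in> {RDA_mat n \<pi> m, RAD_mat n \<pi> m}.
             (\<exists>c. computes_encoding c G \<and> circuit_size c = 2 * m * (n - 1)) \<and>
             (\<exists>c. computes_encoding c G \<and>
                  real (circuit_size c) \<le> 5 * real m * real n \<and>
                  real (circuit_depth c) \<le> 5 * real m * log 2 (real n)))))"
    (is "\<exists>m. _ \<and> (\<forall>\<^sub>F n in sequentially. even n \<longrightarrow> ?prob m n \<and> ?circuits m n)")
proof -
  \<comment> \<open>If \<epsilon> reaches the Gilbert-Varshamov value, the difference is no longer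
    positive; half of that value then keeps \<open>d\<close> in the range of the entropy
    estimates.\<close>
  define d where "d = max (GV_distance (1/2) - \<epsilon>) (GV_distance (1/2) / 2)"
  have d: "0 < d" "d < GV_distance (1/2)" "GV_distance (1/2) - \<epsilon> \<le> d" using GV_half eps by (auto simp: d_def)
  have "binary_entropy d < 1/2"
    using binary_entropy_strict_mono[OF d(1,2)] GV_half by simp
  moreover have "d \<le> 1/2" using d GV_half by simp
  ultimately obtain m0 where m0: "\<And>m. m \<ge> m0 \<Longrightarrow> \<forall>\<^sub>F n in sequentially. even n \<longrightarrow>
      (\<Sum>j=1..n div 2. real ((n div 2) choose j) * ((opD n \<circ> opA n) ^^ m) (\<lambda>w. of_bool (real w < d * real n)) (2 * j))
         \<le> real n powr (1/2 - real m / 4) / 2 \<and>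
      (\<Sum>j=1..n div 2. real ((n div 2) choose j) * ((opA n \<circ> opD n) ^^ m) (\<lambda>w. of_bool (real w < d * real n)) (2 * j))
         \<le> real n powr (1/2 - real m / 4) / 2"
    using first_moment_bounds[OF d(1)] by blast
  \<comment> \<open>3 is the least \<open>m\<close> with \<open>1/2 - m/4 < 0\<close>.\<close>
  define m where "m = max m0 3"
  have mm: "m0 \<le> m" by (simp add: m_def)
  have "\<forall>\<^sub>F n::nat in sequentially. even n \<longrightarrow> ?prob m n \<and> ?circuits m n"
    using m0[OF mm] eventually_ge_at_top[of "2::nat"]
  proof eventually_elim
    case (elim n)
    show ?case
    proof (intro impI conjI)
      assume n: "even n"
      have DA: "weight_kernel n (DA_steps n i) (if odd i then opD n else opA n)" for i
        by (simp add: weight_kernel_deriv weight_kernel_accum)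
      have AD: "weight_kernel n (AD_steps n i) (if odd i then opA n else opD n)" for i
        by (simp add: weight_kernel_derivT weight_kernel_accumT)
      let ?P = "random_permutations n (2 * m)"
      let ?A = "{\<pi>. \<not> d \<le> relative_min_distance (linear_code (RDA_mat n \<pi> m))}"
      let ?B = "{\<pi>. \<not> d \<le> relative_min_distance (linear_code (RAD_mat n \<pi> m))}"
      let ?bad = "{\<pi>. \<not> (relative_min_distance (linear_code (RDA_mat n \<pi> m)) \<ge> GV_distance (1/2) - \<epsilon> \<and>
                relative_min_distance (linear_code (RAD_mat n \<pi> m)) \<ge> GV_distance (1/2) - \<epsilon>)}"
      let ?half = "real n powr (1/2 - real m / 4) / 2"
      have "measure_pmf.prob ?P ?A \<le> ?half"
        by (rule order_trans[OF prob_low_distance[where L = "DA_steps n" and ?K1.0 = "opD n" and ?K2.0 = "opA n"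
              and G = "\<lambda>\<pi>. RDA_mat n \<pi> m", OF DA n elim(2) RDA_carrier supp_RDA[OF _ n]]
              mp[OF elim(1) n, THEN conjunct1]])
      moreover have "measure_pmf.prob ?P ?B \<le> ?half"
        by (rule order_trans[OF prob_low_distance[where L = "AD_steps n" and ?K1.0 = "opA n" and ?K2.0 = "opD n"
              and G = "\<lambda>\<pi>. RAD_mat n \<pi> m", OF AD n elim(2) RAD_carrier supp_RAD[OF _ n]]
              mp[OF elim(1) n, THEN conjunct2]])
      moreover have "measure_pmf.prob ?P ?bad \<le> measure_pmf.prob ?P (?A \<union> ?B)"
        using d by (intro measure_pmf.finite_measure_mono) auto
      moreover have "measure_pmf.prob ?P (?A \<union> ?B) \<le> measure_pmf.prob ?P ?A + measure_pmf.prob ?P ?B"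
        by (rule measure_Un_le) auto
      ultimately show "?prob m n" by linarith
      show "?circuits m n"
        by (intro allI impI ballI) (rule encoding_circuits[OF n elim(2)])
    qed
  qed
  moreover have "1/2 - real m / 4 < 0" by (simp add: m_def)
  ultimately show ?thesis by blast
qed

theorem theorem3p1:
  "\<exists>K::real. K > 0 \<and> (\<forall>\<epsilon>::real. \<epsilon> > 0 \<longrightarrow> (\<exists>m::nat.
     1/2 - real m / 4 < 0 \<and>
     (\<forall>\<^sub>F n::nat in sequentially. even n \<longrightarrow>
        measure_pmf.prob (random_permutations n (2 * m))
          {\<pi>. \<not> (relative_min_distance (linear_code (RDA_mat n \<pi> m)) \<ge> GV_distance (1/2) - \<epsilon> \<and>
                relative_min_distance (linear_code (RAD_mat n \<pi> m)) \<ge> GV_distance (1/2) - \<epsilon>)}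
          \<le> real n powr (1/2 - real m / 4) \<and>
        (\<forall>\<pi>. (\<forall>i \<in> {1..2 * m}. \<pi> i permutes {..<n}) \<longrightarrow>
          (\<forall>G \<in> {RDA_mat n \<pi> m, RAD_mat n \<pi> m}.
             (\<exists>c. computes_encoding c G \<and> circuit_size c = 2 * m * (n - 1)) \<and>
             (\<exists>c. computes_encoding c G \<and>
                  real (circuit_size c) \<le> K * real m * real n \<and>
                  real (circuit_depth c) \<le> K * real m * log 2 (real n)))))))"
  by (rule exI[of _ "5::real"], rule conjI, simp, intro allI impI, rule good_codes_for_epsilon)

end
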